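(* Let $G$ be a finite group and $p$ a fixed prime divisor of $|G|$. Then every non-abelian subgroup of $G$ is a TI-subgroup of $G$ or subnormal in $G$ or has $p'$-order if and only if one of the following statements holds: (1) every non-abelian subgroup of $G$ of order divisible by $p$ is subnormal in $G$; (2) $p>2$ and $G=(Z_q)^r\rtimes(P\times H)$ is a Frobenius group with kernel $(Z_q)^r$ and complement $P\times H$, where $q$ is a prime with $q\neq p$ and $r>1$, $P$ is a Sylow $p$-subgroup of $G$ and $P$ is cyclic, $H$ is a direct product of the quaternion group $Q_8$ and a cyclic group of odd order, and every non-identity subgroup of $P$ acts irreducibly (by conjugation) on $(Z_q)^r$; (3) $p>2$ and $G=(Z_q)^r\rtimes(Z_p\rtimes H)$ is a Frobenius group with kernel $(Z_q)^r$ and complement $Z_p\rtimes H$, where $q$ is a prime with $q\neq p$ and $r>1$, $Z_p$ is a Sylow $p$-subgroup of $G$, $H$ is either a cyclic group or a direct product of the quaternion group $Q_8$ and a cyclic group of odd order such that $[Z_p,H]\neq 1$, and $Z_p$ acts irreducibly (by conjugation) on $(Z_q)^r$.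
   Context: All groups are finite. A subgroup $H$ of a group $G$ is a TI-subgroup of $G$ if for every $g\in G$, $H^g\cap H=1$ or $H^g\cap H=H$. A subgroup has $p'$-order if its order is not divisible by $p$. $Z_n$ denotes the cyclic group of order $n$, $(Z_q)^r$ the elementary abelian group of order $q^r$, and $Q_8$ the quaternion group of order $8$. *)

theory Defs
  imports "HOL-Algebra.Algebra"
begin

definition conj_set :: "('a, 'b) monoid_scheme \<Rightarrow> 'a set \<Rightarrow> 'a \<Rightarrow> 'a set" where
  "conj_set G H g = (\<lambda>h. inv\<^bsub>G\<^esub> g \<otimes>\<^bsub>G\<^esub> h \<otimes>\<^bsub>G\<^esub> g) ` H"

definition TI_subgroup :: "('a, 'b) monoid_scheme \<Rightarrow> 'a set \<Rightarrow> bool" where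
  "TI_subgroup G H \<longleftrightarrow> subgroup H G \<and>
     (\<forall>g \<in> carrier G. conj_set G H g \<inter> H = {\<one>\<^bsub>G\<^esub>} \<or> conj_set G H g \<inter> H = H)"

inductive subnormal :: "('a, 'b) monoid_scheme \<Rightarrow> 'a set \<Rightarrow> bool" for G where
  subnormal_top: "subnormal G (carrier G)"
| subnormal_step: "subnormal G K \<Longrightarrow> H \<lhd> G\<lparr>carrier := K\<rparr> \<Longrightarrow> subnormal G H"

definition nonabelian :: "('a, 'b) monoid_scheme \<Rightarrow> 'a set \<Rightarrow> bool" where
  "nonabelian G H \<longleftrightarrow> (\<exists>x \<in> H. \<exists>y \<in> H. x \<otimes>\<^bsub>G\<^esub> y \<noteq> y \<otimes>\<^bsub>G\<^esub> x)"

definition sylow_subgroup :: "('a, 'b) monoid_scheme \<Rightarrow> nat \<Rightarrow> 'a set \<Rightarrow> bool" where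
  "sylow_subgroup G p P \<longleftrightarrow> subgroup P G \<and> card P = p ^ multiplicity p (order G)"

definition elem_abelian :: "('a, 'b) monoid_scheme \<Rightarrow> 'a set \<Rightarrow> nat \<Rightarrow> nat \<Rightarrow> bool" where
  "elem_abelian G N q r \<longleftrightarrow> subgroup N G \<and> (\<forall>x \<in> N. \<forall>y \<in> N. x \<otimes>\<^bsub>G\<^esub> y = y \<otimes>\<^bsub>G\<^esub> x)
     \<and> (\<forall>x \<in> N. x [^]\<^bsub>G\<^esub> q = \<one>\<^bsub>G\<^esub>) \<and> card N = q ^ r"

definition int_semidirect :: "('a, 'b) monoid_scheme \<Rightarrow> 'a set \<Rightarrow> 'a set \<Rightarrow> 'a set \<Rightarrow> bool" where
  "int_semidirect G N K C \<longleftrightarrow> subgroup C G \<and> N \<lhd> G\<lparr>carrier := C\<rparr> \<and> subgroup K G \<and>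
     N \<inter> K = {\<one>\<^bsub>G\<^esub>} \<and> N <#>\<^bsub>G\<^esub> K = C"

definition int_direct :: "('a, 'b) monoid_scheme \<Rightarrow> 'a set \<Rightarrow> 'a set \<Rightarrow> 'a set \<Rightarrow> bool" where
  "int_direct G A B C \<longleftrightarrow> subgroup A G \<and> subgroup B G \<and>
     (\<forall>a \<in> A. \<forall>b \<in> B. a \<otimes>\<^bsub>G\<^esub> b = b \<otimes>\<^bsub>G\<^esub> a) \<and>
     A \<inter> B = {\<one>\<^bsub>G\<^esub>} \<and> A <#>\<^bsub>G\<^esub> B = C"

definition frobenius :: "('a, 'b) monoid_scheme \<Rightarrow> 'a set \<Rightarrow> 'a set \<Rightarrow> bool" where
  "frobenius G N K \<longleftrightarrow> subgroup K G \<and> K \<noteq> {\<one>\<^bsub>G\<^esub>} \<and> K \<noteq> carrier G \<and>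
     (\<forall>g \<in> carrier G - K. K \<inter> conj_set G K g = {\<one>\<^bsub>G\<^esub>}) \<and>
     N = (carrier G - (\<Union>g \<in> carrier G. conj_set G K g)) \<union> {\<one>\<^bsub>G\<^esub>}"

definition irreducible_on :: "('a, 'b) monoid_scheme \<Rightarrow> 'a set \<Rightarrow> 'a set \<Rightarrow> bool" where
  "irreducible_on G A B \<longleftrightarrow> (\<forall>S. subgroup S G \<and> S \<subseteq> B \<and>
     (\<forall>x \<in> A. \<forall>y \<in> S. (x \<otimes>\<^bsub>G\<^esub> y \<otimes>\<^bsub>G\<^esub> (inv\<^bsub>G\<^esub> x)) \<in> S) \<longrightarrow> S = {\<one>\<^bsub>G\<^esub>} \<or> S = B)"

(* The quaternion group Q_8: elements (s,u), s = sign (True = negative),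
   u \<in> {0,1,2,3} standing for 1, i, j, k. *)
definition q8_umul :: "nat \<Rightarrow> nat \<Rightarrow> bool \<times> nat" where
  "q8_umul u v =
     (if u = 0 then (False, v) else if v = 0 then (False, u)
      else if u = v then (True, 0)
      else ((u, v) \<notin> {(1,2), (2,3), (3,1)}, 6 - u - v))"

definition q8_mult :: "bool \<times> nat \<Rightarrow> bool \<times> nat \<Rightarrow> bool \<times> nat" where
  "q8_mult a b = (let w = q8_umul (snd a) (snd b) in ((fst a \<noteq> fst b) \<noteq> fst w, snd w))"

definition Q8 :: "(bool \<times> nat) monoid" where
  "Q8 = \<lparr>carrier = UNIV \<times> {0,1,2,3}, monoid.mult = q8_mult, one = (False, 0)\<rparr>"

definition Q8_times_odd_cyclic :: "('a, 'b) monoid_scheme \<Rightarrow> 'a set \<Rightarrow> bool" where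
  "Q8_times_odd_cyclic G H \<longleftrightarrow> (\<exists>Q C. int_direct G Q C H \<and> G\<lparr>carrier := Q\<rparr> \<cong> Q8 \<and>
     cyclic_group (G\<lparr>carrier := C\<rparr>) \<and> odd (card C))"

end

theory Submission
  imports Defs
begin

text \<open>A non-subnormal non-abelian subgroup \<open>K\<close> of order divisible by \<open>p\<close> and of maximal order is a
  self-normalizing TI-subgroup, i.e. a Frobenius complement, and a maximal subgroup. By induction on
  the order \<open>K\<close> is solvable, so iterated transfer into the abelian quotients of \<open>K\<close> produces the
  Frobenius kernel \<open>N\<close> without character theory. If \<open>x \<in> K\<close> has order \<open>p\<close> and \<open>D < N\<close> is a non-trivial
  \<open>x\<close>-invariant subgroup, then \<open>D\<langle>x\<rangle>\<close> is TI, which makes \<open>D\<close> a Frobenius complement in \<open>N\<close>;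
  this forces \<open>N\<close> to be an elementary abelian \<open>q\<close>-group on which \<open>x\<close> acts irreducibly. By Schur's lemma
  the centralizer of \<open>x\<close> in \<open>K\<close> is then cyclic, so in particular the configuration \<open>P \<times> H\<close> of
  case (2) never has to be produced: \<open>K\<close> is \<open>\<langle>x\<rangle> \<rtimes> H\<close>, and every subgroup of \<open>H\<close> is normal in \<open>H\<close>
  because the non-abelian subgroups \<open>\<langle>x\<rangle>V\<close> are TI and contain the normal subgroup \<open>\<langle>x\<rangle>\<close> of \<open>K\<close>.\<close>

hide_const (open) Divisibility.prime

section \<open>Conjugation, products and cyclic subgroups\<close>

text \<open>The kernel is defined as a set, and transfer turns it into a subgroup only when the
  complement is solvable. Solvability therefore has to be proved beforehand, for every subgroup
  \<open>Y\<close> with \<open>hyp p Y\<close> and order divisible by \<open>p\<close>, and the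
  non-subnormal case of that induction already needs the analysis of the kernel. This is why the
  TI-or-subnormal condition is stated relative to a subgroup, and why that analysis lives in a
  locale that assumes the kernel to be a subgroup. The fixed-point-free action of \<open>K\<close>
  on \<open>N\<close> enters in two ways. For \<open>k \<noteq> \<one>\<close> in \<open>K\<close>,
  taking commutators with \<open>k\<close> permutes every \<open>k\<close>-invariant subgroup of
  \<open>N\<close>; this forces subnormal subgroups that meet \<open>K\<close> non-trivially to
  contain \<open>N\<close>. And two elements of \<open>K\<close> whose actions commute on one
  non-trivial element of \<open>N\<close> commute, which turns statements about endomorphisms of
  \<open>N\<close> into statements about \<open>K\<close>. For the converse, irreducibility leaves
  two kinds of subgroups containing \<open>x\<close>: those containing \<open>N\<close> and those
  inside \<open>K\<close>.\<close>

definition (in group) cj :: "'a \<Rightarrow> 'a \<Rightarrow> 'a" where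
  "cj g x = g \<otimes> x \<otimes> inv g"

definition (in group) normalizes :: "'a set \<Rightarrow> 'a set \<Rightarrow> bool" where
  "normalizes K N \<longleftrightarrow> (\<forall>k\<in>K. \<forall>n\<in>N. cj k n \<in> N)"

text \<open>Natural exponents suffice for finite groups, where this is the cyclic subgroup generated
  by \<open>x\<close> (see \<open>powers_sg\<close>).\<close>

definition (in group) powers :: "'a \<Rightarrow> 'a set" where
  "powers x = range (\<lambda>i::nat. x [^] i)"

locale fin_group = group G for G (structure) +
  assumes finite_carrier [simp]: "finite (carrier G)"

context group
begin

lemma sgD [dest]: "subgroup H G \<Longrightarrow> x \<in> H \<Longrightarrow> x \<in> carrier G"
  by (rule subgroup.mem_carrier)

lemma sg_mult: "subgroup H G \<Longrightarrow> x \<in> H \<Longrightarrow> y \<in> H \<Longrightarrow> x \<otimes> y \<in> H"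
  by (rule subgroup.m_closed)

lemma sg_inv: "subgroup H G \<Longrightarrow> x \<in> H \<Longrightarrow> inv x \<in> H"
  by (rule subgroup.m_inv_closed)

lemma sg_one: "subgroup H G \<Longrightarrow> \<one> \<in> H"
  by (rule subgroup.one_closed)

lemma sg_pow: "subgroup H G \<Longrightarrow> x \<in> H \<Longrightarrow> x [^] (n::nat) \<in> H"
  by (induction n) (auto simp: sg_one sg_mult)

lemma sg_carrier: "subgroup H G \<Longrightarrow> H \<subseteq> carrier G"
  by (rule subgroup.subset)

lemma sg_Int: "subgroup H G \<Longrightarrow> subgroup K G \<Longrightarrow> subgroup (H \<inter> K) G"
  by (rule subgroups_Inter_pair)

lemma sg_mult_iff1: "subgroup H G \<Longrightarrow> x \<in> H \<Longrightarrow> y \<in> carrier G \<Longrightarrow> x \<otimes> y \<in> H \<longleftrightarrow> y \<in> H"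
  by (metis inv_solve_left sg_inv sg_mult sgD m_closed)

lemma sg_mult_iff2: "subgroup H G \<Longrightarrow> y \<in> H \<Longrightarrow> x \<in> carrier G \<Longrightarrow> x \<otimes> y \<in> H \<longleftrightarrow> x \<in> H"
  by (metis inv_solve_right sg_inv sg_mult sgD m_closed)

lemma sg_inv_iff: "subgroup H G \<Longrightarrow> x \<in> carrier G \<Longrightarrow> inv x \<in> H \<longleftrightarrow> x \<in> H"
  by (metis sg_inv inv_inv)

lemma mult_inv_cancel [simp]: "x \<in> carrier G \<Longrightarrow> y \<in> carrier G \<Longrightarrow> x \<otimes> (inv x \<otimes> y) = y"
  by (simp add: m_assoc[symmetric])

lemma inv_mult_cancel [simp]: "x \<in> carrier G \<Longrightarrow> y \<in> carrier G \<Longrightarrow> inv x \<otimes> (x \<otimes> y) = y"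
  by (simp add: m_assoc[symmetric])

lemma cj_closed [simp, intro]: "g \<in> carrier G \<Longrightarrow> x \<in> carrier G \<Longrightarrow> cj g x \<in> carrier G"
  by (simp add: cj_def)

lemma cj_mult: "\<lbrakk>g \<in> carrier G; x \<in> carrier G; y \<in> carrier G\<rbrakk> \<Longrightarrow> cj g (x \<otimes> y) = cj g x \<otimes> cj g y"
  by (simp add: cj_def m_assoc inv_solve_left)

lemma cj_one_right [simp]: "g \<in> carrier G \<Longrightarrow> cj g \<one> = \<one>"
  by (simp add: cj_def)

lemma cj_one_left [simp]: "x \<in> carrier G \<Longrightarrow> cj \<one> x = x"
  by (simp add: cj_def)

lemma cj_cj: "\<lbrakk>g \<in> carrier G; h \<in> carrier G; x \<in> carrier G\<rbrakk> \<Longrightarrow> cj g (cj h x) = cj (g \<otimes> h) x"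
  by (simp add: cj_def m_assoc inv_mult_group)

lemma cj_inv_left [simp]: "\<lbrakk>g \<in> carrier G; x \<in> carrier G\<rbrakk> \<Longrightarrow> cj (inv g) (cj g x) = x"
  by (simp add: cj_cj)

lemma cj_inv_right [simp]: "\<lbrakk>g \<in> carrier G; x \<in> carrier G\<rbrakk> \<Longrightarrow> cj g (cj (inv g) x) = x"
  by (simp add: cj_cj)

lemma cj_eq_iff [simp]:
  "\<lbrakk>g \<in> carrier G; x \<in> carrier G; y \<in> carrier G\<rbrakk> \<Longrightarrow> cj g x = cj g y \<longleftrightarrow> x = y"
  by (metis cj_inv_left)

lemma cj_eq_one_iff [simp]: "\<lbrakk>g \<in> carrier G; x \<in> carrier G\<rbrakk> \<Longrightarrow> cj g x = \<one> \<longleftrightarrow> x = \<one>"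
  by (metis cj_eq_iff cj_one_right one_closed)

lemma cj_inv: "\<lbrakk>g \<in> carrier G; x \<in> carrier G\<rbrakk> \<Longrightarrow> cj g (inv x) = inv (cj g x)"
  by (metis cj_closed cj_mult cj_one_right inv_closed inv_equality l_inv)

lemma cj_pow: "\<lbrakk>g \<in> carrier G; x \<in> carrier G\<rbrakk> \<Longrightarrow> cj g (x [^] (n::nat)) = cj g x [^] n"
  by (induction n) (auto simp: cj_mult)

lemma cj_fix_iff: "\<lbrakk>g \<in> carrier G; x \<in> carrier G\<rbrakk> \<Longrightarrow> cj g x = x \<longleftrightarrow> g \<otimes> x = x \<otimes> g"
  by (simp add: cj_def inv_solve_right')

lemma cj_fix_sym: "\<lbrakk>g \<in> carrier G; x \<in> carrier G\<rbrakk> \<Longrightarrow> cj g x = x \<longleftrightarrow> cj x g = g"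
  by (metis cj_fix_iff)

lemma cj_mem: "subgroup H G \<Longrightarrow> g \<in> H \<Longrightarrow> x \<in> H \<Longrightarrow> cj g x \<in> H"
  by (simp add: cj_def sg_mult sg_inv)

lemma nonabelianI: "x \<in> H \<Longrightarrow> y \<in> H \<Longrightarrow> x \<otimes> y \<noteq> y \<otimes> x \<Longrightarrow> nonabelian G H"
  by (auto simp: nonabelian_def)

lemma nonabelian_mono: "nonabelian G H \<Longrightarrow> H \<subseteq> K \<Longrightarrow> nonabelian G K"
  by (auto simp: nonabelian_def)

lemma abelianD: "\<not> nonabelian G H \<Longrightarrow> x \<in> H \<Longrightarrow> y \<in> H \<Longrightarrow> x \<otimes> y = y \<otimes> x"
  by (auto simp: nonabelian_def)

lemma normalizesD: "normalizes K N \<Longrightarrow> k \<in> K \<Longrightarrow> n \<in> N \<Longrightarrow> cj k n \<in> N"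
  by (auto simp: normalizes_def)

lemma normalizes_self: "subgroup H G \<Longrightarrow> normalizes H H"
  by (auto simp: normalizes_def cj_mem)

lemma normalizes_mono: "normalizes K N \<Longrightarrow> L \<subseteq> K \<Longrightarrow> normalizes L N"
  by (auto simp: normalizes_def)

lemma mem_set_mult: "x \<in> H <#> K \<longleftrightarrow> (\<exists>h\<in>H. \<exists>k\<in>K. x = h \<otimes> k)"
  by (auto simp: set_mult_def)

lemma set_multI: "h \<in> H \<Longrightarrow> k \<in> K \<Longrightarrow> h \<otimes> k \<in> H <#> K"
  by (auto simp: set_mult_def)

lemma subset_set_mult1: "subgroup N G \<Longrightarrow> subgroup K G \<Longrightarrow> N \<subseteq> N <#> K"
  by (metis mem_set_mult r_one sgD sg_one subsetI)

lemma subset_set_mult2: "subgroup N G \<Longrightarrow> subgroup K G \<Longrightarrow> K \<subseteq> N <#> K"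
  by (metis mem_set_mult l_one sgD sg_one subsetI)

lemma set_mult_subset:
  "subgroup L G \<Longrightarrow> N \<subseteq> L \<Longrightarrow> K \<subseteq> L \<Longrightarrow> N <#> K \<subseteq> L"
  by (auto simp: mem_set_mult sg_mult subset_iff)

lemma subgroup_set_mult:
  assumes N: "subgroup N G" and K: "subgroup K G" and nrm: "normalizes K N"
  shows "subgroup (N <#> K) G"
proof (rule subgroupI)
  show "N <#> K \<subseteq> carrier G"
    using N K by (simp add: sg_carrier set_mult_closed)
  show "N <#> K \<noteq> {}"
    using subset_set_mult1[OF N K] sg_one[OF N] by auto
next
  fix a assume "a \<in> N <#> K"
  then obtain n k where nk: "n \<in> N" "k \<in> K" "a = n \<otimes> k" by (auto simp: mem_set_mult)
  then have c: "n \<in> carrier G" "k \<in> carrier G" using N K by auto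
  have "inv a = cj (inv k) (inv n) \<otimes> inv k"
    using c nk by (simp add: cj_def m_assoc inv_mult_group)
  moreover have "cj (inv k) (inv n) \<in> N"
    using nk nrm by (simp add: normalizesD sg_inv N K)
  ultimately show "inv a \<in> N <#> K" using nk K by (simp add: set_multI sg_inv)
next
  fix a b assume "a \<in> N <#> K" "b \<in> N <#> K"
  then obtain n k n' k' where nk: "n \<in> N" "k \<in> K" "a = n \<otimes> k" "n' \<in> N" "k' \<in> K" "b = n' \<otimes> k'"
    by (auto simp: mem_set_mult)
  then have c: "n \<in> carrier G" "k \<in> carrier G" "n' \<in> carrier G" "k' \<in> carrier G" using N K by auto
  have "a \<otimes> b = (n \<otimes> cj k n') \<otimes> (k \<otimes> k')"
    using c nk by (simp add: cj_def m_assoc inv_solve_left)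
  moreover have "n \<otimes> cj k n' \<in> N"
    using nk nrm by (simp add: normalizesD sg_mult N)
  ultimately show "a \<otimes> b \<in> N <#> K" using nk K by (simp add: set_multI sg_mult)
qed

lemma mult_eq_mult_imp:
  assumes N: "subgroup N G" and K: "subgroup K G" and tr: "N \<inter> K = {\<one>}"
    and m: "n \<in> N" "n' \<in> N" "k \<in> K" "k' \<in> K" "n \<otimes> k = n' \<otimes> k'"
  shows "n = n'" "k = k'"
proof -
  have c: "n \<in> carrier G" "n' \<in> carrier G" "k \<in> carrier G" "k' \<in> carrier G"
    using N K m by auto
  have e: "inv n' \<otimes> n = k' \<otimes> inv k"
    using c m(5) by (metis inv_closed inv_solve_left inv_solve_right m_assoc m_closed)
  have "inv n' \<otimes> n \<in> N \<inter> K"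
    using e m N K by (metis IntI sg_inv sg_mult)
  then have "inv n' \<otimes> n = \<one>" using tr by auto
  then show "n = n'" using c by (metis inv_equality inv_inv inv_closed)
  then show "k = k'" using c m(5) by auto
qed

lemma card_set_mult:
  assumes N: "subgroup N G" and K: "subgroup K G" and tr: "N \<inter> K = {\<one>}"
  shows "card (N <#> K) = card N * card K"
proof -
  have "inj_on (\<lambda>(n,k). n \<otimes> k) (N \<times> K)"
    using mult_eq_mult_imp[OF N K tr] by (auto simp: inj_on_def)
  moreover have "N <#> K = (\<lambda>(n,k). n \<otimes> k) ` (N \<times> K)"
    by (auto simp: set_mult_def image_iff)
  ultimately show ?thesis by (simp add: card_image card_cartesian_product)
qed

text \<open>Dedekind's modular law: for \<open>n\<close> in \<open>L\<close>, the product
  \<open>n \<otimes> k\<close> lies in \<open>L\<close> exactly when \<open>k\<close> does.\<close>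

lemma set_mult_Int:
  assumes N: "subgroup N G" and K: "subgroup K G" and L: "subgroup L G" "N \<subseteq> L"
  shows "(N <#> K) \<inter> L = N <#> (K \<inter> L)"
proof -
  have "k \<in> L" if "n \<in> N" "k \<in> K" "n \<otimes> k \<in> L" for n k
    using that N K L sg_mult_iff1[of L n k] by auto
  moreover have "n \<otimes> k \<in> L" if "n \<in> N" "k \<in> K" "k \<in> L" for n k
    using that L by (auto simp: sg_mult)
  ultimately show ?thesis unfolding set_mult_def by blast
qed

lemma one_mem_powers [simp]: "\<one> \<in> powers x"
  unfolding powers_def by (metis nat_pow_0 rangeI)

lemma self_mem_powers [simp]: "x \<in> carrier G \<Longrightarrow> x \<in> powers x"
  unfolding powers_def by (metis nat_pow_eone rangeI)

lemma powers_subset: "subgroup H G \<Longrightarrow> x \<in> H \<Longrightarrow> powers x \<subseteq> H"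
  by (auto simp: powers_def sg_pow)

lemma powersE: assumes "y \<in> powers x" obtains i :: nat where "y = x [^] i"
  using assms by (auto simp: powers_def)

lemma pow_mem_powers [simp]: "x [^] (i::nat) \<in> powers x"
  by (auto simp: powers_def)

text \<open>Subgroups of subgroups are treated inside \<open>G\<close> throughout; this is the
  bridge from normality in a restricted structure to ambient conjugation.\<close>

lemma normal_relative_iff:
  assumes K: "subgroup K G"
  shows "N \<lhd> G\<lparr>carrier := K\<rparr> \<longleftrightarrow> subgroup N G \<and> N \<subseteq> K \<and> normalizes K N"
proof -
  interpret K: group "G\<lparr>carrier := K\<rparr>" using K by (rule subgroup_imp_group)
  have e: "x \<otimes> h \<otimes> inv\<^bsub>G\<lparr>carrier := K\<rparr>\<^esub> x = cj x h" if "x \<in> K" for x h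
    using that K by (simp add: cj_def)
  show ?thesis
  proof
    assume "N \<lhd> G\<lparr>carrier := K\<rparr>"
    then have "subgroup N (G\<lparr>carrier := K\<rparr>)" and "\<forall>x\<in>K. \<forall>h\<in>N. cj x h \<in> N"
      using e by (auto simp: K.normal_inv_iff)
    then show "subgroup N G \<and> N \<subseteq> K \<and> normalizes K N"
      using incl_subgroup[OF K] subgroup.subset by (fastforce simp: normalizes_def)
  next
    assume "subgroup N G \<and> N \<subseteq> K \<and> normalizes K N"
    then show "N \<lhd> G\<lparr>carrier := K\<rparr>"
      using e K by (auto simp: K.normal_inv_iff normalizes_def subgroup_incl)
  qed
qed

end

section \<open>Finite groups: Lagrange, Cauchy, existence of Sylow subgroups, elements of prime
  order\<close>

context fin_group
begin

lemma sg_finite: "subgroup H G \<Longrightarrow> finite H"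
  by (meson finite_carrier finite_subset sg_carrier)

lemma sg_card_pos: "subgroup H G \<Longrightarrow> card H > 0"
  using sg_finite sg_one card_gt_0_iff by blast

lemma fin_group_sub: "subgroup H G \<Longrightarrow> fin_group (G\<lparr>carrier := H\<rparr>)"
  by (simp add: fin_group_axioms_def fin_group_def sg_finite subgroup_imp_group)

lemma powers_eq_generate: "x \<in> carrier G \<Longrightarrow> powers x = generate G {x}"
  using generate_pow_on_finite_carrier[of x] by (auto simp: powers_def)

lemma powers_sg: "x \<in> carrier G \<Longrightarrow> subgroup (powers x) G"
  by (simp add: powers_eq_generate generate_is_subgroup)

lemma card_powers: "x \<in> carrier G \<Longrightarrow> card (powers x) = ord x"
  by (simp add: powers_eq_generate generate_pow_card)

lemma sg_card_dvd:
  assumes H: "subgroup H G" and K: "subgroup K G" and "H \<subseteq> K"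
  shows "card H dvd card K"
proof -
  interpret K: group "G\<lparr>carrier := K\<rparr>" using K by (rule subgroup_imp_group)
  have "card (rcosets\<^bsub>G\<lparr>carrier := K\<rparr>\<^esub> H) * card H = order (G\<lparr>carrier := K\<rparr>)"
    using assms by (intro K.lagrange subgroup_incl)
  then show ?thesis by (simp add: order_def) (metis dvd_triv_right)
qed

lemma sg_pow_card: "subgroup H G \<Longrightarrow> x \<in> H \<Longrightarrow> x [^] card H = \<one>"
  by (metis card_powers pow_eq_id powers_sg powers_subset sgD sg_card_dvd)

lemma ord_dvd_card: "subgroup H G \<Longrightarrow> x \<in> H \<Longrightarrow> ord x dvd card H"
  by (metis pow_eq_id sgD sg_pow_card)

lemma sg_card_eq: "subgroup K G \<Longrightarrow> H \<subseteq> K \<Longrightarrow> card K \<le> card H \<Longrightarrow> H = K"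
  by (simp add: card_seteq sg_finite)

text \<open>In a finite group the inverse of an element is one of its natural powers, so closure
  under products gives closure under inverses.\<close>

lemma finite_subgroupI:
  assumes "H \<subseteq> carrier G" "\<one> \<in> H" "\<And>x y. x \<in> H \<Longrightarrow> y \<in> H \<Longrightarrow> x \<otimes> y \<in> H"
  shows "subgroup H G"
proof (rule subgroupI)
  fix a assume a: "a \<in> H"
  then have ac: "a \<in> carrier G" using assms(1) by auto
  have "a [^] (n::nat) \<in> H" for n using a assms by (induction n) auto
  moreover have "inv a \<in> powers a"
    using ac by (simp add: powers_sg sg_inv)
  ultimately show "inv a \<in> H" by (auto elim: powersE)
qed (use assms in auto)

lemma cj_image_eq:
  assumes "g \<in> carrier G" "H \<subseteq> carrier G" "\<And>h. h \<in> H \<Longrightarrow> cj g h \<in> H"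
  shows "cj g ` H = H"
proof -
  have "finite H" using assms(2) finite_subset finite_carrier by blast
  moreover have "inj_on (cj g) H"
    using assms(1,2) by (auto simp: inj_on_def subset_iff)
  ultimately show ?thesis
    using assms(3) by (simp add: endo_inj_surj image_subset_iff)
qed

lemma cj_inv_closed:
  assumes "g \<in> carrier G" "H \<subseteq> carrier G" "\<And>h. h \<in> H \<Longrightarrow> cj g h \<in> H" "h \<in> H"
  shows "cj (inv g) h \<in> H"
proof -
  obtain k where "k \<in> H" "h = cj g k"
    using cj_image_eq[OF assms(1-3)] assms(4) by blast
  then show ?thesis using assms(1,2) by (auto simp: subset_iff)
qed

text \<open>Sylow existence holds for every power of \<open>p\<close> dividing the order. Exponent 1
  gives a subgroup of order \<open>p\<close>, and its non-trivial elements have order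
  \<open>p\<close>.\<close>

lemma cauchy:
  assumes K: "subgroup K G" and p: "prime p" "p dvd card K"
  obtains x where "x \<in> K" "ord x = p"
proof -
  interpret K: fin_group "G\<lparr>carrier := K\<rparr>" using K by (rule fin_group_sub)
  obtain m where "card K = p * m" using p by auto
  then have "\<exists>H. subgroup H (G\<lparr>carrier := K\<rparr>) \<and> card H = p ^ 1"
    using p K by (intro sylow_thm[where m = m]) (auto simp: order_def sg_finite K.is_group)
  then obtain H where H: "subgroup H G" "H \<subseteq> K" "card H = p"
    using incl_subgroup[OF K] subgroup.subset by fastforce
  have "card H > 1" using H p prime_gt_1_nat by auto
  then obtain x where x: "x \<in> H" "x \<noteq> \<one>"
    by (metis card_1_singleton_iff card_le_Suc0_iff_eq H(1) sg_finite leD One_nat_def sg_one)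
  have "ord x dvd p" using ord_dvd_card[OF H(1) x(1)] H by simp
  moreover have "ord x \<noteq> 1" using x H ord_eq_1 by blast
  ultimately have "ord x = p" using p by (metis prime_nat_iff)
  then show ?thesis using that x H by blast
qed

lemma sylow_exists:
  assumes K: "subgroup K G" and p: "prime p"
  obtains P where "subgroup P G" "P \<subseteq> K" "card P = p ^ multiplicity p (card K)"
proof -
  interpret K: fin_group "G\<lparr>carrier := K\<rparr>" using K by (rule fin_group_sub)
  obtain m where "card K = p ^ multiplicity p (card K) * m"
    using multiplicity_dvd by blast
  then have "\<exists>H. subgroup H (G\<lparr>carrier := K\<rparr>) \<and> card H = p ^ multiplicity p (card K)"
    using p K by (intro sylow_thm[where m = m]) (auto simp: order_def sg_finite K.is_group)
  then show ?thesis
    using that incl_subgroup[OF K] subgroup.subset by fastforce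
qed

lemma prime_ord_powers_eq:
  assumes x: "x \<in> carrier G" "prime (ord x)" and y: "y \<in> powers x" "y \<noteq> \<one>"
  shows "powers y = powers x" "ord y = ord x"
proof -
  have yc: "y \<in> carrier G" using y x powers_sg by blast
  have "ord y dvd ord x" using ord_dvd_card[OF powers_sg y(1)] x by (simp add: card_powers)
  moreover have "ord y \<noteq> 1" using y yc ord_eq_1 by blast
  ultimately show o: "ord y = ord x" using x by (metis prime_nat_iff)
  show "powers y = powers x"
    using sg_card_eq[OF powers_sg[OF x(1)] powers_subset[OF powers_sg[OF x(1)] y(1)]] o x yc
    by (simp add: card_powers)
qed

lemma prime_card_trivial_Int:
  assumes x: "x \<in> carrier G" "prime (ord x)" and H: "subgroup H G" and n: "x \<notin> H"
  shows "powers x \<inter> H = {\<one>}"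
proof -
  have "y = \<one>" if "y \<in> powers x" "y \<in> H" for y
  proof (rule ccontr)
    assume "y \<noteq> \<one>"
    then have "powers y = powers x" using prime_ord_powers_eq x that by blast
    then have "x \<in> H" using powers_subset[OF H \<open>y \<in> H\<close>] x by auto
    with n show False by simp
  qed
  then show ?thesis using H sg_one by auto
qed

lemma normalizes_powers:
  assumes x: "x \<in> carrier G" and N: "subgroup N G" and c: "\<And>n. n \<in> N \<Longrightarrow> cj x n \<in> N"
  shows "normalizes (powers x) N"
proof -
  have "cj (x [^] (i::nat)) n \<in> N" if "n \<in> N" for n i
  proof (induction i)
    case (Suc i)
    have "n \<in> carrier G" using that N by auto
    then have "cj (x [^] Suc i) n = cj x (cj (x [^] i) n)"
      using x by (simp add: cj_cj flip: nat_pow_Suc2)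
    then show ?case using Suc c by simp
  qed (use that N in auto)
  then show ?thesis by (auto simp: normalizes_def powers_def)
qed

end

section \<open>Transfer and Frobenius kernels\<close>

context fin_group
begin

text \<open>The double cosets \<open>H s H\<close> with \<open>s \<notin> H\<close> carry the function \<open>h s k \<mapsto> \<phi> h\<close>, which is
  well defined because \<open>\<phi>\<close> kills \<open>H \<inter> s H s\<^sup>-\<^sup>1\<close>. It serves as a section for the transfer
  and is right \<open>H\<close>-invariant off \<open>H\<close>, so the transfer agrees with \<open>\<phi>\<close> on \<open>H\<close>.\<close>

lemma transfer_section:
  fixes A :: "('c, 'd) monoid_scheme" and \<phi> :: "'a \<Rightarrow> 'c"
  assumes Y: "subgroup Y G" and H: "subgroup H G" "H \<subseteq> Y" and A: "comm_group A"
    and phi: "\<And>h. h \<in> H \<Longrightarrow> \<phi> h \<in> carrier A"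
    and hom: "\<And>h k. h \<in> H \<Longrightarrow> k \<in> H \<Longrightarrow> \<phi> (h \<otimes> k) = \<phi> h \<otimes>\<^bsub>A\<^esub> \<phi> k"
    and triv: "\<And>g u. g \<in> Y - H \<Longrightarrow> u \<in> H \<Longrightarrow> cj g u \<in> H \<Longrightarrow> \<phi> (cj g u) = \<one>\<^bsub>A\<^esub>"
  obtains f where "\<And>g. g \<in> Y \<Longrightarrow> f g \<in> carrier A"
    and "\<And>h g. h \<in> H \<Longrightarrow> g \<in> Y \<Longrightarrow> f (h \<otimes> g) = \<phi> h \<otimes>\<^bsub>A\<^esub> f g"
    and "\<And>g k. g \<in> Y - H \<Longrightarrow> k \<in> H \<Longrightarrow> f (g \<otimes> k) = f g"
    and "\<And>h. h \<in> H \<Longrightarrow> f h = \<phi> h"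
proof -
  interpret A: comm_group A by (rule A)
  have Yc: "y \<in> carrier G" if "y \<in> Y" for y using that Y by auto
  have Hc: "y \<in> carrier G" if "y \<in> H" for y using that H by auto
  define dc where "dc g = {h \<otimes> g \<otimes> k | h k. h \<in> H \<and> k \<in> H}" for g
  \<comment> \<open>The choice is made from the set \<open>dc g\<close>, so all elements of a double
    coset receive the same representative.\<close>
  define rep where "rep g = (SOME s. s \<in> dc g)" for g
  define f where "f g = (if g \<in> H then \<phi> g else \<phi> (SOME h. h \<in> H \<and> (\<exists>k\<in>H. g = h \<otimes> rep g \<otimes> k)))" for g
  have self: "g \<in> dc g" if "g \<in> Y" for g
  proof -
    have "g = \<one> \<otimes> g \<otimes> \<one>" using Yc[OF that] by simp
    then show ?thesis unfolding dc_def using H sg_one by blast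
  qed
  have rep: "rep g \<in> dc g" if "g \<in> Y" for g
    unfolding rep_def using self[OF that] by (rule someI)
  have repY: "rep g \<in> Y - H" if g: "g \<in> Y - H" for g
  proof -
    obtain h k where hk: "h \<in> H" "k \<in> H" "rep g = h \<otimes> g \<otimes> k"
      using rep[of g] g by (auto simp: dc_def)
    have "rep g \<in> Y" using hk g H Y by (auto simp: sg_mult subset_iff)
    moreover have "rep g \<notin> H"
      using hk g H Yc Hc by (simp add: sg_mult_iff1 sg_mult_iff2)
    ultimately show ?thesis by simp
  qed
  have ex: "\<exists>h. h \<in> H \<and> (\<exists>k\<in>H. g = h \<otimes> rep g \<otimes> k)" if g: "g \<in> Y - H" for g
  proof -
    obtain h k where hk: "h \<in> H" "k \<in> H" "rep g = h \<otimes> g \<otimes> k"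
      using rep[of g] g by (auto simp: dc_def)
    have "g = inv h \<otimes> rep g \<otimes> inv k"
      using hk g Yc Hc by (simp add: m_assoc inv_solve_left)
    moreover have "inv h \<in> H" "inv k \<in> H" using hk H by (simp_all add: sg_inv)
    ultimately show ?thesis by blast
  qed
  \<comment> \<open>Two decompositions of one element satisfy
    \<open>cj s (k' \<otimes> inv k) = inv h' \<otimes> h\<close>. This is an element of
    \<open>H\<close> fused by \<open>s \<notin> H\<close>, so \<open>triv\<close> makes its image
    trivial.\<close>
  have uniq: "\<phi> h = \<phi> h'"
    if "s \<in> Y - H" "h \<in> H" "h' \<in> H" "k \<in> H" "k' \<in> H" "h \<otimes> s \<otimes> k = h' \<otimes> s \<otimes> k'" for s h h' k k'
  proof -
    have c: "s \<in> carrier G" "h \<in> carrier G" "h' \<in> carrier G" "k \<in> carrier G" "k' \<in> carrier G"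
      using that Yc Hc by auto
    have "h' \<otimes> (s \<otimes> (k' \<otimes> inv k)) = h \<otimes> s"
      using that(6) c by (metis inv_closed inv_solve_right m_assoc m_closed)
    then have e: "cj s (k' \<otimes> inv k) = inv h' \<otimes> h"
      using c unfolding cj_def by (metis inv_closed inv_solve_left inv_solve_right m_assoc m_closed)
    then have "cj s (k' \<otimes> inv k) \<in> H" using that H by (simp add: sg_mult sg_inv)
    then have "\<phi> (inv h' \<otimes> h) = \<one>\<^bsub>A\<^esub>"
      using triv[of s "k' \<otimes> inv k"] that H e by (simp add: sg_mult sg_inv)
    moreover have "h = h' \<otimes> (inv h' \<otimes> h)" using c by (simp add: m_assoc[symmetric])
    ultimately show ?thesis
      using hom[of h' "inv h' \<otimes> h"] that H phi by (simp add: sg_mult sg_inv)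
  qed
  have feq: "f g = \<phi> h" if "g \<in> Y - H" "h \<in> H" "k \<in> H" "g = h \<otimes> rep g \<otimes> k" for g h k
  proof -
    define h' where "h' = (SOME h. h \<in> H \<and> (\<exists>k\<in>H. g = h \<otimes> rep g \<otimes> k))"
    have "h' \<in> H \<and> (\<exists>k\<in>H. g = h' \<otimes> rep g \<otimes> k)"
      unfolding h'_def by (rule someI_ex) (rule ex[OF that(1)])
    then have "\<phi> h' = \<phi> h" using uniq[OF repY[OF that(1)]] that by metis
    then show ?thesis using that by (simp add: f_def h'_def)
  qed
  have dc_eq: "dc (h \<otimes> g \<otimes> k) = dc g" if "g \<in> Y" "h \<in> H" "k \<in> H" for g h k
  proof -
    have c: "g \<in> carrier G" "h \<in> carrier G" "k \<in> carrier G" using that Yc Hc by auto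
    have "x \<in> dc g" if x: "x \<in> dc (h \<otimes> g \<otimes> k)" for x
    proof -
      obtain a b where ab: "a \<in> H" "b \<in> H" "x = a \<otimes> (h \<otimes> g \<otimes> k) \<otimes> b" using x by (auto simp: dc_def)
      then have "x = (a \<otimes> h) \<otimes> g \<otimes> (k \<otimes> b)" using c Hc by (simp add: m_assoc)
      moreover have "a \<otimes> h \<in> H" "k \<otimes> b \<in> H" using ab \<open>h \<in> H\<close> \<open>k \<in> H\<close> H by (simp_all add: sg_mult)
      ultimately show ?thesis unfolding dc_def by blast
    qed
    moreover have "x \<in> dc (h \<otimes> g \<otimes> k)" if x: "x \<in> dc g" for x
    proof -
      obtain a b where ab: "a \<in> H" "b \<in> H" "x = a \<otimes> g \<otimes> b" using x by (auto simp: dc_def)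
      then have "x = (a \<otimes> inv h) \<otimes> (h \<otimes> g \<otimes> k) \<otimes> (inv k \<otimes> b)"
        using c Hc by (simp add: m_assoc)
      moreover have "a \<otimes> inv h \<in> H" "inv k \<otimes> b \<in> H"
        using ab \<open>h \<in> H\<close> \<open>k \<in> H\<close> H by (simp_all add: sg_mult sg_inv)
      ultimately show ?thesis unfolding dc_def by blast
    qed
    ultimately show ?thesis by blast
  qed
  have fhk: "f (h \<otimes> g \<otimes> k) = \<phi> h \<otimes>\<^bsub>A\<^esub> f g" if "g \<in> Y - H" "h \<in> H" "k \<in> H" for g h k
  proof -
    have c: "g \<in> carrier G" "h \<in> carrier G" "k \<in> carrier G" using that Yc Hc by auto
    obtain a b where ab: "a \<in> H" "b \<in> H" "g = a \<otimes> rep g \<otimes> b" using ex[of g] \<open>g \<in> Y - H\<close> by blast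
    have r: "rep (h \<otimes> g \<otimes> k) = rep g" using dc_eq[of g h k] that by (simp add: rep_def)
    have rc: "rep g \<in> carrier G" using repY[OF that(1)] Yc by auto
    have "h \<otimes> g \<otimes> k = h \<otimes> (a \<otimes> rep g \<otimes> b) \<otimes> k" using ab(3) by simp
    also have "\<dots> = (h \<otimes> a) \<otimes> rep g \<otimes> (b \<otimes> k)" using ab(1,2) c rc Hc by (simp add: m_assoc)
    finally have "h \<otimes> g \<otimes> k = (h \<otimes> a) \<otimes> rep (h \<otimes> g \<otimes> k) \<otimes> (b \<otimes> k)" using r by simp
    moreover have "h \<otimes> g \<otimes> k \<in> Y - H"
      using that c H Y by (auto simp: sg_mult sg_mult_iff1 sg_mult_iff2 subset_iff)
    ultimately have "f (h \<otimes> g \<otimes> k) = \<phi> (h \<otimes> a)" using feq that ab H sg_mult by metis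
    moreover have "f g = \<phi> a" using feq[OF that(1) ab] .
    ultimately show ?thesis using hom that ab by simp
  qed
  have p1: "\<phi> \<one> = \<one>\<^bsub>A\<^esub>"
    using hom[of \<one> \<one>] phi[of \<one>] H sg_one by (simp)
  have f_closed: "f g \<in> carrier A" if "g \<in> Y" for g
  proof (cases "g \<in> H")
    case False
    then show ?thesis using ex[of g] feq[of g] that phi by (metis DiffI)
  qed (simp add: f_def phi)
  show ?thesis
  proof (rule that)
    fix h g assume h: "h \<in> H" and g: "g \<in> Y"
    show "f (h \<otimes> g) = \<phi> h \<otimes>\<^bsub>A\<^esub> f g"
    proof (cases "g \<in> H")
      case True
      then show ?thesis using h H hom by (simp add: f_def sg_mult)
    next
      case False
      then show ?thesis using fhk[of g h \<one>] g h H sg_one Yc Hc by simp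
    qed
  next
    fix g k assume "g \<in> Y - H" "k \<in> H"
    then show "f (g \<otimes> k) = f g"
      using fhk[of g \<one> k] H sg_one Yc Hc p1 f_closed by simp
  next
    fix h assume "h \<in> H"
    then show "f h = \<phi> h" by (simp add: f_def)
  qed (simp add: f_closed)
qed

text \<open>\<open>V\<close> is the transfer: a product over the right cosets of \<open>H\<close>,
  where the coset of \<open>s\<close> contributes \<open>f (s \<otimes> g)\<close> divided by
  \<open>f s\<close>. Left equivariance of \<open>f\<close> makes this independent of
  \<open>s\<close>; right invariance off \<open>H\<close> leaves only the coset \<open>H\<close>
  when \<open>g\<close> lies in \<open>H\<close>.\<close>

lemma transfer_extension:
  fixes A :: "('c, 'd) monoid_scheme" and \<phi> :: "'a \<Rightarrow> 'c"
  assumes Y: "subgroup Y G" and H: "subgroup H G" "H \<subseteq> Y" and A: "comm_group A"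
    and phi: "\<And>h. h \<in> H \<Longrightarrow> \<phi> h \<in> carrier A"
    and hom: "\<And>h k. h \<in> H \<Longrightarrow> k \<in> H \<Longrightarrow> \<phi> (h \<otimes> k) = \<phi> h \<otimes>\<^bsub>A\<^esub> \<phi> k"
    and triv: "\<And>g u. g \<in> Y - H \<Longrightarrow> u \<in> H \<Longrightarrow> cj g u \<in> H \<Longrightarrow> \<phi> (cj g u) = \<one>\<^bsub>A\<^esub>"
  obtains V where "\<And>y. y \<in> Y \<Longrightarrow> V y \<in> carrier A"
    and "\<And>y z. y \<in> Y \<Longrightarrow> z \<in> Y \<Longrightarrow> V (y \<otimes> z) = V y \<otimes>\<^bsub>A\<^esub> V z"
    and "\<And>h. h \<in> H \<Longrightarrow> V h = \<phi> h"
proof -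
  interpret A: comm_group A by (rule A)
  obtain f where fc: "\<And>g. g \<in> Y \<Longrightarrow> f g \<in> carrier A"
    and fl: "\<And>h g. h \<in> H \<Longrightarrow> g \<in> Y \<Longrightarrow> f (h \<otimes> g) = \<phi> h \<otimes>\<^bsub>A\<^esub> f g"
    and fr: "\<And>g k. g \<in> Y - H \<Longrightarrow> k \<in> H \<Longrightarrow> f (g \<otimes> k) = f g"
    and fH: "\<And>h. h \<in> H \<Longrightarrow> f h = \<phi> h"
    by (rule transfer_section[OF assms]) auto
  have Yc: "y \<in> carrier G" if "y \<in> Y" for y using that Y by auto
  have HY: "h \<in> Y" if "h \<in> H" for h using that H by auto
  define R where "R = (\<lambda>y. H #> y) ` Y"
  define F where "F g c = f ((SOME s. s \<in> c) \<otimes> g) \<otimes>\<^bsub>A\<^esub> inv\<^bsub>A\<^esub> f (SOME s. s \<in> c)" for g c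
  define V where "V g = finprod A (F g) R" for g
  have finR: "finite R" unfolding R_def using Y sg_finite by blast
  have F: "F g (H #> s) = f (s \<otimes> g) \<otimes>\<^bsub>A\<^esub> inv\<^bsub>A\<^esub> f s" if "g \<in> Y" "s \<in> Y" for g s
  proof -
    define t where "t = (SOME t. t \<in> H #> s)"
    have "s \<in> H #> s" using H Yc that by (simp add: rcos_self)
    then have "t \<in> H #> s" unfolding t_def by (rule someI)
    then obtain h where h: "h \<in> H" "t = h \<otimes> s" by (auto simp: r_coset_def)
    have "f (t \<otimes> g) = \<phi> h \<otimes>\<^bsub>A\<^esub> f (s \<otimes> g)"
      using fl[of h "s \<otimes> g"] h that Y Yc HY by (simp add: m_assoc sg_mult)
    moreover have "f t = \<phi> h \<otimes>\<^bsub>A\<^esub> f s" using fl h that by simp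
    moreover have "f (s \<otimes> g) \<in> carrier A" "f s \<in> carrier A" "\<phi> h \<in> carrier A"
      using fc that Y h phi by (auto simp: sg_mult)
    ultimately show ?thesis
      by (simp add: F_def t_def[symmetric] A.inv_mult_group A.m_comm[of "\<phi> h"] A.m_assoc)
  qed
  have FR: "F g c \<in> carrier A" if "g \<in> Y" "c \<in> R" for g c
    using that F fc Y by (auto simp: R_def sg_mult)
  have act: "(H #> s) #> g = H #> (s \<otimes> g)" if "s \<in> Y" "g \<in> Y" for s g
    using that H Yc by (simp add: coset_mult_assoc sg_carrier)
  have bij: "bij_betw (\<lambda>c. c #> g) R R" if "g \<in> Y" for g
  proof (rule bij_betw_byWitness[where f' = "\<lambda>c. c #> inv g"])
    show "\<forall>c\<in>R. c #> g #> inv g = c" "\<forall>c\<in>R. c #> inv g #> g = c"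
      using that Y Yc H by (auto simp: R_def act sg_mult sg_inv m_assoc coset_mult_assoc sg_carrier)
    show "(\<lambda>c. c #> g) ` R \<subseteq> R" "(\<lambda>c. c #> inv g) ` R \<subseteq> R"
      using that Y by (auto simp: R_def act sg_mult sg_inv)
  qed
  have Vc: "V g \<in> carrier A" if "g \<in> Y" for g
    unfolding V_def using FR that by (intro A.finprod_closed) auto
  have "V (g \<otimes> g') = V g \<otimes>\<^bsub>A\<^esub> V g'" if gg: "g \<in> Y" "g' \<in> Y" for g g'
  proof -
    \<comment> \<open>The cocycle identity: the middle term \<open>f (s \<otimes> g)\<close>
      cancels. Since \<open>g\<close> permutes the cosets, reindexing the second factor gives
      multiplicativity.\<close>
    have "F (g \<otimes> g') c = F g c \<otimes>\<^bsub>A\<^esub> F g' (c #> g)" if "c \<in> R" for c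
    proof -
      obtain s where s: "s \<in> Y" "c = H #> s" using \<open>c \<in> R\<close> by (auto simp: R_def)
      have "f (s \<otimes> g \<otimes> g') \<in> carrier A" "f (s \<otimes> g) \<in> carrier A" "f s \<in> carrier A"
        using fc s gg Y by (auto simp: sg_mult)
      then show ?thesis
        using s gg Y Yc A.m_comm[of "f (s \<otimes> g) \<otimes>\<^bsub>A\<^esub> inv\<^bsub>A\<^esub> f s" "f (s \<otimes> g \<otimes> g') \<otimes>\<^bsub>A\<^esub> inv\<^bsub>A\<^esub> f (s \<otimes> g)"]
        by (simp add: act F sg_mult m_assoc A.m_assoc)
    qed
    moreover have "c #> g \<in> R" if "c \<in> R" for c
      using bij[OF gg(1)] that by (auto simp: bij_betw_def)
    ultimately have "V (g \<otimes> g') = finprod A (\<lambda>c. F g c \<otimes>\<^bsub>A\<^esub> F g' (c #> g)) R"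
      unfolding V_def using FR gg by (intro A.finprod_cong') auto
    also have "\<dots> = V g \<otimes>\<^bsub>A\<^esub> finprod A (\<lambda>c. F g' (c #> g)) R"
      unfolding V_def using FR gg bij[OF gg(1)]
      by (intro A.finprod_multf) (auto simp: bij_betw_def)
    also have "finprod A (\<lambda>c. F g' (c #> g)) R = finprod A (F g') ((\<lambda>c. c #> g) ` R)"
      using bij[OF gg(1)] FR gg by (intro A.finprod_reindex[symmetric]) (auto simp: bij_betw_def)
    also have "\<dots> = V g'" using bij[OF gg(1)] by (simp add: V_def bij_betw_def)
    finally show ?thesis .
  qed
  moreover have "V h = \<phi> h" if h: "h \<in> H" for h
  proof -
    have H1: "H #> \<one> = H" using H by (simp add: sg_carrier)
    have HR: "H \<in> R" unfolding R_def using H1 Y sg_one by (metis image_eqI)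
    have off: "F h c = \<one>\<^bsub>A\<^esub>" if "c \<in> R - {H}" for c
    proof -
      obtain s where s: "s \<in> Y" "c = H #> s" using \<open>c \<in> R - {H}\<close> by (auto simp: R_def)
      then have "s \<notin> H" using that H Yc by (auto simp: coset_join2)
      then show ?thesis using F[of h s] fr[of s h] s h HY fc by simp
    qed
    have on: "F h H = \<phi> h"
    proof -
      have "\<phi> \<one> = \<one>\<^bsub>A\<^esub>" using hom[of \<one> \<one>] phi[of \<one>] H sg_one by simp
      then show ?thesis
        using F[of h \<one>] H1 h HY Y Yc H sg_one fH phi by simp
    qed
    have "V h = finprod A (F h) (insert H (R - {H}))" using HR by (simp add: V_def insert_absorb)
    also have "\<dots> = F h H \<otimes>\<^bsub>A\<^esub> finprod A (F h) (R - {H})"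
      using finR FR h HY HR by (intro A.finprod_insert) auto
    also have "finprod A (F h) (R - {H}) = \<one>\<^bsub>A\<^esub>" using off by (intro A.finprod_one_eqI) auto
    finally show ?thesis using on phi h by simp
  qed
  ultimately show ?thesis using that Vc by blast
qed

text \<open>\<open>cj h k \<otimes> inv k\<close> is the commutator of \<open>h\<close> and
  \<open>k\<close>. The hypothesis says that \<open>H / L\<close> is abelian; this form is used
  throughout in place of quotient groups.\<close>

lemma commutators_imp_normalizes:
  assumes H: "subgroup H G" and L: "subgroup L G" "L \<subseteq> H"
    and comm: "\<And>h k. h \<in> H \<Longrightarrow> k \<in> H \<Longrightarrow> cj h k \<otimes> inv k \<in> L"
  shows "normalizes H L"
proof -
  have "cj h k \<in> L" if "h \<in> H" "k \<in> L" for h k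
  proof -
    have "cj h k = (cj h k \<otimes> inv k) \<otimes> k"
      using that H L sgD[of H h] sgD[of L k] by (simp add: m_assoc)
    then show ?thesis using comm[of h k] that L sg_mult by (metis subsetD)
  qed
  then show ?thesis by (auto simp: normalizes_def)
qed

text \<open>The projection of \<open>H\<close> onto the abelian group \<open>H / L\<close> is
  extended to \<open>Y\<close> by transfer, and \<open>M\<close> is the kernel of the extension. Its
  restriction to \<open>H\<close> is onto with kernel \<open>L\<close>, which gives
  \<open>M <#> H = Y\<close> and \<open>M \<inter> H = L\<close>; commutators lie in
  \<open>M\<close> because the target is abelian.\<close>

lemma transfer_normal_complement:
  assumes Y: "subgroup Y G" and H: "subgroup H G" "H \<subseteq> Y" and L: "subgroup L G" "L \<subseteq> H"
    and comm: "\<And>h k. h \<in> H \<Longrightarrow> k \<in> H \<Longrightarrow> cj h k \<otimes> inv k \<in> L"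
    and triv: "\<And>g u. g \<in> Y - H \<Longrightarrow> u \<in> H \<Longrightarrow> cj g u \<in> H \<Longrightarrow> cj g u \<in> L"
  obtains M where "subgroup M G" "M \<subseteq> Y" "normalizes Y M" "M \<inter> H = L" "M <#> H = Y"
    and "\<And>y z. y \<in> Y \<Longrightarrow> z \<in> Y \<Longrightarrow> cj y z \<otimes> inv z \<in> M"
proof -
  have nL: "normalizes H L" using commutators_imp_normalizes[OF H(1) L comm] .
  interpret Hg: group "G\<lparr>carrier := H\<rparr>" using H by (simp add: subgroup_imp_group)
  interpret nl: normal L "G\<lparr>carrier := H\<rparr>" using normal_relative_iff[OF H(1)] L nL by simp
  define A where "A = G\<lparr>carrier := H\<rparr> Mod L"
  have rc: "L #>\<^bsub>G\<lparr>carrier := H\<rparr>\<^esub> h = L #> h" for h by (simp add: r_coset_def)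
  have hom: "L #> (h \<otimes> k) = (L #> h) \<otimes>\<^bsub>A\<^esub> (L #> k)" if "h \<in> H" "k \<in> H" for h k
    using nl.rcos_sum[of h k] that by (simp add: A_def rc)
  have cl: "L #> h \<in> carrier A" if "h \<in> H" for h
    using that by (auto simp: A_def FactGroup_def RCOSETS_def rc)
  have ex: "\<exists>h\<in>H. a = L #> h" if "a \<in> carrier A" for a
    using that by (auto simp: A_def FactGroup_def RCOSETS_def rc)
  have eqL: "L #> h = L \<longleftrightarrow> h \<in> L" if "h \<in> H" for h
    using that H L by (meson coset_join1 coset_join2 sgD sg_carrier)
  have oneA: "\<one>\<^bsub>A\<^esub> = L" by (simp add: A_def)
  have commA: "(L #> h) \<otimes>\<^bsub>A\<^esub> (L #> k) = (L #> k) \<otimes>\<^bsub>A\<^esub> (L #> h)" if "h \<in> H" "k \<in> H" for h k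
  proof -
    have c: "h \<in> carrier G" "k \<in> carrier G" using that H by auto
    have "h \<otimes> k = (cj h k \<otimes> inv k) \<otimes> (k \<otimes> h)" using c by (simp add: cj_def m_assoc inv_solve_left)
    then have "L #> (h \<otimes> k) = (L #> (cj h k \<otimes> inv k)) #> (k \<otimes> h)"
      using c L by (simp add: coset_mult_assoc sg_carrier)
    also have "L #> (cj h k \<otimes> inv k) = L"
      using eqL comm[OF that] L by auto
    finally show ?thesis using hom that by simp
  qed
  have A: "comm_group A"
  proof (rule group.group_comm_groupI)
    show "group A" unfolding A_def by (rule nl.factorgroup_is_group)
    show "x \<otimes>\<^bsub>A\<^esub> y = y \<otimes>\<^bsub>A\<^esub> x" if "x \<in> carrier A" "y \<in> carrier A" for x y
      using that ex commA by metis
  qed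
  interpret A: comm_group A by (rule A)
  obtain V where Vc: "\<And>y. y \<in> Y \<Longrightarrow> V y \<in> carrier A"
    and Vm: "\<And>y z. y \<in> Y \<Longrightarrow> z \<in> Y \<Longrightarrow> V (y \<otimes> z) = V y \<otimes>\<^bsub>A\<^esub> V z"
    and VH: "\<And>h. h \<in> H \<Longrightarrow> V h = L #> h"
  proof (rule transfer_extension[OF Y H A, of "\<lambda>h. L #> h"])
    show "L #> cj g u = \<one>\<^bsub>A\<^esub>" if "g \<in> Y - H" "u \<in> H" "cj g u \<in> H" for g u
      using triv[OF that] eqL oneA that by simp
  qed (use cl hom in auto)
  have Yc: "y \<in> carrier G" if "y \<in> Y" for y using that Y by auto
  have V1: "V \<one> = \<one>\<^bsub>A\<^esub>" using VH[of \<one>] H L sg_one eqL oneA by auto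
  have Vi: "V (inv y) = inv\<^bsub>A\<^esub> V y" if "y \<in> Y" for y
    using that Vm[of "inv y" y] V1 Vc Y Yc
    by (metis A.inv_equality l_inv sg_inv)
  have Vcj: "V (cj y z) = V z" if "y \<in> Y" "z \<in> Y" for y z
    using that Vm Vi Vc Y unfolding cj_def by (simp add: sg_mult sg_inv A.m_comm A.inv_solve_right')
  define M where "M = {y \<in> Y. V y = \<one>\<^bsub>A\<^esub>}"
  have M: "subgroup M G"
  proof (rule finite_subgroupI)
    show "M \<subseteq> carrier G" "\<one> \<in> M" using Yc Y V1 sg_one by (auto simp: M_def)
    show "x \<otimes> y \<in> M" if "x \<in> M" "y \<in> M" for x y
      using that Y Vm by (auto simp: M_def sg_mult)
  qed
  show ?thesis
  proof (rule that[OF M])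
    show MY: "M \<subseteq> Y" by (auto simp: M_def)
    show "normalizes Y M" using Y Vcj by (auto simp: normalizes_def M_def cj_mem)
    have "h \<in> M \<longleftrightarrow> h \<in> L" if "h \<in> H" for h
      using VH[OF that] eqL[OF that] oneA that H by (auto simp: M_def)
    then show "M \<inter> H = L" using L by blast
    show "M <#> H = Y"
    proof
      show "M <#> H \<subseteq> Y" using set_mult_subset[OF Y MY H(2)] .
      show "Y \<subseteq> M <#> H"
      proof
        fix y assume y: "y \<in> Y"
        then obtain h where h: "h \<in> H" "V y = L #> h" using Vc ex by blast
        then have "V (y \<otimes> inv h) = \<one>\<^bsub>A\<^esub>"
          using y H Y Vm[of y "inv h"] Vi[of h] VH[of h] cl[of h] by (simp add: subset_iff sg_inv)
        then have "y \<otimes> inv h \<in> M" using y h H Y by (auto simp: M_def sg_mult sg_inv)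
        moreover have "y = (y \<otimes> inv h) \<otimes> h" using y h H Yc by (auto simp: m_assoc)
        ultimately show "y \<in> M <#> H" using h by (metis mem_set_mult)
      qed
    qed
    show "cj y z \<otimes> inv z \<in> M" if "y \<in> Y" "z \<in> Y" for y z
      using that Y Vm Vcj Vi Vc by (simp add: M_def sg_mult sg_inv cj_mem)
  qed
qed

text \<open>Solvability, expressed as: no non-trivial subgroup is perfect.\<close>

definition solv :: "'a set \<Rightarrow> bool" where
  "solv Y \<longleftrightarrow> (\<forall>Z. subgroup Z G \<and> Z \<subseteq> Y \<and> Z \<noteq> {\<one>} \<longrightarrow>
     (\<exists>W. subgroup W G \<and> W \<subset> Z \<and> (\<forall>y\<in>Z. \<forall>z\<in>Z. cj y z \<otimes> inv z \<in> W)))"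

lemma solv_mono: "solv Y \<Longrightarrow> Z \<subseteq> Y \<Longrightarrow> solv Z"
  unfolding solv_def by (meson order.trans)

lemma solvE:
  assumes "solv Y" "subgroup Y G" "Y \<noteq> {\<one>}"
  obtains W where "subgroup W G" "W \<subset> Y" "\<And>y z. y \<in> Y \<Longrightarrow> z \<in> Y \<Longrightarrow> cj y z \<otimes> inv z \<in> W"
  using assms unfolding solv_def by (metis order.refl)

text \<open>A subgroup of \<open>Y\<close> not contained in \<open>W\<close> meets \<open>W\<close>
  in a proper subgroup that contains all its commutators; for the others the solvability of
  \<open>W\<close> applies.\<close>

lemma solv_extension:
  assumes W: "subgroup W G" "solv W" and comm: "\<And>y z. y \<in> Y \<Longrightarrow> z \<in> Y \<Longrightarrow> cj y z \<otimes> inv z \<in> W"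
  shows "solv Y"
  unfolding solv_def
proof (intro allI impI, elim conjE)
  fix Z assume Z: "subgroup Z G" "Z \<subseteq> Y" "Z \<noteq> {\<one>}"
  show "\<exists>W. subgroup W G \<and> W \<subset> Z \<and> (\<forall>y\<in>Z. \<forall>z\<in>Z. cj y z \<otimes> inv z \<in> W)"
  proof (cases "Z \<subseteq> W")
    case True
    then show ?thesis using W Z unfolding solv_def by blast
  next
    case False
    have "subgroup (W \<inter> Z) G" using W Z by (simp add: sg_Int)
    moreover have "W \<inter> Z \<subset> Z" using False by blast
    moreover have "\<forall>y\<in>Z. \<forall>z\<in>Z. cj y z \<otimes> inv z \<in> W \<inter> Z"
      using comm Z by (auto simp: sg_mult sg_inv cj_mem)
    ultimately show ?thesis by blast
  qed
qed

lemma solv_trivial: "solv {\<one>}"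
  unfolding solv_def by (metis subset_singletonD sg_one empty_iff)

lemma solv_abelian:
  assumes Y: "subgroup Y G" and ab: "\<not> nonabelian G Y"
  shows "solv Y"
proof (rule solv_extension[OF triv_subgroup solv_trivial])
  fix y z assume yz: "y \<in> Y" "z \<in> Y"
  then have c: "y \<in> carrier G" "z \<in> carrier G" using Y by auto
  have "cj y z = z" using abelianD[OF ab yz] c by (simp add: cj_fix_iff)
  then show "cj y z \<otimes> inv z \<in> {\<one>}" using c by simp
qed

section \<open>Counting arguments, Frobenius complements and their kernels\<close>

lemma card_fibres:
  fixes F :: "'s \<Rightarrow> 't"
  assumes "finite S" "\<And>s. s \<in> S \<Longrightarrow> card {t \<in> S. F t = F s} = n"
  shows "card S = card (F ` S) * n"
proof -
  have "card S = (\<Sum>s\<in>S. 1)" by simp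
  also have "\<dots> = (\<Sum>y\<in>F ` S. \<Sum>s\<in>{t \<in> S. F t = y}. 1)" by (rule sum.image_gen[OF assms(1)])
  also have "\<dots> = (\<Sum>y\<in>F ` S. n)" using assms(2) by (intro sum.cong) auto
  finally show ?thesis by simp
qed

text \<open>The product formula: the fibre of the multiplication map through \<open>(m, h)\<close>
  consists of the pairs \<open>(m \<otimes> w, inv w \<otimes> h)\<close> with \<open>w\<close> in
  \<open>M \<inter> H\<close>.\<close>

lemma card_set_mult_Int:
  assumes M: "subgroup M G" and H: "subgroup H G"
  shows "card (M <#> H) * card (M \<inter> H) = card M * card H"
proof -
  let ?F = "\<lambda>(m,h). m \<otimes> h"
  have "card {t \<in> M \<times> H. ?F t = ?F s} = card (M \<inter> H)" if s: "s \<in> M \<times> H" for s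
  proof -
    obtain m h where mh: "s = (m, h)" "m \<in> M" "h \<in> H" using s by auto
    have c: "m \<in> carrier G" "h \<in> carrier G" using mh M H by auto
    have "bij_betw (\<lambda>w. (m \<otimes> w, inv w \<otimes> h)) (M \<inter> H) {t \<in> M \<times> H. ?F t = ?F s}"
    proof (rule bij_betw_byWitness[where f' = "\<lambda>t. inv m \<otimes> fst t"])
      show "\<forall>w\<in>M \<inter> H. inv m \<otimes> fst (m \<otimes> w, inv w \<otimes> h) = w" using c M by auto
      show "(\<lambda>w. (m \<otimes> w, inv w \<otimes> h)) ` (M \<inter> H) \<subseteq> {t \<in> M \<times> H. ?F t = ?F s}"
      proof (rule image_subsetI)
        fix w assume "w \<in> M \<inter> H"
        then show "(m \<otimes> w, inv w \<otimes> h) \<in> {t \<in> M \<times> H. ?F t = ?F s}"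
          using mh c M H sgD[of M w] by (simp add: sg_mult sg_inv m_assoc)
      qed
      have e: "inv m \<otimes> a \<in> M \<inter> H \<and> (m \<otimes> (inv m \<otimes> a), inv (inv m \<otimes> a) \<otimes> h) = (a, b)"
        if "a \<in> M" "b \<in> H" "a \<otimes> b = m \<otimes> h" for a b
      proof -
        have ab: "a \<in> carrier G" "b \<in> carrier G" using that M H by auto
        have "h = inv m \<otimes> (a \<otimes> b)" using that(3) ab c by simp
        then have "inv m \<otimes> a = h \<otimes> inv b" using ab c by (simp add: m_assoc)
        moreover have "inv (inv m \<otimes> a) \<otimes> h = inv a \<otimes> (m \<otimes> h)" using ab c by (simp add: inv_mult_group m_assoc)
        moreover have "\<dots> = b" using that(3)[symmetric] ab by simp
        moreover have "inv m \<otimes> a \<in> M" "h \<otimes> inv b \<in> H"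
          using that mh M H by (simp_all add: sg_mult sg_inv)
        moreover have "m \<otimes> (inv m \<otimes> a) = a" using ab c by simp
        ultimately show ?thesis by simp
      qed
      then show "\<forall>t\<in>{t \<in> M \<times> H. ?F t = ?F s}. (m \<otimes> (inv m \<otimes> fst t), inv (inv m \<otimes> fst t) \<otimes> h) = t"
        using mh by auto
      show "(\<lambda>t. inv m \<otimes> fst t) ` {t \<in> M \<times> H. ?F t = ?F s} \<subseteq> M \<inter> H"
        using e mh by auto
    qed
    then show ?thesis by (rule bij_betw_same_card[symmetric])
  qed
  then have "card (M \<times> H) = card (?F ` (M \<times> H)) * card (M \<inter> H)"
    using M H sg_finite by (intro card_fibres) auto
  moreover have "M <#> H = ?F ` (M \<times> H)" by (auto simp: set_mult_def image_iff)
  ultimately show ?thesis by (simp add: card_cartesian_product)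
qed

definition frob_compl :: "'a set \<Rightarrow> 'a set \<Rightarrow> bool" where
  "frob_compl Y H \<longleftrightarrow> subgroup Y G \<and> subgroup H G \<and> H \<subseteq> Y \<and>
     (\<forall>g\<in>Y. \<forall>h\<in>H. h \<noteq> \<one> \<and> cj g h \<in> H \<longrightarrow> g \<in> H)"

text \<open>Only a set at this stage; the conclusion \<open>x = \<one>\<close> keeps the identity in
  it.\<close>

definition frob_ker :: "'a set \<Rightarrow> 'a set \<Rightarrow> 'a set" where
  "frob_ker Y H = {x \<in> Y. \<forall>g\<in>Y. cj g x \<in> H \<longrightarrow> x = \<one>}"

lemma frob_complD:
  assumes "frob_compl Y H"
  shows "subgroup Y G" "subgroup H G" "H \<subseteq> Y"
    "\<And>g h. g \<in> Y \<Longrightarrow> h \<in> H \<Longrightarrow> h \<noteq> \<one> \<Longrightarrow> cj g h \<in> H \<Longrightarrow> g \<in> H"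
  using assms by (auto simp: frob_compl_def)

lemma frob_kerD: "x \<in> frob_ker Y H \<Longrightarrow> g \<in> Y \<Longrightarrow> cj g x \<in> H \<Longrightarrow> x = \<one>"
  by (auto simp: frob_ker_def)

text \<open>The map \<open>(g, h) \<mapsto> cj g h\<close> on
  \<open>Y \<times> (H - {\<one>})\<close> has image \<open>Y - frob_ker Y H\<close>, and each fibre
  has \<open>card H\<close> elements, because two conjugating elements with the same value differ by
  an element of \<open>H\<close>.\<close>

lemma card_frob_ker:
  assumes fc: "frob_compl Y H"
  shows "card (frob_ker Y H) * card H = card Y"
proof -
  note Y = frob_complD(1)[OF fc] and H = frob_complD(2,3)[OF fc] and fr = frob_complD(4)[OF fc]
  have Yc: "y \<in> carrier G" if "y \<in> Y" for y using that Y by auto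
  have HY: "h \<in> Y" if "h \<in> H" for h using that H by auto
  let ?F = "\<lambda>(g,h). cj g h" and ?S = "Y \<times> (H - {\<one>})"
  have "card {t \<in> ?S. ?F t = ?F s} = card H" if s: "s \<in> ?S" for s
  proof -
    obtain g h where gh: "s = (g, h)" "g \<in> Y" "h \<in> H" "h \<noteq> \<one>" using s by auto
    have c: "g \<in> carrier G" "h \<in> carrier G" using gh Yc HY by auto
    have "bij_betw (\<lambda>k. (g \<otimes> k, cj (inv k) h)) H {t \<in> ?S. ?F t = ?F s}"
    proof (rule bij_betw_byWitness[where f' = "\<lambda>t. inv g \<otimes> fst t"])
      show "\<forall>k\<in>H. inv g \<otimes> fst (g \<otimes> k, cj (inv k) h) = k" using c Yc HY by auto
      show "(\<lambda>k. (g \<otimes> k, cj (inv k) h)) ` H \<subseteq> {t \<in> ?S. ?F t = ?F s}"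
      proof (rule image_subsetI)
        fix k assume "k \<in> H"
        then show "(g \<otimes> k, cj (inv k) h) \<in> {t \<in> ?S. ?F t = ?F s}"
          using gh c Y H Yc HY by (simp add: sg_mult sg_inv cj_mem cj_cj m_assoc)
      qed
      have e: "inv g \<otimes> a \<in> H \<and> (g \<otimes> (inv g \<otimes> a), cj (inv (inv g \<otimes> a)) h) = (a, b)"
        if "a \<in> Y" "b \<in> H" "b \<noteq> \<one>" "cj a b = cj g h" for a b
      proof -
        have ab: "a \<in> carrier G" "b \<in> carrier G" using that Yc HY by auto
        have "h = cj (inv g \<otimes> a) b" using that(4) ab c by (metis cj_cj cj_inv_left inv_closed)
        moreover from this have "inv g \<otimes> a \<in> H"
          using fr[of "inv g \<otimes> a" b] that gh Y by (simp add: sg_mult sg_inv)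
        ultimately show ?thesis using ab c by simp
      qed
      then show "\<forall>t\<in>{t \<in> ?S. ?F t = ?F s}. (g \<otimes> (inv g \<otimes> fst t), cj (inv (inv g \<otimes> fst t)) h) = t"
        using gh by auto
      show "(\<lambda>t. inv g \<otimes> fst t) ` {t \<in> ?S. ?F t = ?F s} \<subseteq> H"
      proof (rule image_subsetI)
        fix t assume "t \<in> {t \<in> ?S. ?F t = ?F s}"
        then obtain a b where "t = (a, b)" "a \<in> Y" "b \<in> H" "b \<noteq> \<one>" "cj a b = cj g h"
          using gh(1) by auto
        then show "inv g \<otimes> fst t \<in> H" using e[of a b] by simp
      qed
    qed
    then show ?thesis by (rule bij_betw_same_card[symmetric])
  qed
  then have 1: "card ?S = card (?F ` ?S) * card H"
    using Y H sg_finite by (intro card_fibres) auto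
  have "?F ` ?S = Y - frob_ker Y H"
  proof
    show "?F ` ?S \<subseteq> Y - frob_ker Y H"
    proof (rule image_subsetI)
      fix t assume "t \<in> ?S"
      then obtain g h where t: "t = (g, h)" and gh: "g \<in> Y" "h \<in> H" "h \<noteq> \<one>" by auto
      have c: "g \<in> carrier G" "h \<in> carrier G" using gh Yc HY by auto
      have "cj (inv g) (cj g h) \<in> H" "cj g h \<noteq> \<one>" using c gh by auto
      then have "cj g h \<notin> frob_ker Y H" unfolding frob_ker_def using gh Y sg_inv by blast
      then show "?F t \<in> Y - frob_ker Y H" using t gh Y HY by (simp add: cj_mem)
    qed
    show "Y - frob_ker Y H \<subseteq> ?F ` ?S"
    proof
      fix y assume "y \<in> Y - frob_ker Y H"
      then obtain g where g: "y \<in> Y" "g \<in> Y" "cj g y \<in> H" "y \<noteq> \<one>" by (auto simp: frob_ker_def)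
      then have "y = ?F (inv g, cj g y)" "(inv g, cj g y) \<in> ?S" using Yc Y by (auto simp: sg_inv)
      then show "y \<in> ?F ` ?S" by blast
    qed
  qed
  moreover have "frob_ker Y H \<subseteq> Y" by (auto simp: frob_ker_def)
  ultimately have "card (?F ` ?S) = card Y - card (frob_ker Y H)"
    using Y sg_finite by (simp add: card_Diff_subset finite_subset)
  moreover have "card ?S = card Y * (card H - 1)"
    using H sg_finite by (simp add: card_cartesian_product sg_one)
  ultimately have e: "card Y * (card H - 1) = (card Y - card (frob_ker Y H)) * card H" using 1 by simp
  moreover have "card (frob_ker Y H) \<le> card Y" "card H \<ge> 1"
    using Y sg_finite sg_card_pos[OF H(1)] \<open>frob_ker Y H \<subseteq> Y\<close> by (simp_all add: card_mono)
  ultimately have "int (card Y) * (int (card H) - 1) = (int (card Y) - int (card (frob_ker Y H))) * int (card H)"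
    by (metis of_nat_mult of_nat_diff of_nat_1)
  then have "int (card (frob_ker Y H) * card H) = int (card Y)" by (simp add: algebra_simps)
  then show ?thesis by (simp only: of_nat_eq_iff)
qed

text \<open>Here \<open>g\<close> may lie outside \<open>Y\<close>: its conjugation is an
  automorphism of \<open>Y\<close> preserving \<open>H\<close>, hence it preserves everything
  defined from \<open>Y\<close> and \<open>H\<close>. The use is \<open>x\<close> acting on the
  kernel of a complement inside \<open>N\<close>.\<close>

lemma frob_ker_cj:
  assumes Y: "subgroup Y G" and "\<And>y. y \<in> Y \<Longrightarrow> cj g y \<in> Y" "\<And>h. h \<in> H \<Longrightarrow> cj g h \<in> H"
    and g: "g \<in> carrier G" and H: "H \<subseteq> Y" and x: "x \<in> frob_ker Y H"
  shows "cj g x \<in> frob_ker Y H"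
proof -
  have Yc: "y \<in> carrier G" if "y \<in> Y" for y using that Y by auto
  have xY: "x \<in> Y" using x by (simp add: frob_ker_def)
  have "x = \<one>" if a: "a \<in> Y" "cj a (cj g x) \<in> H" for a
  proof -
    have "cj (inv g) (cj a (cj g x)) \<in> H"
      using a g assms(3) H Yc by (intro cj_inv_closed) auto
    moreover have "cj (inv g) (cj a (cj g x)) = cj (cj (inv g) a) x"
      using a g Yc xY by (simp add: cj_cj) (simp add: cj_def m_assoc)
    moreover have "cj (inv g) a \<in> Y"
      using a g assms(2) Yc by (intro cj_inv_closed) auto
    ultimately show ?thesis using frob_kerD[OF x] by simp
  qed
  then show ?thesis using xY assms(2) g Yc by (auto simp: frob_ker_def)
qed

lemma frob_ker_normalized:
  assumes fc: "frob_compl Y H" and g: "g \<in> Y" and x: "x \<in> frob_ker Y H"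
  shows "cj g x \<in> frob_ker Y H"
proof -
  note Y = frob_complD(1)[OF fc]
  have xY: "x \<in> Y" using x by (simp add: frob_ker_def)
  have "cj g x = \<one>" if "a \<in> Y" "cj a (cj g x) \<in> H" for a
  proof -
    have "cj (a \<otimes> g) x \<in> H" using that g xY Y cj_cj by (metis sgD)
    then have "x = \<one>" using frob_kerD[OF x, of "a \<otimes> g"] that g Y by (simp add: sg_mult)
    then show ?thesis using g Y by auto
  qed
  then show ?thesis using g xY Y by (auto simp: frob_ker_def cj_mem)
qed

text \<open>Each transfer step replaces \<open>Y\<close> and \<open>H\<close> by the kernel \<open>M\<close> of the transfer and by
  \<open>M \<inter> H\<close> without changing the set \<open>frob_ker Y H\<close>.\<close>

lemma frobenius_kernel:
  assumes "frob_compl Y H" "solv H"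
  shows "subgroup (frob_ker Y H) G \<and> (solv (frob_ker Y H) \<longrightarrow> solv Y)"
  using assms
proof (induction "card H" arbitrary: Y H rule: less_induct)
  case less
  note fc = less.prems(1)
  note Y = frob_complD(1)[OF fc] and H = frob_complD(2,3)[OF fc] and fr = frob_complD(4)[OF fc]
  have Yc: "y \<in> carrier G" if "y \<in> Y" for y using that Y by auto
  show ?case
  proof (cases "H = {\<one>}")
    case True
    then have "frob_ker Y H = Y" using Yc by (auto simp: frob_ker_def)
    then show ?thesis using Y by simp
  next
    case False
    obtain W where W: "subgroup W G" "W \<subset> H" and comm: "\<And>y z. y \<in> H \<Longrightarrow> z \<in> H \<Longrightarrow> cj y z \<otimes> inv z \<in> W"
      using solvE[OF less.prems(2) H(1) False] by metis
    have nW: "normalizes H W" using commutators_imp_normalizes[OF H(1) W(1)] W(2) comm by auto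
    obtain M where M: "subgroup M G" "M \<subseteq> Y" "normalizes Y M" "M \<inter> H = W" "M <#> H = Y"
      and commM: "\<And>y z. y \<in> Y \<Longrightarrow> z \<in> Y \<Longrightarrow> cj y z \<otimes> inv z \<in> M"
    proof (rule transfer_normal_complement[OF Y H W(1)])
      \<comment> \<open>Elements outside a Frobenius complement fuse only the identity, so the
        triviality condition of the transfer is automatic.\<close>
      fix g u assume a: "g \<in> Y - H" "u \<in> H" "cj g u \<in> H"
      then have "u = \<one>" using fr by blast
      then show "cj g u \<in> W" using a Yc W sg_one by auto
    qed (use W comm in auto)
    have fcM: "frob_compl M W"
      unfolding frob_compl_def using M W fr H by (auto simp: psubset_eq)
    have IH: "subgroup (frob_ker M W) G \<and> (solv (frob_ker M W) \<longrightarrow> solv M)"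
      using W H sg_finite solv_mono[OF less.prems(2)] by (intro less.hyps fcM) (auto simp: psubset_card_mono)
    \<comment> \<open>A conjugate under \<open>g \<in> Y\<close> that falls into \<open>H\<close>
      lies in \<open>M \<inter> H = W\<close>. Since \<open>Y = M <#> H\<close> and \<open>H\<close>
      normalizes \<open>W\<close>, an element of \<open>M\<close> already conjugates
      \<open>x\<close> into \<open>W\<close>.\<close>
    have sub: "frob_ker M W \<subseteq> frob_ker Y H"
    proof
      fix x assume x: "x \<in> frob_ker M W"
      then have xM: "x \<in> M" by (simp add: frob_ker_def)
      have "x = \<one>" if g: "g \<in> Y" "cj g x \<in> H" for g
      proof -
        have gW: "cj g x \<in> W" using g xM M normalizesD by blast
        obtain m h where mh: "m \<in> M" "h \<in> H" "inv g = m \<otimes> h"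
          using g Y M(5) by (metis mem_set_mult sg_inv)
        then have c: "m \<in> carrier G" "h \<in> carrier G" "g \<in> carrier G" "x \<in> carrier G"
          using M H g xM Yc by auto
        have "g = inv (m \<otimes> h)" using mh c by (metis inv_inv)
        then have "cj h (cj g x) = cj (inv m) x" using c by (simp add: cj_cj inv_mult_group)
        moreover have "cj h (cj g x) \<in> W" using nW mh gW normalizesD by blast
        ultimately show ?thesis using frob_kerD[OF x, of "inv m"] mh M sg_inv by simp
      qed
      then show "x \<in> frob_ker Y H" using xM M by (auto simp: frob_ker_def)
    qed
    have "card (frob_ker M W) * card W = card M" "card (frob_ker Y H) * card H = card Y"
      using card_frob_ker fc fcM by auto
    moreover have "card Y * card W = card M * card H"
      using card_set_mult_Int[OF M(1) H(1)] M by simp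
    \<comment> \<open>Both kernels have the same size because \<open>Y\<close> over \<open>M\<close>
      and \<open>H\<close> over \<open>W\<close> have the same index, so the inclusion is an
      equality.\<close>
    ultimately have "(card (frob_ker Y H) * card H) * card W = (card (frob_ker M W) * card W) * card H"
      by simp
    then have "card (frob_ker M W) = card (frob_ker Y H)"
      using sg_card_pos[OF W(1)] sg_card_pos[OF H(1)] by auto
    moreover have "finite (frob_ker Y H)" using Y sg_finite by (auto simp: frob_ker_def)
    ultimately have eq: "frob_ker M W = frob_ker Y H" using sub by (simp add: card_subset_eq)
    have "solv Y" if "solv (frob_ker M W)"
    proof (rule solv_extension[OF M(1)])
      show "solv M" using IH that by simp
    qed (rule commM)
    then show ?thesis using IH eq by simp
  qed
qed

end

section \<open>Sylow subgroups and solvability\<close>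

context fin_group
begin

lemma sg_card_less: "subgroup K G \<Longrightarrow> H \<subset> K \<Longrightarrow> card H < card K"
  by (simp add: psubset_card_mono sg_finite)

text \<open>Orbits of a \<open>p\<close>-group have \<open>p\<close>-power size, and those of
  non-fixed points have size greater than 1. Hence \<open>S\<close> and its fixed points have the
  same size modulo \<open>p\<close>, of which only divisibility by \<open>p\<close> is
  recorded.\<close>

lemma card_fixed_points_mod:
  fixes act :: "'a \<Rightarrow> 's \<Rightarrow> 's"
  assumes P: "subgroup P G" "card P = p ^ k" and p: "prime p" and S: "finite S"
    and closed: "\<And>g s. g \<in> P \<Longrightarrow> s \<in> S \<Longrightarrow> act g s \<in> S"
    and one: "\<And>s. s \<in> S \<Longrightarrow> act \<one> s = s"
    and mult: "\<And>g h s. g \<in> P \<Longrightarrow> h \<in> P \<Longrightarrow> s \<in> S \<Longrightarrow> act (g \<otimes> h) s = act g (act h s)"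
  shows "p dvd card S \<longleftrightarrow> p dvd card {s \<in> S. \<forall>g\<in>P. act g s = s}"
proof -
  define Fx where "Fx = {s \<in> S. \<forall>g\<in>P. act g s = s}"
  define orb where "orb s = (\<lambda>g. act g s) ` P" for s
  have Pc: "g \<in> carrier G" if "g \<in> P" for g using that P by auto
  have inv_act: "act (inv g) (act g s) = s" if "g \<in> P" "s \<in> S" for g s
    using that mult[of "inv g" g s] one P Pc by (simp add: sg_inv)
  have orb_card: "card P = card (orb s) * card {g \<in> P. act g s = s}" if s: "s \<in> S" for s
    unfolding orb_def
  proof (rule card_fibres)
    show "finite P" using P sg_finite by blast
    fix h assume h: "h \<in> P"
    have "bij_betw (\<lambda>g. h \<otimes> g) {g \<in> P. act g s = s} {t \<in> P. act t s = act h s}"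
    proof (rule bij_betw_byWitness[where f' = "\<lambda>t. inv h \<otimes> t"])
      show "(\<lambda>g. h \<otimes> g) ` {g \<in> P. act g s = s} \<subseteq> {t \<in> P. act t s = act h s}"
        using h s P mult by (auto simp: sg_mult)
      show "(\<lambda>t. inv h \<otimes> t) ` {t \<in> P. act t s = act h s} \<subseteq> {g \<in> P. act g s = s}"
        using h s P mult inv_act by (auto simp: sg_mult sg_inv)
    qed (use h Pc in auto)
    then show "card {t \<in> P. act t s = act h s} = card {g \<in> P. act g s = s}"
      by (rule bij_betw_same_card[symmetric])
  qed
  have self: "s \<in> orb s" if "s \<in> S" for s
    using one[OF that] P sg_one unfolding orb_def by (metis image_eqI)
  have orb_dvd: "p dvd card (orb s)" if s: "s \<in> S - Fx" for s
  proof -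
    obtain j where j: "card (orb s) = p ^ j"
      using orb_card[of s] P p s divides_primepow_nat[of p "card (orb s)" k] by (metis DiffD1 dvd_triv_left)
    obtain g where g: "g \<in> P" "act g s \<noteq> s" using s by (auto simp: Fx_def)
    then have "{s, act g s} \<subseteq> orb s" using self s by (auto simp: orb_def)
    moreover have "finite (orb s)" unfolding orb_def using P sg_finite by blast
    ultimately have "card (orb s) \<ge> card {s, act g s}" by (rule card_mono[rotated])
    then have "j \<noteq> 0" using j g by (cases j) auto
    then show ?thesis using j by simp
  qed
  have orb_eq: "orb t = orb s" if "s \<in> S" "t \<in> orb s" for s t
  proof -
    obtain h where h: "h \<in> P" "t = act h s" using \<open>t \<in> orb s\<close> by (auto simp: orb_def)
    have 1: "act g t \<in> orb s" if "g \<in> P" for g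
      using h that mult[of g h s] \<open>s \<in> S\<close> P unfolding orb_def by (metis image_eqI sg_mult)
    have 2: "act g s \<in> orb t" if "g \<in> P" for g
    proof -
      have "act g s = act g (act (inv h) t)" using inv_act h \<open>s \<in> S\<close> by simp
      also have "\<dots> = act (g \<otimes> inv h) t" using mult[of g "inv h" t] h that \<open>s \<in> S\<close> closed P sg_inv by simp
      finally show ?thesis using h that P unfolding orb_def by (metis image_eqI sg_mult sg_inv)
    qed
    show ?thesis using 1 2 by (auto simp: orb_def[of s] orb_def[of t])
  qed
  have FxS: "Fx \<subseteq> S" by (auto simp: Fx_def)
  have stay: "orb s \<subseteq> S - Fx" if "s \<in> S - Fx" for s
  proof
    fix t assume t: "t \<in> orb s"
    then have tS: "t \<in> S" using that closed by (auto simp: orb_def)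
    have "s \<in> orb t" using orb_eq[of s t] t that self by auto
    then obtain g where g: "g \<in> P" "s = act g t" by (auto simp: orb_def)
    have "t \<notin> Fx"
    proof
      assume a: "t \<in> Fx"
      then have "s = t" using g by (auto simp: Fx_def)
      then show False using a that by simp
    qed
    then show "t \<in> S - Fx" using tS by simp
  qed
  have U: "\<Union> (orb ` (S - Fx)) = S - Fx" using stay self by blast
  have "p dvd card (\<Union> (orb ` (S - Fx)))"
  proof (rule dvd_partition)
    show "finite (\<Union> (orb ` (S - Fx)))" using U S by simp
    show "\<forall>c\<in>orb ` (S - Fx). p dvd card c" using orb_dvd by auto
    show "\<forall>c1\<in>orb ` (S - Fx). \<forall>c2\<in>orb ` (S - Fx). c1 \<noteq> c2 \<longrightarrow> c1 \<inter> c2 = {}"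
      using orb_eq by (metis (no_types, lifting) DiffD1 disjoint_iff imageE)
  qed
  then have "p dvd card (S - Fx)" using U by simp
  moreover have "card S = card (S - Fx) + card Fx"
    using S FxS by (metis add.commute card_Diff_subset card_mono finite_subset le_add_diff_inverse)
  ultimately show ?thesis by (simp add: dvd_add_right_iff Fx_def)
qed

text \<open>Sylow conjugacy and the growth of normalizers both rest on these two counts; the left
  coset of \<open>k\<close> is written as the image of \<open>R\<close> under left
  multiplication.\<close>

lemma lcosets_action:
  assumes K: "subgroup K G" and R: "subgroup R G" "R \<subseteq> K" and Q: "subgroup Q G" "Q \<subseteq> K"
    and p: "prime p" "card Q = p ^ k"
  defines "S \<equiv> (\<lambda>k. (\<otimes>) k ` R) ` K"
  shows "card S * card R = card K"
    and "p dvd card S \<longleftrightarrow> p dvd card {s \<in> S. \<forall>g\<in>Q. (\<otimes>) g ` s = s}"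
proof -
  have Kc: "k \<in> carrier G" if "k \<in> K" for k using that K by auto
  have "card K = card ((\<lambda>k. (\<otimes>) k ` R) ` K) * card R"
  proof (rule card_fibres)
    show "finite K" using K sg_finite by blast
    fix h assume h: "h \<in> K"
    have "{t \<in> K. (\<otimes>) t ` R = (\<otimes>) h ` R} = (\<otimes>) h ` R"
    proof
      show "{t \<in> K. (\<otimes>) t ` R = (\<otimes>) h ` R} \<subseteq> (\<otimes>) h ` R"
        using R Kc sg_one by (auto simp: image_iff set_eq_iff) (metis r_one)
      show "(\<otimes>) h ` R \<subseteq> {t \<in> K. (\<otimes>) t ` R = (\<otimes>) h ` R}"
      proof clarify
        fix r assume r: "r \<in> R"
        have c: "r \<in> carrier G" "h \<in> carrier G" using r R h Kc by auto
        have "(\<otimes>) (h \<otimes> r) ` R = (\<otimes>) h ` ((\<otimes>) r ` R)"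
          unfolding image_image by (rule image_cong) (use c R in \<open>auto simp: m_assoc\<close>)
        also have "(\<otimes>) r ` R = R"
        proof
          show "(\<otimes>) r ` R \<subseteq> R" using r R by (auto simp: sg_mult)
          show "R \<subseteq> (\<otimes>) r ` R"
          proof
            fix x assume "x \<in> R"
            then have "x = r \<otimes> (inv r \<otimes> x)" "inv r \<otimes> x \<in> R" using r R c by (auto simp: sg_mult sg_inv)
            then show "x \<in> (\<otimes>) r ` R" by blast
          qed
        qed
        finally show "h \<otimes> r \<in> K \<and> (\<otimes>) (h \<otimes> r) ` R = (\<otimes>) h ` R"
          using h r R K by (auto simp: sg_mult)
      qed
    qed
    moreover have "card ((\<otimes>) h ` R) = card R"
      using h Kc R by (intro card_image inj_on_subset[OF inj_on_cmult]) auto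
    ultimately show "card {t \<in> K. (\<otimes>) t ` R = (\<otimes>) h ` R} = card R" by simp
  qed
  then show "card S * card R = card K" by (simp add: S_def)
  show "p dvd card S \<longleftrightarrow> p dvd card {s \<in> S. \<forall>g\<in>Q. (\<otimes>) g ` s = s}"
  proof (rule card_fixed_points_mod[OF Q(1) p(2) p(1)])
    show "finite S" using K sg_finite by (auto simp: S_def)
    have e: "(\<otimes>) g ` ((\<otimes>) k ` R) = (\<otimes>) (g \<otimes> k) ` R" if "g \<in> K" "k \<in> K" for g k
      unfolding image_image by (rule image_cong) (use that Kc R in \<open>auto simp: m_assoc\<close>)
    show "(\<otimes>) g ` s \<in> S" if "g \<in> Q" "s \<in> S" for g s
      using that Q K e by (auto simp: S_def subset_iff sg_mult)
    show "(\<otimes>) \<one> ` s = s" if "s \<in> S" for s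
    proof -
      obtain k where "k \<in> K" "s = (\<otimes>) k ` R" using \<open>s \<in> S\<close> by (auto simp: S_def)
      then show ?thesis using e[of \<one> k] K Kc sg_one by simp
    qed
    show "(\<otimes>) (g \<otimes> h) ` s = (\<otimes>) g ` (\<otimes>) h ` s" if "g \<in> Q" "h \<in> Q" "s \<in> S" for g h s
    proof -
      obtain k where "k \<in> K" "s = (\<otimes>) k ` R" using \<open>s \<in> S\<close> by (auto simp: S_def)
      moreover have "g \<in> K" "h \<in> K" using that Q by auto
      ultimately show ?thesis using e K Kc by (simp add: sg_mult m_assoc)
    qed
  qed
qed

lemma lcoset_fixed_imp:
  assumes k: "k \<in> carrier G" and R: "subgroup R G" and g: "g \<in> carrier G"
    and fx: "(\<otimes>) g ` ((\<otimes>) k ` R) = (\<otimes>) k ` R"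
  shows "cj (inv k) g \<in> R"
proof -
  have "g \<otimes> (k \<otimes> \<one>) \<in> (\<otimes>) k ` R" using fx R sg_one by blast
  then obtain r where r: "r \<in> R" "g \<otimes> k = k \<otimes> r" using k by auto
  then have "cj (inv k) g = inv k \<otimes> (k \<otimes> r)" using k g by (simp add: cj_def m_assoc)
  then show ?thesis using r k R by auto
qed

text \<open>The number of cosets of a Sylow \<open>p\<close>-subgroup is prime to \<open>p\<close>,
  so the \<open>p\<close>-group \<open>Q\<close> fixes a coset of \<open>R\<close>, and the
  representative of that coset conjugates \<open>Q\<close> into \<open>R\<close>.\<close>

lemma sylow_conj:
  assumes K: "subgroup K G" and p: "prime p" and R: "subgroup R G" "R \<subseteq> K" "card R = p ^ multiplicity p (card K)"
    and Q: "subgroup Q G" "Q \<subseteq> K" "card Q = p ^ j"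
  obtains k where "k \<in> K" "\<And>x. x \<in> Q \<Longrightarrow> cj k x \<in> R"
proof -
  define S where "S = (\<lambda>k. (\<otimes>) k ` R) ` K"
  have "\<not> p dvd card S"
  proof
    assume "p dvd card S"
    then have "p * p ^ multiplicity p (card K) dvd card S * card R" using R(3) by (simp add: mult_dvd_mono)
    then have "p ^ Suc (multiplicity p (card K)) dvd card K"
      using lcosets_action(1)[OF K R(1,2) Q(1,2) p Q(3)] by (simp add: S_def)
    moreover have "card K \<noteq> 0" "\<not> is_unit p" using p sg_card_pos[OF K] not_prime_unit by auto
    ultimately show False by (metis not_less_eq_eq order_refl power_dvd_iff_le_multiplicity)
  qed
  then have "{s \<in> S. \<forall>g\<in>Q. (\<otimes>) g ` s = s} \<noteq> {}"
    using lcosets_action(2)[OF K R(1,2) Q(1,2) p Q(3)] unfolding S_def by (metis card.empty dvd_0_right)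
  then obtain k where k: "k \<in> K" "\<forall>g\<in>Q. (\<otimes>) g ` ((\<otimes>) k ` R) = (\<otimes>) k ` R" by (auto simp: S_def)
  have "cj (inv k) x \<in> R" if "x \<in> Q" for x
    using that k K Q R by (intro lcoset_fixed_imp) auto
  then show ?thesis using that[of "inv k"] k K sg_inv by blast
qed

text \<open>Coprime action: \<open>powers x\<close> permutes the Sylow \<open>r\<close>-subgroups of
  \<open>M\<close>, whose number divides \<open>card M\<close> and is therefore prime to
  \<open>ord x\<close>; so one of them is fixed.\<close>

lemma invariant_sylow:
  assumes M: "subgroup M G" and x: "x \<in> carrier G" "prime (ord x)" "\<And>m. m \<in> M \<Longrightarrow> cj x m \<in> M"
    and np: "\<not> ord x dvd card M" and r: "prime r"
  obtains R where "subgroup R G" "R \<subseteq> M" "card R = r ^ multiplicity r (card M)"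
    "\<And>y. y \<in> R \<Longrightarrow> cj x y \<in> R"
proof -
  define n where "n = r ^ multiplicity r (card M)"
  obtain R where R: "subgroup R G" "R \<subseteq> M" "card R = n" using sylow_exists[OF M r] n_def by metis
  define S where "S = {R. subgroup R G \<and> R \<subseteq> M \<and> card R = n}"
  have Mc: "m \<in> carrier G" if "m \<in> M" for m using that M by auto
  have img_sg: "subgroup (cj g ` Q) G" if "g \<in> carrier G" "subgroup Q G" for g Q
  proof (rule finite_subgroupI)
    show "\<one> \<in> cj g ` Q" using that sg_one by (metis cj_one_right image_eqI)
    fix a b assume "a \<in> cj g ` Q" "b \<in> cj g ` Q"
    then obtain u v where uv: "u \<in> Q" "v \<in> Q" "a = cj g u" "b = cj g v" by auto
    then have "a \<otimes> b = cj g (u \<otimes> v)" using that cj_mult[of g u v] sgD by metis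
    then show "a \<otimes> b \<in> cj g ` Q" using uv that sg_mult by blast
  qed (use that in auto)
  have img_card: "card (cj g ` Q) = card Q" if "g \<in> carrier G" "subgroup Q G" for g Q
    using that by (intro card_image inj_onI) (metis cj_eq_iff sgD)
  have img_img: "cj g ` (cj h ` Q) = cj (g \<otimes> h) ` Q" if "g \<in> carrier G" "h \<in> carrier G" "subgroup Q G" for g h Q
    unfolding image_image by (rule image_cong) (use that in \<open>auto simp: cj_cj\<close>)
  \<comment> \<open>Conjugacy makes the Sylow subgroups a single orbit of \<open>M\<close>, so their
    number is the index of a stabilizer.\<close>
  have Seq: "S = (\<lambda>m. cj m ` R) ` M"
  proof
    show "(\<lambda>m. cj m ` R) ` M \<subseteq> S"
      using R M Mc by (auto simp: S_def img_sg img_card subset_iff cj_mem)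
    show "S \<subseteq> (\<lambda>m. cj m ` R) ` M"
    proof
      fix Q assume Q: "Q \<in> S"
      then have Q': "subgroup Q G" "Q \<subseteq> M" "card Q = n" by (auto simp: S_def)
      obtain k where k: "k \<in> M" "\<And>x. x \<in> R \<Longrightarrow> cj k x \<in> Q"
        using sylow_conj[OF M r Q'(1,2) _ R(1,2), of "multiplicity r (card M)"] Q' R n_def by metis
      have "cj k ` R = Q"
        using k Q' R Mc by (intro sg_card_eq) (auto simp: img_card)
      then show "Q \<in> (\<lambda>m. cj m ` R) ` M" using k by blast
    qed
  qed
  have "card M = card ((\<lambda>m. cj m ` R) ` M) * card {m \<in> M. cj m ` R = R}"
  proof (rule card_fibres)
    show "finite M" using M sg_finite by blast
    fix h assume h: "h \<in> M"
    have "bij_betw (\<lambda>g. h \<otimes> g) {m \<in> M. cj m ` R = R} {t \<in> M. cj t ` R = cj h ` R}"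
    proof (rule bij_betw_byWitness[where f' = "\<lambda>t. inv h \<otimes> t"])
      show "(\<lambda>g. h \<otimes> g) ` {m \<in> M. cj m ` R = R} \<subseteq> {t \<in> M. cj t ` R = cj h ` R}"
      proof (rule image_subsetI)
        fix t assume "t \<in> {m \<in> M. cj m ` R = R}"
        then show "h \<otimes> t \<in> {t \<in> M. cj t ` R = cj h ` R}"
          using h M Mc R by (simp add: sg_mult img_img[symmetric])
      qed
      show "(\<lambda>t. inv h \<otimes> t) ` {t \<in> M. cj t ` R = cj h ` R} \<subseteq> {m \<in> M. cj m ` R = R}"
      proof (rule image_subsetI)
        fix t assume t: "t \<in> {t \<in> M. cj t ` R = cj h ` R}"
        then have "cj (inv h \<otimes> t) ` R = cj (inv h) ` (cj h ` R)"
          using h Mc R by (simp add: img_img[symmetric])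
        also have "\<dots> = cj \<one> ` R" using h Mc R by (simp add: img_img)
        also have "\<dots> = id ` R" by (rule image_cong) (use R in auto)
        finally have "cj (inv h \<otimes> t) ` R = R" by simp
        then show "inv h \<otimes> t \<in> {m \<in> M. cj m ` R = R}" using t h M by (simp add: sg_mult sg_inv)
      qed
    qed (use h Mc in auto)
    then show "card {t \<in> M. cj t ` R = cj h ` R} = card {m \<in> M. cj m ` R = R}"
      by (rule bij_betw_same_card[symmetric])
  qed
  then have "\<not> ord x dvd card S" using np Seq by auto
  moreover have "ord x dvd card S \<longleftrightarrow> ord x dvd card {s \<in> S. \<forall>g\<in>powers x. cj g ` s = s}"
  proof (rule card_fixed_points_mod)
    show "subgroup (powers x) G" "card (powers x) = ord x ^ 1" using x powers_sg card_powers by auto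
    show "finite S" using M sg_finite by (simp add: Seq)
    have nM: "normalizes (powers x) M" using normalizes_powers[OF x(1) M x(3)] .
    have pc: "g \<in> carrier G" if "g \<in> powers x" for g using that x powers_sg by blast
    show "cj g ` s \<in> S" if "g \<in> powers x" "s \<in> S" for g s
      using that pc nM unfolding S_def by (auto simp: img_sg img_card normalizesD)
    show "cj \<one> ` s = s" if "s \<in> S" for s
    proof -
      have "cj \<one> ` s = id ` s" by (rule image_cong) (use that in \<open>auto simp: S_def\<close>)
      then show ?thesis by simp
    qed
    show "cj (g \<otimes> h) ` s = cj g ` cj h ` s" if "g \<in> powers x" "h \<in> powers x" "s \<in> S" for g h s
      using that pc by (simp add: S_def img_img)
  qed (use x in auto)
  ultimately have "{s \<in> S. \<forall>g\<in>powers x. cj g ` s = s} \<noteq> {}" by (metis card.empty dvd_0_right)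
  then obtain Q where "subgroup Q G" "Q \<subseteq> M" "card Q = n" "cj x ` Q = Q"
    using x by (auto simp: S_def)
  then show ?thesis using that n_def by blast
qed

section \<open>Maximal subgroups and criteria for solvability\<close>

definition max_subgroup :: "'a set \<Rightarrow> 'a set \<Rightarrow> bool" where
  "max_subgroup Y C \<longleftrightarrow> subgroup C G \<and> C \<subset> Y \<and> (\<forall>D. subgroup D G \<and> C \<subseteq> D \<and> D \<subset> Y \<longrightarrow> D = C)"

lemma max_subgroup_exists:
  assumes "subgroup U G" "U \<subset> Y"
  obtains C where "max_subgroup Y C" "U \<subseteq> C"
proof -
  let ?A = "{D. subgroup D G \<and> U \<subseteq> D \<and> D \<subset> Y}"
  have "?A \<subseteq> Pow (carrier G)" using sg_carrier by auto
  then have "finite ?A" using finite_carrier finite_subset by blast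
  moreover have "U \<in> ?A" using assms by auto
  ultimately obtain C where C: "C \<in> ?A" "U \<subseteq> C" "\<forall>b\<in>?A. C \<subseteq> b \<longrightarrow> C = b"
    using finite_has_maximal2[of ?A U] by auto
  then have "max_subgroup Y C" unfolding max_subgroup_def by (metis (no_types, lifting) mem_Collect_eq order.trans)
  then show ?thesis using that C by blast
qed

lemma subgroup_normalizer:
  assumes Y: "subgroup Y G" and C: "subgroup C G"
  shows "subgroup {y \<in> Y. \<forall>c\<in>C. cj y c \<in> C} G"
proof (rule finite_subgroupI)
  show "x \<otimes> y \<in> {y \<in> Y. \<forall>c\<in>C. cj y c \<in> C}"
    if "x \<in> {y \<in> Y. \<forall>c\<in>C. cj y c \<in> C}" "y \<in> {y \<in> Y. \<forall>c\<in>C. cj y c \<in> C}" for x y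
    using that Y C by (auto simp: sg_mult) (metis cj_cj sgD)
qed (use Y C in \<open>auto simp: sg_one\<close>)

lemma subgroup_centralizer:
  assumes Y: "subgroup Y G" and w: "w \<in> carrier G"
  shows "subgroup {y \<in> Y. cj y w = w} G"
proof (rule finite_subgroupI)
  show "x \<otimes> y \<in> {y \<in> Y. cj y w = w}"
    if "x \<in> {y \<in> Y. cj y w = w}" "y \<in> {y \<in> Y. cj y w = w}" for x y
    using that Y w by (auto simp: sg_mult) (metis cj_cj sgD)
qed (use Y w in \<open>auto simp: sg_one\<close>)

text \<open>The quotient by a normal maximal subgroup has no proper non-trivial subgroup, hence is
  abelian. Without quotients: for \<open>b \<notin> C\<close> the elements commuting with
  \<open>b\<close> modulo \<open>C\<close> form a subgroup that contains \<open>C\<close> and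
  \<open>b\<close>, so it is \<open>Y\<close>.\<close>

lemma max_normal_commutators:
  assumes Y: "subgroup Y G" and C: "max_subgroup Y C" and n: "normalizes Y C" and ab: "a \<in> Y" "b \<in> Y"
  shows "cj a b \<otimes> inv b \<in> C"
proof -
  have Cs: "subgroup C G" "C \<subset> Y" and mx: "\<And>D. subgroup D G \<Longrightarrow> C \<subseteq> D \<Longrightarrow> D \<subset> Y \<Longrightarrow> D = C"
    using C by (auto simp: max_subgroup_def)
  have Yc: "y \<in> carrier G" if "y \<in> Y" for y using that Y by auto
  show ?thesis
  proof (cases "b \<in> C")
    case True
    then show ?thesis using Cs n ab normalizesD by (simp add: sg_mult sg_inv)
  next
    case False
    define D where "D = {y \<in> Y. cj y b \<otimes> inv b \<in> C}"
    have "subgroup D G"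
    proof (rule finite_subgroupI)
      show "D \<subseteq> carrier G" "\<one> \<in> D" using Yc Y Cs ab by (auto simp: D_def sg_one)
      fix x y assume xy: "x \<in> D" "y \<in> D"
      then have c: "x \<in> carrier G" "y \<in> carrier G" "b \<in> carrier G" using Yc ab by (auto simp: D_def)
      have "cj (x \<otimes> y) b \<otimes> inv b = cj x (cj y b \<otimes> inv b) \<otimes> (cj x b \<otimes> inv b)"
        using c by (simp add: cj_mult cj_inv cj_cj m_assoc)
      moreover have "cj x (cj y b \<otimes> inv b) \<in> C" using xy n normalizesD by (auto simp: D_def)
      ultimately show "x \<otimes> y \<in> D" using xy Y Cs by (simp add: D_def sg_mult)
    qed
    moreover have "C \<subseteq> D"
    proof
      fix c assume c: "c \<in> C"
      then have cc: "c \<in> carrier G" "b \<in> carrier G" using Cs Yc ab by auto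
      have "cj c b \<otimes> inv b = c \<otimes> cj b (inv c)" using cc by (simp add: cj_def m_assoc)
      moreover have "cj b (inv c) \<in> C" using n ab c Cs normalizesD sg_inv by blast
      ultimately show "c \<in> D" using c Cs by (auto simp: D_def sg_mult)
    qed
    moreover have "b \<in> D" using ab Yc Cs sg_one by (auto simp: D_def cj_def m_assoc)
    ultimately have "D = Y" using mx[of D] False by (auto simp: D_def)
    then show ?thesis using ab by (auto simp: D_def)
  qed
qed

text \<open>\<open>C\<close> acts by left multiplication on its own cosets in \<open>Q\<close>.
  Their number is divisible by \<open>p\<close> and \<open>C\<close> itself is fixed, so a second
  coset is fixed; its representative normalizes \<open>C\<close>, up to inversion.\<close>

lemma normalizer_grows:
  assumes p: "prime p" and Q: "subgroup Q G" "card Q = p ^ k" and C: "subgroup C G" "C \<subset> Q"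
  obtains g where "g \<in> Q - C" "\<And>c. c \<in> C \<Longrightarrow> cj g c \<in> C"
proof -
  define S where "S = (\<lambda>k. (\<otimes>) k ` C) ` Q"
  have Qc: "k \<in> carrier G" if "k \<in> Q" for k using that Q by auto
  have CQ: "C \<subseteq> Q" using C by auto
  obtain j where j: "card C = p ^ j"
    using sg_card_dvd[OF C(1) Q(1) CQ] Q(2) p divides_primepow_nat by metis
  have cS: "card S * card C = card Q" using lcosets_action(1)[OF Q(1) C(1) CQ C(1) CQ p j] S_def by simp
  have "card S dvd p ^ k" using cS Q by (metis dvd_triv_left)
  then obtain i where i: "card S = p ^ i" using p divides_primepow_nat by blast
  have "card C < card Q" using C Q sg_card_less by blast
  then have "i \<noteq> 0" using i cS by (cases i) auto
  then have "p dvd card S" using i by simp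
  then have d: "p dvd card {s \<in> S. \<forall>g\<in>C. (\<otimes>) g ` s = s}"
    using lcosets_action(2)[OF Q(1) C(1) CQ C(1) CQ p j] S_def by simp
  have "C \<in> {s \<in> S. \<forall>g\<in>C. (\<otimes>) g ` s = s}"
  proof -
    have "(\<otimes>) g ` C = C" if g: "g \<in> C" for g
    proof
      show "(\<otimes>) g ` C \<subseteq> C" using g C by (auto simp: sg_mult)
      show "C \<subseteq> (\<otimes>) g ` C"
      proof
        fix x assume "x \<in> C"
        then have "x = g \<otimes> (inv g \<otimes> x)" "inv g \<otimes> x \<in> C" using g C CQ Qc by (auto simp: sg_mult sg_inv subset_iff)
        then show "x \<in> (\<otimes>) g ` C" by blast
      qed
    qed
    moreover from this have "C \<in> S"
      unfolding S_def using sg_one[OF C(1)] sg_one[OF Q(1)] by (intro image_eqI[where x = \<one>]) simp_all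
    ultimately show ?thesis by simp
  qed
  moreover have "{s \<in> S. \<forall>g\<in>C. (\<otimes>) g ` s = s} \<noteq> {C}" using d p by auto
  ultimately obtain s where s: "s \<in> S" "\<forall>g\<in>C. (\<otimes>) g ` s = s" "s \<noteq> C" by blast
  then obtain g where g: "g \<in> Q" "s = (\<otimes>) g ` C" by (auto simp: S_def)
  have "g \<notin> C"
  proof
    assume gC: "g \<in> C"
    then have "(\<otimes>) g ` C \<subseteq> C" using C by (auto simp: sg_mult)
    moreover have "card ((\<otimes>) g ` C) = card C"
      using g Qc C by (intro card_image inj_on_subset[OF inj_on_cmult]) auto
    ultimately have "s = C" using g C sg_finite by (simp add: card_subset_eq)
    then show False using s by simp
  qed
  moreover have "cj (inv g) c \<in> C" if "c \<in> C" for c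
    using that s g Qc C by (intro lcoset_fixed_imp) auto
  ultimately show ?thesis using that[of "inv g"] g Q C Qc by (simp add: sg_inv sg_inv_iff)
qed

lemma solv_max_normal:
  assumes "subgroup Y G" "max_subgroup Y C" "normalizes Y C" "solv C"
  shows "solv Y"
proof (rule solv_extension)
  show "subgroup C G" "solv C" using assms by (simp_all add: max_subgroup_def)
qed (rule max_normal_commutators[OF assms(1-3)])

text \<open>A maximal subgroup of a \<open>p\<close>-group is properly contained in its normalizer,
  hence normal, and induction applies to it.\<close>

lemma solv_prime_power:
  assumes p: "prime p"
  shows "subgroup Q G \<Longrightarrow> card Q = p ^ k \<Longrightarrow> solv Q"
proof (induction "card Q" arbitrary: Q k rule: less_induct)
  case less
  note Q = less.prems
  show ?case
  proof (cases "Q = {\<one>}")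
    case False
    then have "{\<one>} \<subset> Q" using Q sg_one by blast
    then obtain C where C: "max_subgroup Q C" using max_subgroup_exists[OF triv_subgroup] by metis
    then have Cs: "subgroup C G" "C \<subset> Q" and mx: "\<And>D. subgroup D G \<Longrightarrow> C \<subseteq> D \<Longrightarrow> D \<subset> Q \<Longrightarrow> D = C"
      by (auto simp: max_subgroup_def)
    obtain j where j: "card C = p ^ j"
      using sg_card_dvd[OF Cs(1) Q(1)] Cs Q(2) p divides_primepow_nat by (metis psubset_imp_subset)
    have "solv C" using less.hyps[OF sg_card_less[OF Q(1) Cs(2)] Cs(1) j] .
    moreover have "normalizes Q C"
    proof -
      obtain g where g: "g \<in> Q - C" "\<And>c. c \<in> C \<Longrightarrow> cj g c \<in> C"
        using normalizer_grows[OF p Q(1,2) Cs] by metis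
      let ?N = "{y \<in> Q. \<forall>c\<in>C. cj y c \<in> C}"
      have "C \<subseteq> ?N" using Cs by (auto simp: cj_mem)
      then have "?N = Q" using mx[OF subgroup_normalizer[OF Q(1) Cs(1)]] g by blast
      then show ?thesis by (auto simp: normalizes_def)
    qed
    ultimately show ?thesis using solv_max_normal[OF Q(1) C] by blast
  qed (simp add: solv_trivial)
qed

text \<open>A theorem of Herstein: for \<open>g \<notin> C\<close> an element of \<open>C \<inter> g C g\<^sup>-\<^sup>1\<close> is centralized by \<open>C\<close> and
  \<open>g C g\<^sup>-\<^sup>1\<close>, hence central, so the transfer applies modulo the centre.\<close>

lemma abelian_max_subgroup:
  assumes Y: "subgroup Y G" and C: "max_subgroup Y C" and ab: "\<not> nonabelian G C"
  obtains M where "subgroup M G" "M \<subset> Y" "\<And>y z. y \<in> Y \<Longrightarrow> z \<in> Y \<Longrightarrow> cj y z \<otimes> inv z \<in> M"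
proof -
  have Cs: "subgroup C G" "C \<subset> Y" and mx: "\<And>D. subgroup D G \<Longrightarrow> C \<subseteq> D \<Longrightarrow> D \<subset> Y \<Longrightarrow> D = C"
    using C by (auto simp: max_subgroup_def)
  have Yc: "y \<in> carrier G" if "y \<in> Y" for y using that Y by auto
  have Cc: "y \<in> carrier G" if "y \<in> C" for y using that Cs by auto
  let ?N = "{y \<in> Y. \<forall>c\<in>C. cj y c \<in> C}"
  have NC: "C \<subseteq> ?N" using Cs by (auto simp: cj_mem)
  show ?thesis
  proof (cases "?N = Y")
    case True
    then have "normalizes Y C" by (auto simp: normalizes_def)
    then show ?thesis using that[OF Cs] max_normal_commutators[OF Y C] by blast
  next
    case False
    then have NeqC: "?N = C" using mx[OF subgroup_normalizer[OF Y Cs(1)] NC] by blast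
    define L where "L = {c \<in> C. \<forall>y\<in>Y. cj y c = c}"
    have L: "subgroup L G"
    proof (rule finite_subgroupI)
      show "x \<otimes> y \<in> L" if "x \<in> L" "y \<in> L" for x y
        using that Cs Yc Cc by (auto simp: L_def sg_mult cj_mult)
    qed (use Cc Cs Yc in \<open>auto simp: L_def sg_one\<close>)
    have fixC: "cj a b = b" if "a \<in> C" "b \<in> C" for a b
      using that abelianD[OF ab] Cc by (simp add: cj_fix_iff)
    obtain M where M: "subgroup M G" "M \<subseteq> Y" "M \<inter> C = L"
      and commM: "\<And>y z. y \<in> Y \<Longrightarrow> z \<in> Y \<Longrightarrow> cj y z \<otimes> inv z \<in> M"
    proof (rule transfer_normal_complement[OF Y Cs(1) _ L])
      fix g u assume gu: "g \<in> Y - C" "u \<in> C" "cj g u \<in> C"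
      define w where "w = cj g u"
      let ?D = "{y \<in> Y. cj y w = w}"
      have D: "subgroup ?D G" using subgroup_centralizer[OF Y] gu Cc w_def by blast
      have CD: "C \<subseteq> ?D" using gu Cs fixC by (auto simp: w_def)
      \<comment> \<open>The conjugate of \<open>C\<close> under \<open>g\<close> is abelian and
        contains \<open>w\<close>, so it centralizes \<open>w\<close>. If the centralizer of
        \<open>w\<close> were only \<open>C\<close>, then \<open>g\<close> would normalize
        \<open>C\<close>, although \<open>C\<close> is its own normalizer.\<close>
      have "?D \<noteq> C"
      proof
        assume DC: "?D = C"
        have "cj g c \<in> C" if c: "c \<in> C" for c
        proof -
          have cs: "g \<in> carrier G" "c \<in> carrier G" "u \<in> carrier G" using gu c Yc Cc by auto
          have "cj (cj g c) w = cj g (cj c u)"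
            using cs by (simp add: w_def cj_cj) (simp add: cj_def m_assoc)
          also have "\<dots> = w" using fixC c gu by (simp add: w_def)
          finally have "cj g c \<in> ?D" using gu c Cs Y by (auto simp: cj_mem)
          then show ?thesis using DC by simp
        qed
        then have "g \<in> ?N" using gu by auto
        then show False using NeqC gu by auto
      qed
      then have "?D = Y" using mx[OF D CD] by blast
      then show "cj g u \<in> L" using gu by (auto simp: L_def w_def)
    next
      fix h k assume "h \<in> C" "k \<in> C"
      then show "cj h k \<otimes> inv k \<in> L" using fixC Cc L sg_one by simp
    qed (use Cs in \<open>auto simp: L_def\<close>)
    \<comment> \<open>Otherwise \<open>C = L\<close> would be central in \<open>Y\<close> and so
      normalized by all of \<open>Y\<close>, against the case assumption.\<close>
    have "M \<noteq> Y"
    proof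
      assume "M = Y"
      then have CL: "C = L" using M Cs by auto
      have "cj y c = c" if "y \<in> Y" "c \<in> C" for y c
      proof -
        have "c \<in> L" using that CL by simp
        then show ?thesis using that by (simp add: L_def)
      qed
      then have "Y \<subseteq> ?N" by auto
      then show False using False by auto
    qed
    then show ?thesis using that[OF M(1) _ commM] M(2) by blast
  qed
qed

text \<open>A maximal subgroup is abelian, so \<open>abelian_max_subgroup\<close> yields a proper
  subgroup containing all commutators; it is abelian as well.\<close>

lemma solv_minimal_nonabelian:
  assumes Y: "subgroup Y G" and ab: "\<And>U. subgroup U G \<Longrightarrow> U \<subset> Y \<Longrightarrow> \<not> nonabelian G U"
  shows "solv Y"
proof (cases "Y = {\<one>}")
  case False
  then have "{\<one>} \<subset> Y" using Y sg_one by blast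
  then obtain C where C: "max_subgroup Y C" using max_subgroup_exists[OF triv_subgroup] by metis
  then have "\<not> nonabelian G C" using ab by (auto simp: max_subgroup_def)
  then obtain M where M: "subgroup M G" "M \<subset> Y" "\<And>y z. y \<in> Y \<Longrightarrow> z \<in> Y \<Longrightarrow> cj y z \<otimes> inv z \<in> M"
    using abelian_max_subgroup[OF Y C] by metis
  then have "solv M" using solv_abelian ab by blast
  then show ?thesis using solv_extension[of M Y] M by blast
qed (simp add: solv_trivial)

end

section \<open>Subnormal and TI subgroups\<close>

context fin_group
begin

text \<open>Subnormality relative to a subgroup \<open>Y\<close>, as the induction on subgroups
  requires; for \<open>Y = carrier G\<close> it is \<open>subnormal\<close> (see
  \<open>snrm_carrier_iff\<close>).\<close>

inductive snrm :: "'a set \<Rightarrow> 'a set \<Rightarrow> bool" for Y where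
  snrm_top: "snrm Y Y"
| snrm_step: "snrm Y K \<Longrightarrow> subgroup H G \<Longrightarrow> H \<subseteq> K \<Longrightarrow> normalizes K H \<Longrightarrow> snrm Y H"

lemma snrm_sg: "snrm Y U \<Longrightarrow> subgroup Y G \<Longrightarrow> subgroup U G"
  by (induction rule: snrm.induct) auto

lemma snrm_Int:
  assumes "snrm Y U" "subgroup L G"
  shows "snrm (Y \<inter> L) (U \<inter> L)"
  using assms(1)
proof (induction rule: snrm.induct)
  case (snrm_step K H)
  have "normalizes (K \<inter> L) (H \<inter> L)"
    using snrm_step.hyps(4) cj_mem[OF assms(2)] unfolding normalizes_def by blast
  then show ?case
    using snrm.snrm_step[OF snrm_step.IH sg_Int[OF snrm_step.hyps(2) assms(2)]] snrm_step.hyps(3) by blast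
qed (rule snrm_top)

lemma snrm_restrict:
  assumes "snrm Y U" "subgroup L G" "L \<subseteq> Y" "U \<subseteq> L"
  shows "snrm L U"
  using snrm_Int[OF assms(1,2)] assms(3,4) by (metis inf.absorb1 inf.absorb2)

text \<open>\<open>W\<close> is the first proper member of the subnormal chain; it is normal in
  \<open>Y\<close> itself.\<close>

lemma snrm_proper:
  assumes "snrm Y U" "U \<noteq> Y"
  obtains W where "subgroup W G" "W \<subset> Y" "normalizes Y W" "U \<subseteq> W"
proof -
  have "U \<noteq> Y \<longrightarrow> (\<exists>W. subgroup W G \<and> W \<subset> Y \<and> normalizes Y W \<and> U \<subseteq> W)"
    using assms(1)
  proof (induction rule: snrm.induct)
    case (snrm_step K H)
    show ?case
    proof (cases "K = Y")
      case True
      then show ?thesis using snrm_step by blast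
    next
      case False
      then show ?thesis using snrm_step by (meson order.trans)
    qed
  qed simp
  then show ?thesis using assms(2) that by blast
qed

lemma snrm_max_normal:
  assumes "max_subgroup Y C" "snrm Y C"
  shows "normalizes Y C"
proof -
  obtain W where "subgroup W G" "W \<subset> Y" "normalizes Y W" "C \<subseteq> W"
    using snrm_proper[OF assms(2)] assms(1) by (metis max_subgroup_def psubset_eq)
  then show ?thesis using assms(1) by (auto simp: max_subgroup_def)
qed

lemma snrm_carrier_iff: "subnormal G U \<longleftrightarrow> snrm (carrier G) U"
proof
  assume "subnormal G U"
  then show "snrm (carrier G) U"
  proof (induction rule: subnormal.induct)
    case (subnormal_step K H)
    have "subgroup K G" using snrm_sg[OF subnormal_step.IH subgroup_self] .
    then show ?case
      using subnormal_step normal_relative_iff by (auto intro: snrm_step)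
  qed (rule snrm_top)
next
  assume "snrm (carrier G) U"
  then show "subnormal G U"
  proof (induction rule: snrm.induct)
    case (snrm_step K H)
    have "subgroup K G" using snrm_sg[OF snrm_step.hyps(1) subgroup_self] .
    then show ?case
      using snrm_step normal_relative_iff by (auto intro: subnormal.subnormal_step)
  qed (rule subnormal.subnormal_top)
qed

text \<open>The form in which TI is applied: one non-trivial element that \<open>g\<close> keeps
  inside \<open>U\<close> forces \<open>g\<close> to normalize \<open>U\<close>. By finiteness,
  mapping \<open>U\<close> into itself already means mapping it onto itself.\<close>

definition ti :: "'a set \<Rightarrow> 'a set \<Rightarrow> bool" where
  "ti Y U \<longleftrightarrow> (\<forall>g\<in>Y. (\<exists>u\<in>U. u \<noteq> \<one> \<and> cj g u \<in> U) \<longrightarrow> (\<forall>u\<in>U. cj g u \<in> U))"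

lemma tiD: "ti Y U \<Longrightarrow> g \<in> Y \<Longrightarrow> u \<in> U \<Longrightarrow> u \<noteq> \<one> \<Longrightarrow> cj g u \<in> U \<Longrightarrow> v \<in> U \<Longrightarrow> cj g v \<in> U"
  unfolding ti_def by blast

lemma TI_subgroup_iff:
  assumes U: "subgroup U G"
  shows "TI_subgroup G U \<longleftrightarrow> ti (carrier G) U"
proof -
  have Uc: "u \<in> carrier G" if "u \<in> U" for u using that U by auto
  \<comment> \<open>\<open>conj_set\<close> conjugates from the right and \<open>cj\<close> from the
    left, hence the inverse.\<close>
  have cs: "conj_set G U g = cj (inv g) ` U" if "g \<in> carrier G" for g
    using that by (simp add: conj_set_def cj_def)
  have one: "\<one> \<in> conj_set G U g \<inter> U" if "g \<in> carrier G" for g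
    using that U sg_one by (auto simp: cs image_iff intro!: bexI[of _ \<one>])
  show ?thesis
  proof
    assume T: "TI_subgroup G U"
    show "ti (carrier G) U"
      unfolding ti_def
    proof (intro ballI impI)
      fix g v assume g: "g \<in> carrier G" and ex: "\<exists>u\<in>U. u \<noteq> \<one> \<and> cj g u \<in> U" and v: "v \<in> U"
      obtain u where u: "u \<in> U" "u \<noteq> \<one>" "cj g u \<in> U" using ex by blast
      have "cj g u \<in> conj_set G U (inv g) \<inter> U" using u g by (auto simp: cs)
      moreover have "cj g u \<noteq> \<one>" using u g Uc by simp
      ultimately have "conj_set G U (inv g) \<inter> U = U" using T g unfolding TI_subgroup_def by (metis inv_closed singletonD)
      then have "U \<subseteq> cj g ` U" using g by (auto simp: cs)
      moreover have "card (cj g ` U) = card U" using g Uc by (intro card_image inj_onI) auto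
      ultimately have "cj g ` U = U" using sg_finite[OF U] by (metis card_subset_eq finite_imageI)
      then show "cj g v \<in> U" using v by blast
    qed
  next
    assume T: "ti (carrier G) U"
    have "conj_set G U g \<inter> U = {\<one>} \<or> conj_set G U g \<inter> U = U" if g: "g \<in> carrier G" for g
    proof (rule disjCI)
      assume n: "conj_set G U g \<inter> U \<noteq> U"
      have "w = \<one>" if "w \<in> conj_set G U g \<inter> U" for w
      proof (rule ccontr)
        assume w1: "w \<noteq> \<one>"
        obtain u where u: "u \<in> U" "w = cj (inv g) u" "w \<in> U"
          using \<open>w \<in> conj_set G U g \<inter> U\<close> g by (auto simp: cs)
        then have "u \<noteq> \<one>" using w1 g by auto
        then have "\<And>v. v \<in> U \<Longrightarrow> cj (inv g) v \<in> U" using tiD[OF T, of "inv g" u] u g by simp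
        then have "cj (inv g) ` U = U" using g U by (intro cj_image_eq) auto
        then show False using n cs[OF g] by simp
      qed
      then show "conj_set G U g \<inter> U = {\<one>}" using one[OF g] by blast
    qed
    then show "TI_subgroup G U" using U by (simp add: TI_subgroup_def)
  qed
qed

definition hyp :: "nat \<Rightarrow> 'a set \<Rightarrow> bool" where
  "hyp p Y \<longleftrightarrow> (\<forall>U. subgroup U G \<and> U \<subseteq> Y \<and> nonabelian G U \<and> p dvd card U \<longrightarrow> ti Y U \<or> snrm Y U)"

lemma hypD:
  "hyp p Y \<Longrightarrow> subgroup U G \<Longrightarrow> U \<subseteq> Y \<Longrightarrow> nonabelian G U \<Longrightarrow> p dvd card U \<Longrightarrow> ti Y U \<or> snrm Y U"
  unfolding hyp_def by blast

lemma hyp_mono: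
  assumes "hyp p Y" "subgroup L G" "L \<subseteq> Y"
  shows "hyp p L"
  unfolding hyp_def
proof (intro allI impI, elim conjE)
  fix U assume U: "subgroup U G" "U \<subseteq> L" "nonabelian G U" "p dvd card U"
  then have "ti Y U \<or> snrm Y U" using hypD[OF assms(1)] assms(3) by blast
  then show "ti L U \<or> snrm L U"
    using snrm_restrict[OF _ assms(2,3) U(2)] assms(3) by (auto simp: ti_def)
qed

lemma nonabelian_card:
  assumes "subgroup K G" "nonabelian G K"
  shows "card K > 2"
proof -
  obtain a b where ab: "a \<in> K" "b \<in> K" "a \<otimes> b \<noteq> b \<otimes> a" using assms(2) by (auto simp: nonabelian_def)
  then have c: "a \<in> carrier G" "b \<in> carrier G" using assms by auto
  then have "a \<noteq> \<one>" "b \<noteq> \<one>" "a \<noteq> b" using ab(3) by auto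
  then have "card {\<one>, a, b} = 3" by auto
  moreover have "{\<one>, a, b} \<subseteq> K" using ab assms sg_one by auto
  ultimately show ?thesis using card_mono[OF sg_finite[OF assms(1)], of "{\<one>, a, b}"] by simp
qed

text \<open>\<open>K\<close> is a counterexample to subnormality of largest order, so everything
  strictly above it is subnormal. Maximality is a counting argument: a proper \<open>D\<close>
  strictly above \<open>K\<close> lies in a proper normal \<open>W\<close>, and \<open>W\<close>
  contains all conjugates of \<open>K\<close>, that is, everything outside the kernel. The kernel
  has index \<open>card K \<ge> 3\<close>, so \<open>W\<close> would cover at least two thirds of
  \<open>Y\<close>, while a proper subgroup covers at most half.\<close>

lemma nonsubnormal_frobenius:
  assumes Y: "subgroup Y G" and h: "hyp p Y"
    and bad: "subgroup U G" "U \<subseteq> Y" "nonabelian G U" "p dvd card U" "\<not> snrm Y U"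
  obtains K where "frob_compl Y K" "max_subgroup Y K" "nonabelian G K" "p dvd card K" "\<not> snrm Y K"
proof -
  define bd where "bd U \<longleftrightarrow> subgroup U G \<and> U \<subseteq> Y \<and> nonabelian G U \<and> p dvd card U \<and> \<not> snrm Y U" for U
  have "bd U" using bad by (simp add: bd_def)
  moreover have "\<forall>V. bd V \<longrightarrow> card V \<le> card Y"
    using Y sg_finite by (auto simp: bd_def card_mono)
  ultimately obtain K where K: "bd K" and mxK: "\<And>V. bd V \<Longrightarrow> card V \<le> card K"
    using ex_has_greatest_nat[of bd U card "Suc (card Y)"] le_imp_less_Suc by blast
  have Ks: "subgroup K G" "K \<subseteq> Y" "nonabelian G K" "p dvd card K" "\<not> snrm Y K" using K by (auto simp: bd_def)
  have up: "snrm Y D" if "subgroup D G" "K \<subset> D" "D \<subseteq> Y" for D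
  proof (rule ccontr)
    assume "\<not> snrm Y D"
    moreover have "p dvd card D" using Ks(4) sg_card_dvd[OF Ks(1) that(1)] that(2) by (meson dvd_trans psubset_imp_subset)
    ultimately have "bd D" using that nonabelian_mono[OF Ks(3)] by (auto simp: bd_def)
    then show False using mxK[of D] sg_card_less[OF that(1,2)] by simp
  qed
  let ?N = "{y \<in> Y. \<forall>c\<in>K. cj y c \<in> K}"
  have N: "subgroup ?N G" using subgroup_normalizer[OF Y Ks(1)] .
  have "K \<subseteq> ?N" using Ks by (auto simp: cj_mem)
  \<comment> \<open>A strictly larger normalizer would be subnormal in \<open>Y\<close>, and
    \<open>K\<close>, being normal in it, would be subnormal too.\<close>
  moreover have "\<not> K \<subset> ?N"
  proof
    assume "K \<subset> ?N"
    then have "snrm Y ?N" using up N by blast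
    then have "snrm Y K"
      using snrm_step[of Y ?N K] Ks(1) \<open>K \<subseteq> ?N\<close> by (auto simp: normalizes_def)
    then show False using Ks by simp
  qed
  ultimately have NK: "?N = K" by blast
  have tiK: "ti Y K" using hypD[OF h Ks(1-4)] Ks(5) by simp
  have fc: "frob_compl Y K"
    unfolding frob_compl_def
  proof (intro conjI ballI impI)
    fix g h assume a: "g \<in> Y" "h \<in> K" "h \<noteq> \<one> \<and> cj g h \<in> K"
    then have "g \<in> ?N" using tiD[OF tiK a(1,2)] by auto
    then show "g \<in> K" using NK by simp
  qed (use Y Ks in auto)
  have KY: "K \<noteq> Y" using Ks snrm_top by blast
  have "D = K" if D: "subgroup D G" "K \<subseteq> D" "D \<subset> Y" for D
  proof (rule ccontr)
    assume "D \<noteq> K"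
    then have "snrm Y D" using up[of D] D by auto
    then obtain W where W: "subgroup W G" "W \<subset> Y" "normalizes Y W" "D \<subseteq> W"
      using snrm_proper D by (metis psubset_eq)
    have "Y - frob_ker Y K \<subseteq> W"
    proof
      fix y assume "y \<in> Y - frob_ker Y K"
      then obtain g where g: "y \<in> Y" "g \<in> Y" "cj g y \<in> K" by (auto simp: frob_ker_def)
      then have "cj g y \<in> W" using W(4) D(2) by blast
      then have "cj (inv g) (cj g y) \<in> W" using normalizesD[OF W(3) sg_inv[OF Y g(2)]] by blast
      then show "y \<in> W" using g Y by (metis cj_inv_left sgD)
    qed
    then have "card (Y - frob_ker Y K) \<le> card W" using W sg_finite by (simp add: card_mono)
    moreover have "card (Y - frob_ker Y K) = card Y - card (frob_ker Y K)"
      using Y sg_finite by (intro card_Diff_subset) (auto simp: frob_ker_def)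
    moreover have "2 * card W \<le> card Y"
    proof -
      obtain c where c: "card Y = card W * c" using sg_card_dvd[OF W(1) Y] W(2) by (auto simp: dvd_def)
      have "c \<noteq> 0" "c \<noteq> 1" using c sg_card_pos[OF Y] sg_card_less[OF Y W(2)] by auto
      then show ?thesis using c by (cases c) auto
    qed
    moreover have "card (frob_ker Y K) * card K = card Y" using card_frob_ker[OF fc] .
    moreover have "card K > 2" using nonabelian_card Ks by blast
    moreover have "card (frob_ker Y K) > 0"
      using calculation(4) sg_card_pos[OF Y] by (metis mult_is_0 neq0_conv)
    moreover have "card (frob_ker Y K) * 3 \<le> card (frob_ker Y K) * card K" using \<open>card K > 2\<close> by simp
    ultimately show False by linarith
  qed
  then have "max_subgroup Y K" using Ks KY by (auto simp: max_subgroup_def)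
  then show ?thesis using that fc Ks by blast
qed

end

section \<open>The Frobenius kernel under the TI-or-subnormal hypothesis\<close>

locale frob_TI = fin_group +
  fixes Y K :: "'a set" and p :: nat
  assumes fc: "frob_compl Y K" and hypY: "hyp p Y" and prime_p: "prime p"
    and K_proper: "K \<noteq> Y" and ker_sg: "subgroup (frob_ker Y K) G"
begin

abbreviation N where "N \<equiv> frob_ker Y K"

lemma Y_sg: "subgroup Y G" and K_sg: "subgroup K G" and K_sub: "K \<subseteq> Y"
  using frob_complD[OF fc] by auto

lemma N_sub: "N \<subseteq> Y"
  by (auto simp: frob_ker_def)

lemma Nc: "n \<in> N \<Longrightarrow> n \<in> carrier G"
  using ker_sg by auto

lemma Kc: "n \<in> K \<Longrightarrow> n \<in> carrier G"
  using K_sg by auto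

lemma Y_normalizes_N: "normalizes Y N"
  using frob_ker_normalized[OF fc] by (auto simp: normalizes_def)

lemma N_Int_K: "N \<inter> K = {\<one>}"
proof -
  have "n = \<one>" if "n \<in> N" "n \<in> K" for n
    using frob_kerD[OF that(1), of \<one>] that Y_sg sg_one Nc by simp
  then show ?thesis using K_sg ker_sg sg_one by blast
qed

lemma N_mult_K: "N <#> K = Y"
proof (rule card_subset_eq)
  show "finite Y" using Y_sg sg_finite by blast
  show "N <#> K \<subseteq> Y" using set_mult_subset[OF Y_sg N_sub K_sub] .
  show "card (N <#> K) = card Y"
    using card_set_mult[OF ker_sg K_sg N_Int_K] card_frob_ker[OF fc] by simp
qed

lemma N_nontrivial: "N \<noteq> {\<one>}"
proof
  assume "N = {\<one>}"
  then have "card K = card Y" using card_frob_ker[OF fc] by simp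
  then show False using K_proper sg_card_eq[OF Y_sg K_sub] by simp
qed

lemma fixed_point_free: "k \<in> K \<Longrightarrow> k \<noteq> \<one> \<Longrightarrow> n \<in> N \<Longrightarrow> cj k n = n \<Longrightarrow> n = \<one>"
proof -
  assume a: "k \<in> K" "k \<noteq> \<one>" "n \<in> N" "cj k n = n"
  then have "cj n k = k" using cj_fix_sym[of k n] Kc Nc by simp
  then have "n \<in> K" using frob_complD(4)[OF fc, of n k] a N_sub by auto
  then show ?thesis using a N_Int_K by auto
qed

text \<open>Equal commutators with \<open>k\<close> make \<open>inv f \<otimes> e\<close> a fixed
  point of \<open>k\<close>.\<close>

lemma commutator_inj:
  assumes "k \<in> K" "k \<noteq> \<one>" "e \<in> N" "f \<in> N" "cj k e \<otimes> inv e = cj k f \<otimes> inv f"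
  shows "e = f"
proof -
  have c: "k \<in> carrier G" "e \<in> carrier G" "f \<in> carrier G" using assms Kc Nc by auto
  have "cj k e = (cj k e \<otimes> inv e) \<otimes> e" using c by (simp add: m_assoc)
  also have "\<dots> = cj k f \<otimes> (inv f \<otimes> e)" using c assms(5) by (simp add: m_assoc)
  finally have "cj k (inv f \<otimes> e) = inv f \<otimes> e" using c by (simp add: cj_mult cj_inv)
  then have "inv f \<otimes> e = \<one>"
    using fixed_point_free[OF assms(1,2), of "inv f \<otimes> e"] assms ker_sg by (simp add: sg_mult sg_inv)
  then show ?thesis using c by (metis inv_equality inv_inv inv_closed)
qed

text \<open>Taking commutators with \<open>k\<close> is an injective self-map of the finite set
  \<open>D\<close>, hence onto.\<close>

lemma commutator_surj:
  assumes k: "k \<in> K" "k \<noteq> \<one>" and D: "subgroup D G" "D \<subseteq> N" "\<And>d. d \<in> D \<Longrightarrow> cj k d \<in> D" and d: "d \<in> D"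
  obtains e where "e \<in> D" "d = cj k e \<otimes> inv e"
proof -
  have "inj_on (\<lambda>e. cj k e \<otimes> inv e) D"
    using commutator_inj[OF k] D(2) by (intro inj_onI) auto
  moreover have "(\<lambda>e. cj k e \<otimes> inv e) ` D \<subseteq> D"
    using D by (auto simp: sg_mult sg_inv)
  ultimately have "(\<lambda>e. cj k e \<otimes> inv e) ` D = D"
    using sg_finite[OF D(1)] by (simp add: endo_inj_surj)
  then show ?thesis using d that by blast
qed

text \<open>Descent along the chain: every \<open>n \<in> N\<close> is a commutator of
  \<open>k\<close> with some \<open>e \<in> N\<close>. If \<open>k\<close> lies in \<open>H\<close>
  and \<open>e\<close> in \<open>L\<close>, which normalizes \<open>H\<close>, that commutator lies
  in \<open>H\<close>.\<close>

lemma subnormal_contains_N: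
  assumes "snrm Y U" "k \<in> K" "k \<noteq> \<one>" "k \<in> U"
  shows "N \<subseteq> U"
  using assms(1,4)
proof (induction rule: snrm.induct)
  case (snrm_step L H)
  have NL: "N \<subseteq> L" using snrm_step by blast
  show ?case
  proof
    fix n assume n: "n \<in> N"
    have "\<And>d. d \<in> N \<Longrightarrow> cj k d \<in> N" using Y_normalizes_N assms K_sub normalizesD by blast
    then obtain e where e: "e \<in> N" "n = cj k e \<otimes> inv e"
      using commutator_surj[OF assms(2,3) ker_sg order.refl _ n] by metis
    have c: "e \<in> carrier G" "k \<in> carrier G" using e Nc assms Kc by auto
    have "n = k \<otimes> cj e (inv k)" using e c by (simp add: cj_def m_assoc)
    moreover have "cj e (inv k) \<in> H"
      using snrm_step.hyps(4) e NL snrm_step.prems snrm_step.hyps(2) by (intro normalizesD[of L H]) (auto simp: sg_inv)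
    ultimately show "n \<in> H" using snrm_step by (simp add: sg_mult)
  qed
qed (rule N_sub)

text \<open>The group \<open>U\<close>, the product of \<open>D\<close> and \<open>powers x\<close>,
  is non-abelian and meets \<open>N\<close> exactly in \<open>D\<close>. It does not contain
  \<open>N\<close>, so it is not subnormal and must be TI. Hence \<open>n\<close> normalizes
  \<open>U\<close>, and the commutator of \<open>x\<close> and \<open>n\<close> lies in
  \<open>U \<inter> N = D\<close>. It is also the commutator of \<open>x\<close> with some
  \<open>e \<in> D\<close>, and injectivity gives \<open>n = e\<close>.\<close>

lemma invariant_subgroup_TI:
  assumes x: "x \<in> K" "ord x = p" and D: "subgroup D G" "D \<subset> N" "D \<noteq> {\<one>}" "\<And>d. d \<in> D \<Longrightarrow> cj x d \<in> D"
    and n: "n \<in> N" "d \<in> D" "d \<noteq> \<one>" "cj n d \<in> D"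
  shows "n \<in> D"
proof -
  have xc: "x \<in> carrier G" using x Kc by blast
  have x1: "x \<noteq> \<one>" using x prime_p by auto
  have px: "subgroup (powers x) G" "powers x \<subseteq> K" using powers_sg[OF xc] powers_subset[OF K_sg x(1)] by auto
  define U where "U = D <#> powers x"
  have U: "subgroup U G"
    unfolding U_def using normalizes_powers[OF xc D(1) D(4)] by (intro subgroup_set_mult D px)
  have DU: "D \<subseteq> U" and pU: "powers x \<subseteq> U"
    unfolding U_def using subset_set_mult1 subset_set_mult2 D px by auto
  have UN: "U \<inter> N = D"
  proof -
    have "U \<inter> N = D <#> (powers x \<inter> N)"
      unfolding U_def using D by (intro set_mult_Int px ker_sg) auto
    also have "powers x \<inter> N = {\<one>}" using N_Int_K px sg_one ker_sg by blast
    also have "D <#> {\<one>} = D" using D(1) by (auto simp: set_mult_def) (metis r_one sgD)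
    finally show ?thesis .
  qed
  have xU: "x \<in> U" using pU xc by auto
  have "d \<in> N" using n D by auto
  then have "cj x d \<noteq> d" using fixed_point_free[OF x(1) x1] n by blast
  then have "x \<otimes> d \<noteq> d \<otimes> x" using cj_fix_iff[of x d] xc Nc[OF \<open>d \<in> N\<close>] by simp
  then have nab: "nonabelian G U" using xU DU n by (intro nonabelianI[of x U d]) auto
  have "p dvd card U" using ord_dvd_card[OF U xU] x by simp
  moreover have UY: "U \<subseteq> Y" unfolding U_def using D N_sub px K_sub by (intro set_mult_subset Y_sg) auto
  ultimately have "ti Y U \<or> snrm Y U" using hypD[OF hypY U _ nab] by blast
  moreover have "\<not> snrm Y U"
  proof
    assume "snrm Y U"
    then have "N \<subseteq> U" using subnormal_contains_N[OF _ x(1) x1 xU] by blast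
    then show False using UN D by blast
  qed
  ultimately have "ti Y U" by simp
  then have cx: "cj n (inv x) \<in> U"
    using tiD[of Y U n d "inv x"] n N_sub DU xU U sg_inv by auto
  have nc: "n \<in> carrier G" using n Nc by simp
  have "cj x n \<otimes> inv n = x \<otimes> cj n (inv x)" using nc xc by (simp add: cj_def m_assoc)
  then have "cj x n \<otimes> inv n \<in> U" using cx xU U by (simp add: sg_mult)
  moreover have "cj x n \<otimes> inv n \<in> N"
    using n x K_sub Y_normalizes_N ker_sg by (auto intro!: sg_mult sg_inv normalizesD[OF Y_normalizes_N])
  ultimately have cD: "cj x n \<otimes> inv n \<in> D" using UN by blast
  obtain e where "e \<in> D" "cj x n \<otimes> inv n = cj x e \<otimes> inv e"
    using commutator_surj[OF x(1) x1 D(1) _ D(4) cD] D(2) by (metis psubset_imp_subset)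
  then show ?thesis using commutator_inj[OF x(1) x1 n(1), of e] D(2) by auto
qed

text \<open>The \<open>p\<close>-group \<open>powers x\<close> fixes only the identity of
  \<open>N\<close>, so the size of \<open>N\<close> is not divisible by \<open>p\<close>.\<close>

lemma p_not_dvd_N:
  assumes x: "x \<in> K" "ord x = p"
  shows "\<not> p dvd card N"
proof -
  have xc: "x \<in> carrier G" using x Kc by blast
  have pc: "g \<in> Y" if "g \<in> powers x" for g using that powers_subset[OF K_sg x(1)] K_sub by auto
  have "p dvd card N \<longleftrightarrow> p dvd card {s \<in> N. \<forall>g\<in>powers x. cj g s = s}"
  proof (rule card_fixed_points_mod)
    show "subgroup (powers x) G" "card (powers x) = p ^ 1" using xc x powers_sg card_powers by auto
    show "finite N" using ker_sg sg_finite by blast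
    show "cj g s \<in> N" if "g \<in> powers x" "s \<in> N" for g s using that pc Y_normalizes_N normalizesD by blast
    show "cj (g \<otimes> h) s = cj g (cj h s)" if "g \<in> powers x" "h \<in> powers x" "s \<in> N" for g h s
      using that pc Y_sg Nc cj_cj by (metis sgD)
  qed (use prime_p Nc in auto)
  moreover have "{s \<in> N. \<forall>g\<in>powers x. cj g s = s} = {\<one>}"
  proof -
    have "x \<noteq> \<one>" using x prime_p by auto
    then have "s = \<one>" if "s \<in> N" "\<forall>g\<in>powers x. cj g s = s" for s
      using fixed_point_free[OF x(1) _ that(1)] that xc by auto
    moreover have "\<one> \<in> N" "\<forall>g\<in>powers x. cj g \<one> = \<one>"
      using ker_sg sg_one sgD[OF powers_sg[OF xc]] by auto
    ultimately show ?thesis by blast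
  qed
  ultimately show ?thesis using prime_p by auto
qed

text \<open>An \<open>x\<close>-invariant Sylow subgroup \<open>R\<close> that is proper in
  \<open>N\<close> would be a Frobenius complement in \<open>N\<close> by
  \<open>invariant_subgroup_TI\<close>, with a kernel that is again proper, non-trivial and
  \<open>x\<close>-invariant. The same lemma then applies to that kernel; but the kernel is normal
  in \<open>N\<close>, so it would contain all of \<open>N\<close>.\<close>

lemma kernel_prime_power:
  assumes x: "x \<in> K" "ord x = p"
  obtains q a where "prime q" "q \<noteq> p" "card N = q ^ a"
proof -
  have xc: "x \<in> carrier G" using x Kc by blast
  have Nx: "cj x m \<in> N" if "m \<in> N" for m using that x K_sub Y_normalizes_N normalizesD by blast
  have "card N \<noteq> 1" using N_nontrivial ker_sg sg_one by (metis card_1_singletonE singletonD)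
  then obtain q where q: "prime q" "q dvd card N" using prime_factor_nat by blast
  then have qp: "q \<noteq> p" using p_not_dvd_N[OF x] by auto
  obtain R where R: "subgroup R G" "R \<subseteq> N" "card R = q ^ multiplicity q (card N)" "\<And>y. y \<in> R \<Longrightarrow> cj x y \<in> R"
    using invariant_sylow[OF ker_sg xc _ Nx _ q(1)] x prime_p p_not_dvd_N[OF x] by metis
  have Rq: "q dvd card R"
  proof -
    have "card N \<noteq> 0" using sg_card_pos[OF ker_sg] by simp
    then have "multiplicity q (card N) > 0" using q by (simp add: prime_multiplicity_gt_zero_iff)
    then show ?thesis using R by simp
  qed
  have R1: "R \<noteq> {\<one>}" using Rq q by auto
  have "R = N"
  proof (rule ccontr)
    assume "R \<noteq> N"
    then have RN: "R \<subset> N" using R by blast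
    have fcR: "frob_compl N R"
      unfolding frob_compl_def
    proof (intro conjI ballI impI ker_sg R)
      show "g \<in> R" if "g \<in> N" "h \<in> R" "h \<noteq> \<one> \<and> cj g h \<in> R" for g h
        using invariant_subgroup_TI[OF x R(1) RN R1 R(4) that(1,2)] that(3) by simp
    qed
    have "solv R" using solv_prime_power[OF q(1) R(1,3)] .
    then have M: "subgroup (frob_ker N R) G" using frobenius_kernel[OF fcR] by simp
    have cM: "card (frob_ker N R) * card R = card N" using card_frob_ker[OF fcR] .
    have MN: "frob_ker N R \<subseteq> N" by (auto simp: frob_ker_def[of N])
    have Mx: "cj x d \<in> frob_ker N R" if "d \<in> frob_ker N R" for d
      by (rule frob_ker_cj[OF ker_sg _ _ xc R(2) that]) (use Nx R in auto)
    have M1: "frob_ker N R \<noteq> {\<one>}"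
    proof
      assume "frob_ker N R = {\<one>}"
      then have "card R = card N" using cM by simp
      then show False using sg_card_less[OF ker_sg RN] by simp
    qed
    have MnN: "frob_ker N R \<noteq> N"
    proof
      assume "frob_ker N R = N"
      then have "card R = 1" using cM sg_card_pos[OF ker_sg] by simp
      then show False using Rq q by auto
    qed
    obtain m where m: "m \<in> frob_ker N R" "m \<noteq> \<one>" using M1 M sg_one by blast
    have "n \<in> frob_ker N R" if n: "n \<in> N" for n
      using invariant_subgroup_TI[OF x M _ M1 Mx n m] MN MnN frob_ker_normalized[OF fcR n m(1)] by blast
    then show False using MN MnN by blast
  qed
  then show ?thesis using that q(1) qp R(3) by blast
qed

text \<open>In the \<open>q\<close>-group \<open>N\<close> some element outside a proper
  \<open>D\<close> normalizes \<open>D\<close>; by \<open>invariant_subgroup_TI\<close> it would lie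
  in \<open>D\<close>.\<close>

lemma kernel_irreducible:
  assumes x: "x \<in> K" "ord x = p" and D: "subgroup D G" "D \<subseteq> N" "\<And>d. d \<in> D \<Longrightarrow> cj x d \<in> D"
  shows "D = {\<one>} \<or> D = N"
proof (rule ccontr)
  assume "\<not> (D = {\<one>} \<or> D = N)"
  then have a: "D \<noteq> {\<one>}" "D \<subset> N" using D by auto
  obtain q b where q: "prime q" "card N = q ^ b" using kernel_prime_power[OF x] by metis
  obtain g where g: "g \<in> N - D" "\<And>c. c \<in> D \<Longrightarrow> cj g c \<in> D"
    using normalizer_grows[OF q(1) ker_sg q(2) D(1) a(2)] by metis
  obtain d where d: "d \<in> D" "d \<noteq> \<one>" using a(1) D(1) sg_one by blast
  then have "g \<in> D" using invariant_subgroup_TI[OF x D(1) a(2,1) D(3)] g by auto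
  then show False using g by simp
qed

text \<open>The centre of the \<open>q\<close>-group \<open>N\<close> is non-trivial and
  \<open>x\<close>-invariant, so irreducibility makes it all of \<open>N\<close>.\<close>

lemma kernel_abelian:
  assumes x: "x \<in> K" "ord x = p" and mn: "m \<in> N" "n \<in> N"
  shows "m \<otimes> n = n \<otimes> m"
proof -
  have xc: "x \<in> carrier G" using x Kc by blast
  obtain q b where q: "prime q" "card N = q ^ b" using kernel_prime_power[OF x] by metis
  let ?Z = "{s \<in> N. \<forall>g\<in>N. cj g s = s}"
  have "q dvd card N \<longleftrightarrow> q dvd card ?Z"
  proof (rule card_fixed_points_mod[OF ker_sg q(2,1)])
    show "finite N" using ker_sg sg_finite by blast
    show "cj g s \<in> N" if "g \<in> N" "s \<in> N" for g s using that ker_sg cj_mem by blast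
    show "cj (g \<otimes> h) s = cj g (cj h s)" if "g \<in> N" "h \<in> N" "s \<in> N" for g h s
      using that Nc cj_cj by simp
  qed (use Nc in auto)
  moreover have "q dvd card N"
  proof -
    have "card N \<noteq> 1" using N_nontrivial ker_sg sg_one by (metis card_1_singletonE singletonD)
    then have "b \<noteq> 0" using q by (cases b) auto
    then show ?thesis using q by simp
  qed
  ultimately have "?Z \<noteq> {\<one>}" using q by auto
  moreover have "subgroup ?Z G"
  proof (rule finite_subgroupI)
    show "u \<otimes> v \<in> ?Z" if "u \<in> ?Z" "v \<in> ?Z" for u v
      using that ker_sg Nc by (auto simp: sg_mult cj_mult)
  qed (use Nc ker_sg in \<open>auto simp: sg_one\<close>)
  moreover have "cj x s \<in> ?Z" if s: "s \<in> ?Z" for s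
  proof -
    have Nx: "cj y m \<in> N" if "m \<in> N" "y \<in> K" for m y using that K_sub Y_normalizes_N normalizesD by blast
    have "cj g (cj x s) = cj x s" if g: "g \<in> N" for g
    proof -
      have c: "g \<in> carrier G" "s \<in> carrier G" using g s Nc by auto
      have "cj (inv x) g \<in> N" using Nx g x K_sg sg_inv by blast
      then have "cj (cj (inv x) g) s = s" using s by auto
      moreover have "cj g (cj x s) = cj x (cj (cj (inv x) g) s)"
        using c xc by (simp add: cj_cj) (simp add: cj_def m_assoc)
      ultimately show ?thesis by simp
    qed
    then show ?thesis using s Nx x by auto
  qed
  ultimately have "?Z = N" using kernel_irreducible[OF x, of ?Z] by blast
  then have "cj m n = n" using mn by blast
  then show ?thesis using cj_fix_iff mn Nc by simp
qed

text \<open>In the abelian group \<open>N\<close> the elements killed by \<open>q\<close> form an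
  \<open>x\<close>-invariant subgroup, non-trivial by Cauchy, so irreducibility applies
  again.\<close>

lemma kernel_exponent:
  assumes x: "x \<in> K" "ord x = p" and q: "prime q" "card N = q ^ b" and n: "n \<in> N"
  shows "n [^] q = \<one>"
proof -
  have xc: "x \<in> carrier G" using x Kc by blast
  let ?D = "{n \<in> N. n [^] q = \<one>}"
  have "subgroup ?D G"
  proof (rule finite_subgroupI)
    show "u \<otimes> v \<in> ?D" if "u \<in> ?D" "v \<in> ?D" for u v
      using that ker_sg Nc kernel_abelian[OF x, of u v] by (auto simp: sg_mult pow_mult_distrib)
  qed (use Nc ker_sg in \<open>auto simp: sg_one\<close>)
  moreover have "cj x d \<in> ?D" if "d \<in> ?D" for d
  proof -
    have "cj x d \<in> N" using that K_sub Y_normalizes_N normalizesD x by blast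
    moreover have "cj x d [^] q = \<one>" using that xc Nc cj_pow[of x d q] by auto
    ultimately show ?thesis by simp
  qed
  moreover have "?D \<noteq> {\<one>}"
  proof -
    have "card N \<noteq> 1" using N_nontrivial ker_sg sg_one by (metis card_1_singletonE singletonD)
    then have "b \<noteq> 0" using q by (cases b) auto
    then have "q dvd card N" using q by simp
    then obtain y where y: "y \<in> N" "ord y = q" using cauchy[OF ker_sg q(1)] by metis
    then have "y \<in> ?D" "y \<noteq> \<one>" using Nc pow_ord_eq_1[of y] q(1) by auto
    then show ?thesis by blast
  qed
  ultimately have "?D = N" using kernel_irreducible[OF x, of ?D] by blast
  then show ?thesis using n by blast
qed

end

section \<open>Solvability of the groups satisfying the hypothesis\<close>

context fin_group
begin

text \<open>Induction on the order. A non-subnormal witness gives a Frobenius group with solvable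
  complement and abelian kernel. Failing that, a proper non-abelian subgroup of order divisible by
  \<open>p\<close> lies in a maximal one, which is subnormal, hence normal, and solvable by
  induction. In the remaining case every proper subgroup of order divisible by \<open>p\<close> is
  abelian, and \<open>abelian_max_subgroup\<close> reduces the claim to a proper normal subgroup
  \<open>M\<close>.\<close>

lemma hyp_imp_solv:
  assumes p: "prime p"
  shows "subgroup Y G \<Longrightarrow> hyp p Y \<Longrightarrow> p dvd card Y \<Longrightarrow> solv Y"
proof (induction "card Y" arbitrary: Y rule: less_induct)
  case less
  note Y = less.prems(1) and h = less.prems(2) and pY = less.prems(3)
  have Yc: "y \<in> carrier G" if "y \<in> Y" for y using that Y by auto
  have IH: "solv L" if "subgroup L G" "L \<subset> Y" "p dvd card L" for L
    using less.hyps[OF sg_card_less[OF Y that(2)] that(1) _ that(3)] hyp_mono[OF h that(1)] that(2) by blast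
  show ?case
  proof (cases "\<exists>U. subgroup U G \<and> U \<subseteq> Y \<and> nonabelian G U \<and> p dvd card U \<and> \<not> snrm Y U")
    case True
    then obtain K where K: "frob_compl Y K" "max_subgroup Y K" "nonabelian G K" "p dvd card K"
      using nonsubnormal_frobenius[OF Y h] by metis
    then have Ks: "subgroup K G" "K \<subset> Y" by (auto simp: max_subgroup_def)
    have sK: "solv K" using IH Ks K by blast
    note ker = frobenius_kernel[OF K(1) sK]
    interpret F: frob_TI G Y K p
      using K(1) h p Ks(2) ker by (simp add: frob_TI_def frob_TI_axioms_def fin_group_axioms psubset_eq)
    obtain x where x: "x \<in> K" "ord x = p" using cauchy[OF Ks(1) p K(4)] by metis
    have "\<not> nonabelian G (frob_ker Y K)"
      using F.kernel_abelian[OF x] by (auto simp: nonabelian_def)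
    then show ?thesis using ker solv_abelian by blast
  next
    case False
    then have sn: "snrm Y U" if "subgroup U G" "U \<subseteq> Y" "nonabelian G U" "p dvd card U" for U using that by blast
    show ?thesis
    proof (cases "\<exists>U. subgroup U G \<and> U \<subset> Y \<and> nonabelian G U \<and> p dvd card U")
      case True
      then obtain U where U: "subgroup U G" "U \<subset> Y" "nonabelian G U" "p dvd card U" by blast
      obtain C where C: "max_subgroup Y C" "U \<subseteq> C" using max_subgroup_exists[OF U(1,2)] by metis
      then have Cs: "subgroup C G" "C \<subset> Y" by (auto simp: max_subgroup_def)
      have pC: "p dvd card C" using U(4) sg_card_dvd[OF U(1) Cs(1) C(2)] by (rule dvd_trans)
      have "snrm Y C" using sn[OF Cs(1)] Cs nonabelian_mono[OF U(3) C(2)] pC by blast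
      then have "normalizes Y C" using snrm_max_normal C by blast
      then show ?thesis using solv_max_normal[OF Y C(1)] IH Cs pC by blast
    next
      case noU: False
      have ab: "\<not> nonabelian G U" if "subgroup U G" "U \<subset> Y" "p dvd card U" for U using noU that by blast
      obtain x where x: "x \<in> Y" "ord x = p" using cauchy[OF Y p pY] by metis
      have xc: "x \<in> carrier G" using x Yc by blast
      have px: "subgroup (powers x) G" "powers x \<subseteq> Y" "x \<in> powers x" "card (powers x) = p"
        using powers_sg[OF xc] powers_subset[OF Y x(1)] xc card_powers x by auto
      show ?thesis
      proof (cases "powers x = Y")
        case True
        then show ?thesis using solv_prime_power[OF p Y, of 1] px by simp
      next
        case False
        then have "powers x \<subset> Y" using px by blast
        then obtain C where C: "max_subgroup Y C" "powers x \<subseteq> C" using max_subgroup_exists[OF px(1)] by metis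
        then have Cs: "subgroup C G" "C \<subset> Y" by (auto simp: max_subgroup_def)
        have "p dvd card C" using sg_card_dvd[OF px(1) Cs(1) C(2)] px(4) by simp
        then have "\<not> nonabelian G C" using ab Cs by blast
        then obtain M where M: "subgroup M G" "M \<subset> Y" and cM: "\<And>y z. y \<in> Y \<Longrightarrow> z \<in> Y \<Longrightarrow> cj y z \<otimes> inv z \<in> M"
          using abelian_max_subgroup[OF Y C(1)] by metis
        have nM: "normalizes Y M" using commutators_imp_normalizes[OF Y M(1)] M(2) cM by blast
        have "solv M"
        proof (cases "p dvd card M")
          case True
          then show ?thesis using IH M by blast
        next
          case pM: False
          have xM: "x \<notin> M" using ord_dvd_card[OF M(1), of x] x pM by auto
          define T where "T = M <#> powers x"
          have T: "subgroup T G" unfolding T_def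
            using M px nM by (intro subgroup_set_mult normalizes_mono[OF nM]) auto
          have MT: "M \<subseteq> T" and xT: "x \<in> T" and TY: "T \<subseteq> Y"
            unfolding T_def using subset_set_mult1[OF M(1) px(1)] subset_set_mult2[OF M(1) px(1)] px
              set_mult_subset[OF Y, of M "powers x"] M by auto
          have pT: "p dvd card T" using ord_dvd_card[OF T xT] x by simp
          show ?thesis
          proof (cases "T = Y")
            case False
            then have "\<not> nonabelian G T" using ab[OF T] TY pT by blast
            then show ?thesis using solv_abelian[OF T] solv_mono MT by blast
          next
            case TeY: True
            have Mx: "cj x m \<in> M" if "m \<in> M" for m using nM that x normalizesD by blast
            \<comment> \<open>An \<open>x\<close>-invariant proper subgroup of \<open>M\<close>
              together with \<open>x\<close> generates a proper subgroup of
              \<open>Y = M <#> powers x\<close> of order divisible by \<open>p\<close>; in the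
              present case such subgroups are abelian, so \<open>x\<close> centralizes
              \<open>U\<close>.\<close>
            have add: "U <#> powers x \<subset> Y \<and> subgroup (U <#> powers x) G \<and> p dvd card (U <#> powers x)
                \<and> U \<subseteq> U <#> powers x \<and> x \<in> U <#> powers x"
              if U: "subgroup U G" "U \<subset> M" "\<And>u. u \<in> U \<Longrightarrow> cj x u \<in> U" for U
            proof -
              have s: "subgroup (U <#> powers x) G"
                using normalizes_powers[OF xc U(1,3)] by (intro subgroup_set_mult U px)
              have i: "M \<inter> powers x = {\<one>}" "U \<inter> powers x = {\<one>}"
                using prime_card_trivial_Int[OF xc _ M(1) xM] x p U sg_one[OF U(1)] sg_one[OF px(1)] by auto
              have "card (U <#> powers x) = card U * card (powers x)" "card T = card M * card (powers x)"
                unfolding T_def using card_set_mult[OF U(1) px(1) i(2)] card_set_mult[OF M(1) px(1) i(1)] by auto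
              then have "card (U <#> powers x) < card Y"
                using sg_card_less[OF M(1) U(2)] TeY px(4) p prime_gt_0_nat by simp
              moreover have "U <#> powers x \<subseteq> Y" using U M px by (intro set_mult_subset Y) auto
              ultimately have "U <#> powers x \<subset> Y" by auto
              moreover have "U \<subseteq> U <#> powers x" "x \<in> U <#> powers x"
                using subset_set_mult1[OF U(1) px(1)] subset_set_mult2[OF U(1) px(1)] px(3) by auto
              ultimately show ?thesis using s ord_dvd_card[OF s, of x] x by auto
            qed
            have fixU: "cj x u = u" if U: "subgroup U G" "U \<subset> M" "\<And>u. u \<in> U \<Longrightarrow> cj x u \<in> U" and u: "u \<in> U" for U u
            proof -
              have "\<not> nonabelian G (U <#> powers x)" using ab add[OF U] by blast
              then have "x \<otimes> u = u \<otimes> x" using add[OF U] u abelianD by blast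
              then show ?thesis using cj_fix_iff[of x u] xc U(1) u by auto
            qed
            show ?thesis
            proof (cases "\<exists>r k. prime r \<and> card M = r ^ k")
              case True
              then show ?thesis using solv_prime_power M(1) by blast
            next
              case nr: False
              \<comment> \<open>When \<open>M\<close> is not of prime power order, its
                \<open>x\<close>-invariant Sylow subgroups are all proper and hence centralized by
                \<open>x\<close>; the centralizer of \<open>x\<close> in \<open>M\<close> then has
                full order.\<close>
              have cent: "cj x m = m" if m: "m \<in> M" for m
              proof -
                let ?Z = "{y \<in> M. cj y x = x}"
                have Z: "subgroup ?Z G" using subgroup_centralizer[OF M(1) xc] .
                have ZM: "?Z \<subseteq> M" by auto
                have "card M dvd card ?Z"
                proof (rule multiplicity_le_imp_dvd)
                  show "card M \<noteq> 0" using sg_card_pos[OF M(1)] by simp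
                  fix r :: nat assume r: "prime r"
                  obtain R where R: "subgroup R G" "R \<subseteq> M" "card R = r ^ multiplicity r (card M)" "\<And>y. y \<in> R \<Longrightarrow> cj x y \<in> R"
                    using invariant_sylow[OF M(1) xc _ Mx _ r] x p pM by metis
                  have "R \<noteq> M" using nr R(3) r by metis
                  then have "R \<subseteq> ?Z" using fixU[OF R(1) _ R(4)] R cj_fix_sym[OF xc] by blast
                  then have "r ^ multiplicity r (card M) dvd card ?Z" using sg_card_dvd[OF R(1) Z] R(3) by simp
                  then show "multiplicity r (card M) \<le> multiplicity r (card ?Z)"
                    using r sg_card_pos[OF Z] by (intro multiplicity_geI) auto
                qed
                then have "?Z = M" using sg_card_eq[OF M(1) ZM] sg_card_pos[OF Z] by (simp add: dvd_imp_le)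
                then have "cj m x = x" using m by blast
                then show ?thesis using cj_fix_sym[OF xc] m M by blast
              qed
              \<comment> \<open>Since \<open>x\<close> centralizes \<open>M\<close>, every proper
                subgroup of \<open>M\<close> is \<open>x\<close>-invariant and so abelian;
                \<open>solv_minimal_nonabelian\<close> finishes.\<close>
              have "\<not> nonabelian G U" if U: "subgroup U G" "U \<subset> M" for U
              proof -
                have "\<And>u. u \<in> U \<Longrightarrow> cj x u \<in> U" using cent U by auto
                then have "\<not> nonabelian G (U <#> powers x)" "U \<subseteq> U <#> powers x" using ab add[OF U] by auto
                then show ?thesis using nonabelian_mono by blast
              qed
              then show ?thesis using solv_minimal_nonabelian[OF M(1)] by blast
            qed
          qed
        qed
        then show ?thesis using solv_extension[OF M(1) _ cM] by blast
      qed
    qed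
  qed
qed

end

section \<open>Irreducible commutative actions\<close>

lemma (in fin_group) subgroup_of_cyclic:
  assumes g: "g \<in> carrier G" "carrier G = powers g" and S: "subgroup S G"
  obtains s where "s \<in> S" "S = powers s"
proof -
  define d where "d = (LEAST d. d > 0 \<and> g [^] (d::nat) \<in> S)"
  have "ord g > 0 \<and> g [^] ord g \<in> S"
    using g(1) S ord_ge_1[OF finite_carrier g(1)] sg_one[OF S] pow_ord_eq_1[OF g(1)] by simp
  then have d: "d > 0 \<and> g [^] d \<in> S" unfolding d_def by (rule LeastI)
  have "y \<in> powers (g [^] d)" if y: "y \<in> S" for y
  proof -
    obtain i where i: "y = g [^] (i::nat)" using y S g by (metis powersE sgD)
    have "g [^] i = (g [^] d) [^] (i div d) \<otimes> g [^] (i mod d)"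
      using g by (simp add: nat_pow_pow nat_pow_mult)
    then have "g [^] (i mod d) \<in> S"
      using y i S d g sg_mult_iff1[OF S sg_pow[OF S], of "g [^] d" "g [^] (i mod d)" "i div d"] by simp
    then have "i mod d = 0" using not_less_Least[of "i mod d" "\<lambda>d. d > 0 \<and> g [^] d \<in> S"] d
      by (metis d_def gr0I mod_less_divisor)
    then have "y = (g [^] d) [^] (i div d)" using i g by (metis dvd_mult_div_cancel mod_0_imp_dvd nat_pow_pow)
    then show ?thesis by (simp add: powers_def)
  qed
  then have "S = powers (g [^] d)" using powers_subset[OF S] d by blast
  then show ?thesis using that d by blast
qed

text \<open>Only the action of \<open>A\<close> on \<open>V\<close> has to be commutative, not
  \<open>A\<close> itself: besides \<open>powers x\<close> acting on the kernel, the locale is used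
  for the non-abelian complement acting on \<open>powers x\<close>.\<close>

locale irr_action = fin_group +
  fixes A V :: "'a set"
  assumes A: "subgroup A G" and V: "subgroup V G"
    and V_comm: "\<And>m n. m \<in> V \<Longrightarrow> n \<in> V \<Longrightarrow> m \<otimes> n = n \<otimes> m"
    and V_nontriv: "V \<noteq> {\<one>}"
    and AV: "\<And>a n. a \<in> A \<Longrightarrow> n \<in> V \<Longrightarrow> cj a n \<in> V"
    and A_comm: "\<And>a b n. a \<in> A \<Longrightarrow> b \<in> A \<Longrightarrow> n \<in> V \<Longrightarrow> cj a (cj b n) = cj b (cj a n)"
    and irr: "\<And>D. subgroup D G \<Longrightarrow> D \<subseteq> V \<Longrightarrow> (\<And>a d. a \<in> A \<Longrightarrow> d \<in> D \<Longrightarrow> cj a d \<in> D) \<Longrightarrow> D = {\<one>} \<or> D = V"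
begin

lemma Vc: "n \<in> V \<Longrightarrow> n \<in> carrier G" and Ac: "a \<in> A \<Longrightarrow> a \<in> carrier G"
  using A V by auto

lemma V1: "\<one> \<in> V"
  using V sg_one by blast

lemma Vm: "m \<in> V \<Longrightarrow> n \<in> V \<Longrightarrow> m \<otimes> n \<in> V"
  using V sg_mult by blast

lemma Vi: "m \<in> V \<Longrightarrow> inv m \<in> V"
  using V sg_inv by blast

text \<open>Maps are extensional so that equality of ring elements is equality on \<open>V\<close>,
  which also makes the ring finite.\<close>

definition Ends :: "('a \<Rightarrow> 'a) set" where
  "Ends = {e \<in> extensional V. (\<forall>n\<in>V. e n \<in> V) \<and> (\<forall>m\<in>V. \<forall>n\<in>V. e (m \<otimes> n) = e m \<otimes> e n)}"

definition Commutant :: "('a \<Rightarrow> 'a) set" where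
  "Commutant = {e \<in> Ends. \<forall>a\<in>A. \<forall>n\<in>V. e (cj a n) = cj a (e n)}"

text \<open>The double commutant of \<open>A\<close>: commutative because \<open>A\<close> acts commutatively, and a field by
  Schur's lemma.\<close>

definition Bicomm :: "('a \<Rightarrow> 'a) set" where
  "Bicomm = {e \<in> Ends. \<forall>f\<in>Commutant. \<forall>n\<in>V. e (f n) = f (e n)}"

definition R :: "('a \<Rightarrow> 'a) ring" where
  "R = \<lparr>carrier = Bicomm, monoid.mult = (\<lambda>e f. \<lambda>n\<in>V. e (f n)), one = (\<lambda>n\<in>V. n),
        ring.zero = (\<lambda>n\<in>V. \<one>), ring.add = (\<lambda>e f. \<lambda>n\<in>V. e n \<otimes> f n)\<rparr>"

lemma R_simps: "carrier R = Bicomm" "e \<otimes>\<^bsub>R\<^esub> f = (\<lambda>n\<in>V. e (f n))" "\<one>\<^bsub>R\<^esub> = (\<lambda>n\<in>V. n)"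
  "\<zero>\<^bsub>R\<^esub> = (\<lambda>n\<in>V. \<one>)" "e \<oplus>\<^bsub>R\<^esub> f = (\<lambda>n\<in>V. e n \<otimes> f n)"
  by (simp_all add: R_def)

lemma EndsD: "e \<in> Ends \<Longrightarrow> n \<in> V \<Longrightarrow> e n \<in> V"
  "e \<in> Ends \<Longrightarrow> m \<in> V \<Longrightarrow> n \<in> V \<Longrightarrow> e (m \<otimes> n) = e m \<otimes> e n"
  "e \<in> Ends \<Longrightarrow> e \<in> extensional V"
  by (auto simp: Ends_def)

lemma Ends_one: "e \<in> Ends \<Longrightarrow> e \<one> = \<one>"
  using EndsD(2)[of e \<one> \<one>] EndsD(1)[of e \<one>] V1 Vc by simp

lemma Ends_inv: "e \<in> Ends \<Longrightarrow> n \<in> V \<Longrightarrow> e (inv n) = inv (e n)"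
  using EndsD(2)[of e "inv n" n] Vi Vc EndsD(1) Ends_one by (metis inv_equality l_inv)

lemma Bicomm_Ends: "e \<in> Bicomm \<Longrightarrow> e \<in> Ends"
  by (simp add: Bicomm_def)

lemma cj_Commutant: "a \<in> A \<Longrightarrow> (\<lambda>n\<in>V. cj a n) \<in> Commutant"
  by (auto simp: Commutant_def Ends_def AV Vm Vc Ac cj_mult A_comm)

lemma Bicomm_Commutant: "e \<in> Bicomm \<Longrightarrow> e \<in> Commutant"
proof -
  assume e: "e \<in> Bicomm"
  have "e (cj a n) = cj a (e n)" if "a \<in> A" "n \<in> V" for a n
    using e cj_Commutant[OF that(1)] that EndsD(1)[OF Bicomm_Ends[OF e]] unfolding Bicomm_def by force
  then show ?thesis using Bicomm_Ends[OF e] by (simp add: Commutant_def)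
qed

lemma Bicomm_comm: "e \<in> Bicomm \<Longrightarrow> f \<in> Commutant \<Longrightarrow> n \<in> V \<Longrightarrow> e (f n) = f (e n)"
  by (simp add: Bicomm_def)

lemma cj_Bicomm: "a \<in> A \<Longrightarrow> (\<lambda>n\<in>V. cj a n) \<in> Bicomm"
proof -
  assume a: "a \<in> A"
  have "(\<lambda>n\<in>V. cj a n) (f n) = f ((\<lambda>n\<in>V. cj a n) n)" if "f \<in> Commutant" "n \<in> V" for f n
    using that a by (auto simp: Commutant_def EndsD)
  then show ?thesis using cj_Commutant[OF a] by (simp add: Bicomm_def Commutant_def)
qed

lemma Bicomm_mult: "e \<in> Bicomm \<Longrightarrow> f \<in> Bicomm \<Longrightarrow> (\<lambda>n\<in>V. e (f n)) \<in> Bicomm"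
  unfolding Bicomm_def by (auto simp: Commutant_def Ends_def Vm)

lemma Bicomm_add: "e \<in> Bicomm \<Longrightarrow> f \<in> Bicomm \<Longrightarrow> (\<lambda>n\<in>V. e n \<otimes> f n) \<in> Bicomm"
proof -
  assume ef: "e \<in> Bicomm" "f \<in> Bicomm"
  have E: "e \<in> Ends" "f \<in> Ends" using ef Bicomm_Ends by auto
  have "e (m \<otimes> n) \<otimes> f (m \<otimes> n) = e m \<otimes> f m \<otimes> (e n \<otimes> f n)" if "m \<in> V" "n \<in> V" for m n
  proof -
    have c: "e m \<in> V" "e n \<in> V" "f m \<in> V" "f n \<in> V" using E that EndsD by auto
    have "e n \<otimes> (f m \<otimes> f n) = f m \<otimes> (e n \<otimes> f n)" using c Vc V_comm[of "e n" "f m"] by (metis m_assoc)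
    then show ?thesis using E that c Vc by (simp add: EndsD m_assoc)
  qed
  moreover have "(\<lambda>n\<in>V. e n \<otimes> f n) (g n) = g ((\<lambda>n\<in>V. e n \<otimes> f n) n)" if "g \<in> Commutant" "n \<in> V" for g n
  proof -
    have "g \<in> Ends" using that by (simp add: Commutant_def)
    then show ?thesis using that E Bicomm_comm[OF ef(1) that] Bicomm_comm[OF ef(2) that] by (simp add: EndsD Vm)
  qed
  ultimately show ?thesis using E unfolding Bicomm_def Ends_def by (auto simp: Vm)
qed

lemma Bicomm_zero: "(\<lambda>n\<in>V. \<one>) \<in> Bicomm"
proof -
  have "(\<lambda>n\<in>V. \<one>) (f n) = f ((\<lambda>n\<in>V. \<one>) n)" if "f \<in> Commutant" "n \<in> V" for f n
  proof -
    have f: "f \<in> Ends" using that by (simp add: Commutant_def)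
    show ?thesis using that(2) EndsD(1)[OF f that(2)] Ends_one[OF f] by simp
  qed
  moreover have "(\<lambda>n\<in>V. \<one>) \<in> Ends" using V1 by (auto simp: Ends_def Vm)
  ultimately show ?thesis unfolding Bicomm_def by blast
qed

lemma Bicomm_one: "(\<lambda>n\<in>V. n) \<in> Bicomm"
  unfolding Bicomm_def using Vm by (auto simp: Ends_def Commutant_def)

lemma Bicomm_minus: "e \<in> Bicomm \<Longrightarrow> (\<lambda>n\<in>V. inv (e n)) \<in> Bicomm"
proof -
  assume e: "e \<in> Bicomm"
  have E: "e \<in> Ends" using e Bicomm_Ends by auto
  have "inv (e (m \<otimes> n)) = inv (e m) \<otimes> inv (e n)" if "m \<in> V" "n \<in> V" for m n
  proof -
    have c: "e m \<in> V" "e n \<in> V" using E that EndsD by auto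
    then show ?thesis using E that Vc V_comm[of "inv (e m)" "inv (e n)"] Vi by (simp add: EndsD inv_mult_group)
  qed
  moreover have "(\<lambda>n\<in>V. inv (e n)) (g n) = g ((\<lambda>n\<in>V. inv (e n)) n)" if "g \<in> Commutant" "n \<in> V" for g n
  proof -
    have "g \<in> Ends" using that by (simp add: Commutant_def)
    then show ?thesis using that E Bicomm_comm[OF e that] by (simp add: EndsD Ends_inv)
  qed
  ultimately show ?thesis using E unfolding Bicomm_def Ends_def by (auto simp: Vm Vi)
qed

lemma R_cring: "cring R"
proof (rule cringI)
  have BV: "e n \<in> V" "e n \<in> carrier G" if "e \<in> Bicomm" "n \<in> V" for e n
    using that Bicomm_Ends EndsD Vc by auto
  have ext: "e = f" if "e \<in> Bicomm" "f \<in> Bicomm" "\<And>n. n \<in> V \<Longrightarrow> e n = f n" for e f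
    using that Bicomm_Ends EndsD(3) by (metis extensionalityI)
  show "abelian_group R"
  proof (rule abelian_groupI)
    fix x y z assume x: "x \<in> carrier R" and y: "y \<in> carrier R" and z: "z \<in> carrier R"
    show "x \<oplus>\<^bsub>R\<^esub> y \<in> carrier R" using x y Bicomm_add by (simp add: R_simps)
    show "x \<oplus>\<^bsub>R\<^esub> y \<oplus>\<^bsub>R\<^esub> z = x \<oplus>\<^bsub>R\<^esub> (y \<oplus>\<^bsub>R\<^esub> z)"
      using x y z BV by (auto simp: R_simps m_assoc fun_eq_iff)
    show "x \<oplus>\<^bsub>R\<^esub> y = y \<oplus>\<^bsub>R\<^esub> x"
      using x y BV V_comm by (auto simp: R_simps fun_eq_iff)
  next
    fix x assume x: "x \<in> carrier R"
    show "\<zero>\<^bsub>R\<^esub> \<oplus>\<^bsub>R\<^esub> x = x"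
    proof (rule ext)
      show "\<zero>\<^bsub>R\<^esub> \<oplus>\<^bsub>R\<^esub> x \<in> Bicomm" "x \<in> Bicomm"
        using x Bicomm_add[OF Bicomm_zero, of x] by (simp_all add: R_simps)
    qed (use x BV in \<open>simp add: R_simps\<close>)
    show "\<exists>y\<in>carrier R. y \<oplus>\<^bsub>R\<^esub> x = \<zero>\<^bsub>R\<^esub>"
      using x BV Bicomm_minus by (intro bexI[of _ "\<lambda>n\<in>V. inv (x n)"]) (auto simp: R_simps fun_eq_iff)
  qed (simp add: R_simps Bicomm_zero)
  show "comm_monoid R"
  proof (rule comm_monoidI)
    fix x y z assume x: "x \<in> carrier R" and y: "y \<in> carrier R" and z: "z \<in> carrier R"
    show "x \<otimes>\<^bsub>R\<^esub> y \<in> carrier R" using x y Bicomm_mult by (simp add: R_simps)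
    show "x \<otimes>\<^bsub>R\<^esub> y \<otimes>\<^bsub>R\<^esub> z = x \<otimes>\<^bsub>R\<^esub> (y \<otimes>\<^bsub>R\<^esub> z)"
      using x y z BV by (auto simp: R_simps fun_eq_iff)
    show "x \<otimes>\<^bsub>R\<^esub> y = y \<otimes>\<^bsub>R\<^esub> x"
      using x y Bicomm_comm[OF _ Bicomm_Commutant] by (auto simp: R_simps fun_eq_iff)
  next
    fix x assume x: "x \<in> carrier R"
    show "\<one>\<^bsub>R\<^esub> \<otimes>\<^bsub>R\<^esub> x = x"
    proof (rule ext)
      show "\<one>\<^bsub>R\<^esub> \<otimes>\<^bsub>R\<^esub> x \<in> Bicomm" "x \<in> Bicomm"
        using x Bicomm_mult[OF Bicomm_one, of x] by (simp_all add: R_simps)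
    qed (use x BV in \<open>simp add: R_simps\<close>)
  qed (simp add: R_simps Bicomm_one)
  fix x y z assume x: "x \<in> carrier R" and y: "y \<in> carrier R" and z: "z \<in> carrier R"
  show "(x \<oplus>\<^bsub>R\<^esub> y) \<otimes>\<^bsub>R\<^esub> z = x \<otimes>\<^bsub>R\<^esub> z \<oplus>\<^bsub>R\<^esub> y \<otimes>\<^bsub>R\<^esub> z"
    using x y z BV by (auto simp: R_simps fun_eq_iff)
qed

lemma R_finite: "finite (carrier R)"
proof -
  have "carrier R \<subseteq> PiE V (\<lambda>_. V)"
    using Bicomm_Ends EndsD by (auto simp: R_simps PiE_def)
  moreover have "finite (PiE V (\<lambda>_. V))" using V sg_finite by (simp add: finite_PiE)
  ultimately show ?thesis by (rule finite_subset)
qed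

text \<open>Schur's lemma: the kernel of \<open>e\<close> is \<open>A\<close>-invariant, because the
  double commutant lies in the commutant.\<close>

lemma Bicomm_injective:
  assumes e: "e \<in> Bicomm" "e \<noteq> (\<lambda>n\<in>V. \<one>)" and n: "n \<in> V" "e n = \<one>"
  shows "n = \<one>"
proof -
  have E: "e \<in> Ends" using e Bicomm_Ends by auto
  define D where "D = {n \<in> V. e n = \<one>}"
  have "subgroup D G"
  proof (rule finite_subgroupI)
    show "x \<otimes> y \<in> D" if "x \<in> D" "y \<in> D" for x y using that E Vm by (auto simp: D_def EndsD)
  qed (use Vc V1 E Ends_one in \<open>auto simp: D_def\<close>)
  moreover have "cj a d \<in> D" if "a \<in> A" "d \<in> D" for a d
    using that Bicomm_Commutant[OF e(1)] AV Ac by (auto simp: D_def Commutant_def)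
  moreover have "D \<subseteq> V" by (auto simp: D_def)
  ultimately have "D = {\<one>} \<or> D = V" using irr by blast
  moreover have "D \<noteq> V"
  proof
    assume DV: "D = V"
    have "e = (\<lambda>n\<in>V. \<one>)"
    proof (rule extensionalityI[OF EndsD(3)[OF E]])
      fix n assume "n \<in> V"
      then have "n \<in> D" using DV by simp
      then show "e n = (\<lambda>n\<in>V. \<one>) n" by (simp add: D_def)
    qed auto
    then show False using e by simp
  qed
  ultimately show ?thesis using n by (auto simp: D_def)
qed

text \<open>Multiplication by a non-zero element is injective by Schur's lemma, hence onto in the
  finite ring, so it reaches the identity.\<close>

lemma R_field: "field R"
proof -
  interpret R: cring R by (rule R_cring)
  have ne: "\<one>\<^bsub>R\<^esub> \<noteq> \<zero>\<^bsub>R\<^esub>"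
  proof
    assume "\<one>\<^bsub>R\<^esub> = \<zero>\<^bsub>R\<^esub>"
    then have e: "(\<lambda>n\<in>V. n) = (\<lambda>n\<in>V. \<one>)" by (simp add: R_simps)
    have "n = \<one>" if "n \<in> V" for n using that fun_cong[OF e, of n] by simp
    then show False using V_nontriv V1 by blast
  qed
  have "\<exists>b\<in>carrier R. a \<otimes>\<^bsub>R\<^esub> b = \<one>\<^bsub>R\<^esub>" if a: "a \<in> carrier R" "a \<noteq> \<zero>\<^bsub>R\<^esub>" for a
  proof -
    have aB: "a \<in> Bicomm" "a \<noteq> (\<lambda>n\<in>V. \<one>)" using a by (auto simp: R_simps)
    have "inj_on (\<lambda>b. a \<otimes>\<^bsub>R\<^esub> b) (carrier R)"
    proof (rule inj_onI)
      fix b c assume bc: "b \<in> carrier R" "c \<in> carrier R" "a \<otimes>\<^bsub>R\<^esub> b = a \<otimes>\<^bsub>R\<^esub> c"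
      then have B: "b \<in> Ends" "c \<in> Ends" using Bicomm_Ends by (auto simp: R_simps)
      show "b = c"
      proof (rule extensionalityI[OF EndsD(3)[OF B(1)] EndsD(3)[OF B(2)]])
        fix n assume n: "n \<in> V"
        have V2: "b n \<in> V" "c n \<in> V" using B n EndsD by auto
        have "a (b n) = a (c n)" using fun_cong[OF bc(3), of n] n by (simp add: R_simps)
        then have "a (b n \<otimes> inv (c n)) = \<one>"
          using V2 Vi Vc Bicomm_Ends[OF aB(1)] by (simp add: EndsD Ends_inv)
        then have "b n \<otimes> inv (c n) = \<one>" using Bicomm_injective[OF aB] V2 Vm Vi by simp
        then show "b n = c n" using V2 Vc by (metis inv_closed inv_equality inv_inv)
      qed
    qed
    moreover have "(\<lambda>b. a \<otimes>\<^bsub>R\<^esub> b) ` carrier R \<subseteq> carrier R"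
      using R.m_closed[OF a(1)] by (rule image_subsetI)
    ultimately have "(\<lambda>b. a \<otimes>\<^bsub>R\<^esub> b) ` carrier R = carrier R" using endo_inj_surj[OF R_finite] by metis
    then have "\<one>\<^bsub>R\<^esub> \<in> (\<lambda>b. a \<otimes>\<^bsub>R\<^esub> b) ` carrier R" using R.one_closed by simp
    then show ?thesis by force
  qed
  then show ?thesis using ne by (intro R.cring_fieldI2) auto
qed

text \<open>\<open>A\<close> maps into the multiplicative group of a finite field, which is cyclic,
  and so is every subgroup of it. As the action need not be faithful, the conclusion concerns the
  action and not \<open>A\<close>.\<close>

lemma action_cyclic:
  obtains a where "a \<in> A" "\<And>b. b \<in> A \<Longrightarrow> \<exists>i::nat. \<forall>n\<in>V. cj b n = cj (a [^] i) n"
proof -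
  interpret R: field R by (rule R_field)
  let ?M = "Multiplicative_Group.mult_of R"
  have M: "fin_group ?M"
    using R.field_mult_group R_finite by (simp add: fin_group_def fin_group_axioms_def)
  interpret M: fin_group ?M by (rule M)
  obtain g where g: "g \<in> carrier ?M" "carrier ?M = {g [^]\<^bsub>R\<^esub> i | i::nat. i \<in> UNIV}"
    using R.finite_field_mult_group_has_gen[OF R_finite] by blast
  have g2: "carrier ?M = M.powers g" unfolding g(2) M.powers_def Multiplicative_Group.nat_pow_mult_of by blast
  define c where "c a = (\<lambda>n\<in>V. cj a n)" for a
  have cB: "c a \<in> carrier ?M" if "a \<in> A" for a
  proof -
    obtain n where n: "n \<in> V" "n \<noteq> \<one>" using V_nontriv V1 by blast
    have "c a n \<noteq> (\<lambda>n\<in>V. \<one>) n" using n cj_eq_one_iff[OF Ac[OF that] Vc[OF n(1)]] by (simp add: c_def)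
    then have "c a \<noteq> (\<lambda>n\<in>V. \<one>)" by metis
    then show ?thesis using cj_Bicomm[OF that] by (simp add: R_simps c_def)
  qed
  have cm: "c (a \<otimes> b) = c a \<otimes>\<^bsub>?M\<^esub> c b" if "a \<in> A" "b \<in> A" for a b
    using that AV Vc Ac by (auto simp: R_simps c_def cj_cj fun_eq_iff)
  have c1: "c \<one> = \<one>\<^bsub>?M\<^esub>" using Vc by (auto simp: R_simps c_def fun_eq_iff)
  have S: "subgroup (c ` A) ?M"
  proof (rule M.finite_subgroupI)
    show "\<one>\<^bsub>?M\<^esub> \<in> c ` A" using c1 A sg_one by (metis image_eqI)
    show "x \<otimes>\<^bsub>?M\<^esub> y \<in> c ` A" if "x \<in> c ` A" "y \<in> c ` A" for x y
    proof -
      obtain a b where ab: "a \<in> A" "b \<in> A" "x = c a" "y = c b" using \<open>x \<in> c ` A\<close> \<open>y \<in> c ` A\<close> by blast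
      then have "x \<otimes>\<^bsub>?M\<^esub> y = c (a \<otimes> b)" using cm by simp
      then show ?thesis using ab A sg_mult by blast
    qed
  qed (use cB in auto)
  obtain s where s: "s \<in> c ` A" "c ` A = M.powers s" using M.subgroup_of_cyclic[OF g(1) g2 S] by metis
  then obtain a where a: "a \<in> A" "s = c a" by blast
  have cpow: "c (a [^] i) = c a [^]\<^bsub>?M\<^esub> (i::nat)" for i
  proof (induction i)
    case (Suc i)
    then show ?case using cm[of "a [^] i" a] a A sg_pow by simp
  qed (simp add: c1)
  have "\<exists>i::nat. \<forall>n\<in>V. cj b n = cj (a [^] i) n" if b: "b \<in> A" for b
  proof -
    have "c b \<in> M.powers s" using b s by blast
    then obtain i :: nat where i: "c b = c (a [^] i)" using cpow a by (metis M.powersE)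
    have "cj b n = cj (a [^] i) n" if "n \<in> V" for n using fun_cong[OF i, of n] that by (simp add: c_def)
    then show ?thesis by blast
  qed
  then show ?thesis using that a by blast
qed

text \<open>\<open>V\<close> is one-dimensional over the field \<open>R\<close>: the images of a
  non-trivial \<open>v\<close> under \<open>R\<close> form an \<open>A\<close>-invariant subgroup
  containing \<open>v\<close>. So \<open>c\<close> and \<open>d\<close> act on \<open>v\<close> like
  scalars \<open>e\<close> and \<open>f\<close>, and scalars commute.\<close>

lemma commutant_commutative:
  assumes c: "c \<in> carrier G" "d \<in> carrier G"
    and cV: "\<And>n. n \<in> V \<Longrightarrow> cj c n \<in> V" and dV: "\<And>n. n \<in> V \<Longrightarrow> cj d n \<in> V"
    and cA: "\<And>a n. a \<in> A \<Longrightarrow> n \<in> V \<Longrightarrow> cj c (cj a n) = cj a (cj c n)"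
    and dA: "\<And>a n. a \<in> A \<Longrightarrow> n \<in> V \<Longrightarrow> cj d (cj a n) = cj a (cj d n)"
    and v: "v \<in> V"
  shows "cj c (cj d v) = cj d (cj c v)"
proof (cases "v = \<one>")
  case False
  have C: "(\<lambda>n\<in>V. cj c n) \<in> Commutant" "(\<lambda>n\<in>V. cj d n) \<in> Commutant"
    using c cV dV cA dA AV Vm Vc by (auto simp: Commutant_def Ends_def cj_mult)
  define D where "D = (\<lambda>e. e v) ` Bicomm"
  have DV: "D \<subseteq> V" using v Bicomm_Ends EndsD by (auto simp: D_def)
  have "subgroup D G"
  proof (rule finite_subgroupI)
    show "D \<subseteq> carrier G" using DV Vc by auto
    show "\<one> \<in> D" unfolding D_def using v by (intro image_eqI[OF _ Bicomm_zero]) simp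
    fix x y assume "x \<in> D" "y \<in> D"
    then obtain e f where ef: "e \<in> Bicomm" "f \<in> Bicomm" "x = e v" "y = f v" by (auto simp: D_def)
    then have "x \<otimes> y = (\<lambda>n\<in>V. e n \<otimes> f n) v" using v by simp
    then show "x \<otimes> y \<in> D" using Bicomm_add[OF ef(1,2)] unfolding D_def by blast
  qed
  moreover have "cj a x \<in> D" if a: "a \<in> A" and x: "x \<in> D" for a x
  proof -
    obtain e where e: "e \<in> Bicomm" "x = e v" using x by (auto simp: D_def)
    have "e v \<in> V" using e v Bicomm_Ends EndsD by auto
    then have "cj a x = (\<lambda>n\<in>V. (\<lambda>n\<in>V. cj a n) (e n)) v" using e v by simp
    then show ?thesis using Bicomm_mult[OF cj_Bicomm[OF a] e(1)] unfolding D_def by blast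
  qed
  moreover have "v \<in> D" unfolding D_def using v by (intro image_eqI[OF _ Bicomm_one]) simp
  ultimately have "D = V" using irr[OF _ DV] False by blast
  then obtain e f where ef: "e \<in> Bicomm" "f \<in> Bicomm" "cj c v = e v" "cj d v = f v"
    using cV[OF v] dV[OF v] unfolding D_def by blast
  have efV: "e v \<in> V" "f v \<in> V" using ef v Bicomm_Ends EndsD by auto
  have "cj c (f v) = f (cj c v)" "cj d (e v) = e (cj d v)"
    using Bicomm_comm[OF ef(2) C(1) v] Bicomm_comm[OF ef(1) C(2) v] v efV by auto
  moreover have "e (f v) = f (e v)" using Bicomm_comm[OF ef(1) Bicomm_Commutant[OF ef(2)] v] .
  ultimately show ?thesis using ef by simp
qed (use c in simp)

end

section \<open>Dedekind groups with a fixed-point-free action\<close>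

context fin_group
begin

text \<open>On a minimal non-trivial \<open>A\<close>-invariant subgroup \<open>V\<close> of
  \<open>W\<close> the action is irreducible, hence cyclic; freeness from fixed points makes it
  faithful, which carries cyclicity back to \<open>A\<close>.\<close>

lemma abelian_fpf_cyclic:
  assumes A: "subgroup A G" and A_ab: "\<And>a b. a \<in> A \<Longrightarrow> b \<in> A \<Longrightarrow> a \<otimes> b = b \<otimes> a"
    and W: "subgroup W G" "W \<noteq> {\<one>}" and W_ab: "\<And>m n. m \<in> W \<Longrightarrow> n \<in> W \<Longrightarrow> m \<otimes> n = n \<otimes> m"
    and AW: "\<And>a n. a \<in> A \<Longrightarrow> n \<in> W \<Longrightarrow> cj a n \<in> W"
    and fpf: "\<And>a n. a \<in> A \<Longrightarrow> n \<in> W \<Longrightarrow> n \<noteq> \<one> \<Longrightarrow> cj a n = n \<Longrightarrow> a = \<one>"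
  obtains a where "a \<in> A" "A = powers a"
proof -
  let ?S = "{D. subgroup D G \<and> D \<subseteq> W \<and> D \<noteq> {\<one>} \<and> (\<forall>a\<in>A. \<forall>d\<in>D. cj a d \<in> D)}"
  have "?S \<subseteq> Pow (carrier G)" using sg_carrier by auto
  then have "finite ?S" using finite_carrier finite_subset by blast
  moreover have "W \<in> ?S" using W AW by auto
  ultimately obtain V where V: "V \<in> ?S" "\<forall>b\<in>?S. b \<subseteq> V \<longrightarrow> V = b"
    using finite_has_minimal2[of ?S W] by auto
  have Ac: "a \<in> carrier G" if "a \<in> A" for a using that A by auto
  have Wc: "a \<in> carrier G" if "a \<in> W" for a using that W by auto
  have VW: "V \<subseteq> W" using V by blast
  interpret I: irr_action G A V
  proof (rule irr_action.intro[OF fin_group_axioms], rule irr_action_axioms.intro)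
    show "cj a (cj b n) = cj b (cj a n)" if "a \<in> A" "b \<in> A" "n \<in> V" for a b n
      using that A_ab[of a b] Ac Wc VW by (auto simp: cj_cj)
    show "D = {\<one>} \<or> D = V" if "subgroup D G" "D \<subseteq> V" "\<And>a d. a \<in> A \<Longrightarrow> d \<in> D \<Longrightarrow> cj a d \<in> D" for D
    proof (rule disjCI)
      assume "D \<noteq> V"
      then have "D \<notin> ?S" using V(2) that(2) by blast
      then show "D = {\<one>}" using that VW by blast
    qed
    show "m \<otimes> n = n \<otimes> m" if "m \<in> V" "n \<in> V" for m n using that VW W_ab by blast
    show "subgroup V G" "V \<noteq> {\<one>}" "\<And>a n. a \<in> A \<Longrightarrow> n \<in> V \<Longrightarrow> cj a n \<in> V" using V(1) by blast+
  qed (rule A)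
  obtain a where a: "a \<in> A" "\<And>b. b \<in> A \<Longrightarrow> \<exists>i::nat. \<forall>n\<in>V. cj b n = cj (a [^] i) n"
    using I.action_cyclic by metis
  obtain n where n: "n \<in> V" "n \<noteq> \<one>" using V(1) I.V1 by blast
  have nW: "n \<in> W" using n VW by auto
  have "b \<in> powers a" if b: "b \<in> A" for b
  proof -
    obtain i :: nat where i: "cj b n = cj (a [^] i) n" using a(2)[OF b] n by blast
    have c: "b \<in> carrier G" "a [^] i \<in> carrier G" "n \<in> carrier G" using b a Ac Wc nW by auto
    have "cj (inv (a [^] i) \<otimes> b) n = n" using i c by (simp flip: cj_cj)
    then have "inv (a [^] i) \<otimes> b = \<one>"
      using fpf[of "inv (a [^] i) \<otimes> b" n] A a b n nW by (simp add: sg_mult sg_inv sg_pow)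
    then have "b = a [^] i" using c by (metis inv_equality inv_inv inv_closed)
    then show ?thesis by simp
  qed
  then have "A = powers a" using powers_subset[OF A a(1)] by blast
  then show ?thesis using that a by blast
qed

text \<open>Collection in nilpotency class 2: the exponent of \<open>y\<close> counts the swaps
  needed to move every \<open>b\<close> to the left of every \<open>c\<close>.\<close>

lemma pow_mult_class2:
  assumes c: "b \<in> carrier G" "c \<in> carrier G" "y \<in> carrier G"
    and cb: "c \<otimes> b = b \<otimes> c \<otimes> y" and yb: "y \<otimes> b = b \<otimes> y" and yc: "y \<otimes> c = c \<otimes> y"
  shows "(b \<otimes> c) [^] (n::nat) = b [^] n \<otimes> c [^] n \<otimes> y [^] (n * (n - 1) div 2)"
proof (induction n)
  case (Suc n)
  have ynb: "y [^] (i::nat) \<otimes> b = b \<otimes> y [^] i" and ync: "y [^] (i::nat) \<otimes> c = c \<otimes> y [^] i" for i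
    using c yb yc by (simp_all add: group_commutes_pow)
  have cn: "c [^] (i::nat) \<otimes> b = b \<otimes> c [^] i \<otimes> y [^] i" for i
  proof (induction i)
    case (Suc i)
    have "c [^] Suc i \<otimes> b = c [^] i \<otimes> (b \<otimes> c \<otimes> y)" using c cb by (simp add: m_assoc)
    also have "\<dots> = (c [^] i \<otimes> b) \<otimes> (c \<otimes> y)" using c by (simp add: m_assoc)
    also have "\<dots> = b \<otimes> c [^] i \<otimes> y [^] i \<otimes> (c \<otimes> y)" using Suc by simp
    also have "\<dots> = b \<otimes> c [^] i \<otimes> (y [^] i \<otimes> c) \<otimes> y" using c by (simp add: m_assoc)
    also have "\<dots> = b \<otimes> c [^] Suc i \<otimes> y [^] Suc i" using c ync by (simp add: m_assoc)
    finally show ?case .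
  qed (use c in simp)
  define k where "k = n * (n - 1) div 2"
  have k: "Suc n * (Suc n - 1) div 2 = k + n"
  proof (cases n)
    case (Suc m)
    have "Suc n * (Suc n - 1) = n * (n - 1) + n * 2" using Suc by simp
    then show ?thesis unfolding k_def by simp
  qed (simp add: k_def)
  have "(b \<otimes> c) [^] Suc n = b [^] n \<otimes> c [^] n \<otimes> y [^] k \<otimes> (b \<otimes> c)" using Suc by (simp add: k_def)
  also have "\<dots> = b [^] n \<otimes> c [^] n \<otimes> (y [^] k \<otimes> b) \<otimes> c" using c by (simp add: m_assoc)
  also have "\<dots> = b [^] n \<otimes> (c [^] n \<otimes> b) \<otimes> (y [^] k \<otimes> c)" using c ynb by (simp add: m_assoc)
  also have "\<dots> = b [^] n \<otimes> b \<otimes> c [^] n \<otimes> (y [^] n \<otimes> c) \<otimes> y [^] k"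
    using c by (simp add: m_assoc ync[of k] cn[of n])
  also have "\<dots> = b [^] Suc n \<otimes> c [^] Suc n \<otimes> (y [^] n \<otimes> y [^] k)" using c by (simp add: m_assoc ync[of n])
  also have "y [^] n \<otimes> y [^] k = y [^] (k + n)" using c by (simp add: nat_pow_mult add.commute)
  finally show ?case using k by simp
qed (use c in simp)

lemma prime_power_of_unique_prime:
  fixes n s :: nat
  assumes "n > 0" "prime s" "\<And>r. prime r \<Longrightarrow> r dvd n \<Longrightarrow> r = s"
  obtains k where "n = s ^ k"
proof -
  obtain m where m: "n = s ^ multiplicity s n * m" "\<not> s dvd m"
    using multiplicity_decompose'[of n s] assms not_prime_unit by blast
  have "m = 1"
  proof (rule ccontr)
    assume "m \<noteq> 1"
    then obtain r where r: "prime r" "r dvd m" using prime_factor_nat by blast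
    then have "r dvd n" using m(1) by (metis dvd_mult)
    then show False using assms(3)[OF r(1)] r m(2) by blast
  qed
  then show ?thesis using m that by simp
qed

text \<open>\<open>z\<close> is the commutator of \<open>a\<close> and \<open>b\<close>. Both cyclic
  subgroups are normal in \<open>H\<close>, so \<open>z\<close> lies in both and commutes with both;
  taking commutators is then multiplicative in powers of either argument.\<close>

lemma dedekind_commutator:
  assumes H: "subgroup H G" and ded: "\<And>g h. g \<in> H \<Longrightarrow> h \<in> H \<Longrightarrow> cj g h \<in> powers h"
    and ab: "a \<in> H" "b \<in> H"
  obtains z where "z \<in> powers a" "z \<in> powers b" "a \<otimes> b = z \<otimes> (b \<otimes> a)" "z \<otimes> a = a \<otimes> z" "z \<otimes> b = b \<otimes> z"
    "\<And>n::nat. a [^] n \<otimes> b = z [^] n \<otimes> (b \<otimes> a [^] n)" "\<And>n::nat. a \<otimes> b [^] n = z [^] n \<otimes> (b [^] n \<otimes> a)"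
proof -
  have c: "a \<in> carrier G" "b \<in> carrier G" using ab H by auto
  have pa: "subgroup (powers a) G" and pb: "subgroup (powers b) G" using c powers_sg by auto
  define z where "z = cj a b \<otimes> inv b"
  have zb: "z \<in> powers b" unfolding z_def using ded[OF ab] pb c by (simp add: sg_mult sg_inv)
  have "z = a \<otimes> cj b (inv a)" using c by (simp add: z_def cj_def m_assoc)
  moreover have "cj b (inv a) \<in> powers a"
    using ded[OF ab(2) sg_inv[OF H ab(1)]] powers_subset[OF pa, of "inv a"] pa c by (auto simp: sg_inv)
  ultimately have za: "z \<in> powers a" using pa c by (simp add: sg_mult)
  have zc: "z \<in> carrier G" using za pa by auto
  have comm: "y \<otimes> x = x \<otimes> y" if "x \<in> carrier G" "y \<in> powers x" for x y
    using that nat_pow_comm[of x _ 1] by (auto elim!: powersE)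
  have z1: "z \<otimes> a = a \<otimes> z" and z2: "z \<otimes> b = b \<otimes> z" using comm za zb c by auto
  have eq: "a \<otimes> b = z \<otimes> (b \<otimes> a)" using c by (simp add: z_def cj_def m_assoc)
  have n1: "a [^] n \<otimes> b = z [^] n \<otimes> (b \<otimes> a [^] n)" for n :: nat
  proof (induction n)
    case (Suc n)
    have zna: "z [^] n \<otimes> a = a \<otimes> z [^] n" and anz: "a [^] n \<otimes> z = z \<otimes> a [^] n"
      using z1 zc c by (simp_all add: group_commutes_pow)
    have "a [^] Suc n \<otimes> b = a [^] n \<otimes> (z \<otimes> (b \<otimes> a))" using c eq by (simp add: m_assoc)
    also have "\<dots> = (a [^] n \<otimes> z) \<otimes> (b \<otimes> a)" using c zc by (simp add: m_assoc)
    also have "\<dots> = z \<otimes> (a [^] n \<otimes> b) \<otimes> a" using c zc anz by (simp add: m_assoc)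
    also have "\<dots> = (z \<otimes> z [^] n) \<otimes> (b \<otimes> a [^] Suc n)" using c zc Suc by (simp add: m_assoc)
    also have "z \<otimes> z [^] n = z [^] Suc n" using nat_pow_Suc2[OF zc, of n] by simp
    finally show ?case .
  qed (use c in simp)
  have n2: "a \<otimes> b [^] n = z [^] n \<otimes> (b [^] n \<otimes> a)" for n :: nat
  proof (induction n)
    case (Suc n)
    have bnz: "b [^] n \<otimes> z = z \<otimes> b [^] n" using z2 zc c by (simp add: group_commutes_pow)
    have "a \<otimes> b [^] Suc n = (a \<otimes> b [^] n) \<otimes> b" using c by (simp add: m_assoc)
    also have "\<dots> = z [^] n \<otimes> (b [^] n \<otimes> (a \<otimes> b))" using c zc Suc by (simp add: m_assoc)
    also have "\<dots> = z [^] n \<otimes> ((b [^] n \<otimes> z) \<otimes> (b \<otimes> a))" using c zc eq by (simp add: m_assoc)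
    also have "\<dots> = z [^] Suc n \<otimes> (b [^] Suc n \<otimes> a)" using c zc bnz by (simp add: m_assoc)
    finally show ?case .
  qed (use c in simp)
  show ?thesis using that[OF za zb eq z1 z2 n1 n2] .
qed

text \<open>A cyclic \<open>s\<close>-group has only one subgroup of order \<open>s\<close>,
  generated by the power \<open>x [^] (s ^ (k - 1))\<close>.\<close>

lemma prime_ord_in_powers:
  assumes x: "x \<in> carrier G" "ord x = s ^ k" "prime s" and z: "z \<in> powers x" "ord z = s" and k: "k > 0"
  shows "powers (x [^] (s ^ (k - 1))) = powers z" "z \<in> powers (x [^] (s ^ (k - 1)))"
proof -
  define m where "m = s ^ (k - 1)"
  have sm: "s ^ k = s * m" using k by (metis m_def power_eq_if not_gr0)
  have s0: "s > 0" using x prime_gt_0_nat by blast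
  have zc: "z \<in> carrier G" using z x powers_sg by blast
  obtain i where i: "z = x [^] (i::nat)" using z by (auto elim: powersE)
  have "z [^] s = \<one>" using pow_ord_eq_1[OF zc] z(2) by simp
  then have "x [^] (i * s) = \<one>" using i x(1) by (simp add: nat_pow_pow)
  then have "s * m dvd i * s" using x sm pow_eq_id by metis
  then have "m dvd i" using s0 by (simp add: mult.commute[of i])
  then obtain j where j: "i = m * j" by (auto simp: dvd_def)
  show zm: "z \<in> powers (x [^] (s ^ (k - 1)))" using i j x(1) pow_mem_powers[of "x [^] m" j] by (simp add: m_def nat_pow_pow)
  have "ord (x [^] m) = s" using ord_pow[of x m] x sm s0 by (simp add: m_def)
  then show "powers (x [^] (s ^ (k - 1))) = powers z"
    using prime_ord_powers_eq(1)[of "x [^] m" z] x zm z zc ord_eq_1 not_prime_1 unfolding m_def by (metis nat_pow_closed)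
qed

text \<open>Take non-commuting \<open>a\<close>, \<open>b\<close> with minimal sum of orders: both are \<open>s\<close>-elements and \<open>[a,b]\<close> has
  order \<open>s\<close>. Multiplying \<open>b\<close> by a power of \<open>a\<close> would lower its order unless \<open>s = 2\<close> and both
  orders are 4.\<close>

lemma dedekind_Q8:
  assumes H: "subgroup H G" and ded: "\<And>g h. g \<in> H \<Longrightarrow> h \<in> H \<Longrightarrow> cj g h \<in> powers h"
    and nab: "nonabelian G H"
  obtains a b where "a \<in> H" "b \<in> H" "a \<otimes> a = b \<otimes> b" "a \<otimes> a \<noteq> \<one>" "(a \<otimes> a) \<otimes> (a \<otimes> a) = \<one>"
    "a \<otimes> b = (a \<otimes> a) \<otimes> (b \<otimes> a)"
proof -
  have Hc: "h \<in> carrier G" if "h \<in> H" for h using that H by auto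
  \<comment> \<open>A non-commuting pair may be swapped, so the condition on the orders loses
    nothing; it singles out \<open>b\<close> as the element whose order is to be lowered.\<close>
  define nc where "nc = (\<lambda>(a, b). a \<in> H \<and> b \<in> H \<and> a \<otimes> b \<noteq> b \<otimes> a \<and> ord b \<le> ord a)"
  define wt where "wt = (\<lambda>(a, b). ord a + ord b)"
  obtain u v where uv: "u \<in> H" "v \<in> H" "u \<otimes> v \<noteq> v \<otimes> u" using nab by (auto simp: nonabelian_def)
  have "nc (u, v) \<or> nc (v, u)" using uv by (auto simp: nc_def)
  then obtain ab where ab: "nc ab" "\<And>cd. nc cd \<Longrightarrow> wt ab \<le> wt cd"
    using ex_has_least_nat[of nc _ wt] by metis
  obtain a b where e: "ab = (a, b)" by (cases ab)
  have aH: "a \<in> H" and bH: "b \<in> H" and n: "a \<otimes> b \<noteq> b \<otimes> a" and le: "ord b \<le> ord a"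
    using ab(1) e by (auto simp: nc_def)
  have c: "a \<in> carrier G" "b \<in> carrier G" using aH bH Hc by auto
  have mn: "g \<otimes> h = h \<otimes> g" if "g \<in> H" "h \<in> H" "ord g + ord h < ord a + ord b" for g h
  proof (rule ccontr)
    assume "g \<otimes> h \<noteq> h \<otimes> g"
    then have "nc (g, h) \<or> nc (h, g)" using that by (auto simp: nc_def)
    then show False using ab(2)[of "(g, h)"] ab(2)[of "(h, g)"] that e by (auto simp: wt_def)
  qed
  obtain z where z: "z \<in> powers a" "z \<in> powers b" "a \<otimes> b = z \<otimes> (b \<otimes> a)" "z \<otimes> a = a \<otimes> z" "z \<otimes> b = b \<otimes> z"
    and z1: "\<And>n::nat. a [^] n \<otimes> b = z [^] n \<otimes> (b \<otimes> a [^] n)" and z2: "\<And>n::nat. a \<otimes> b [^] n = z [^] n \<otimes> (b [^] n \<otimes> a)"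
    using dedekind_commutator[OF H ded aH bH] by metis
  have zc: "z \<in> carrier G" using z c powers_sg by blast
  have zn: "z \<noteq> \<one>" using z(3) n c by auto
  have oz: "ord z \<noteq> 1" using zn zc ord_eq_1 by blast
  have pos: "ord x > 0" if "x \<in> H" for x using that ord_ge_1[OF finite_carrier, of x] Hc by fastforce
  have less: "ord (x [^] r) < ord x" if "x \<in> H" "prime r" "r dvd ord x" for x r
    using ord_pow[of x r] that pos[OF that(1)] Hc prime_gt_1_nat[OF that(2)] by simp
  \<comment> \<open>\<open>a [^] r\<close> has smaller order than \<open>a\<close>, so by minimality
    it commutes with \<open>b\<close> and \<open>z [^] r\<close> is trivial. Thus
    \<open>ord z\<close> is the only prime dividing \<open>ord a\<close>.\<close>
  have za: "ord z = r" if r: "prime r" "r dvd ord a" for r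
  proof -
    have "a [^] r \<otimes> b = b \<otimes> a [^] r"
      using mn[OF sg_pow[OF H aH] bH, of r] less[OF aH r] by simp
    then have "z [^] r = \<one>" using z1[of r] c zc by simp
    then have "ord z dvd r" using zc pow_eq_id by blast
    then show ?thesis using r oz by (metis prime_nat_iff)
  qed
  have zb: "ord z = r" if r: "prime r" "r dvd ord b" for r
  proof -
    have "a \<otimes> b [^] r = b [^] r \<otimes> a"
      using mn[OF aH sg_pow[OF H bH], of r] less[OF bH r] by simp
    then have "z [^] r = \<one>" using z2[of r] c zc by simp
    then have "ord z dvd r" using zc pow_eq_id by blast
    then show ?thesis using r oz by (metis prime_nat_iff)
  qed
  have a1: "ord a \<noteq> 1" "ord b \<noteq> 1" using n c ord_eq_1 by auto
  define s where "s = ord z"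
  have s: "prime s" using prime_factor_nat[OF a1(1)] za s_def by metis
  have "\<exists>\<alpha>. ord a = s ^ \<alpha>" using za pos[OF aH] s s_def prime_power_of_unique_prime[of "ord a" s] by metis
  then obtain \<alpha> where \<alpha>: "ord a = s ^ \<alpha>" by blast
  have "\<exists>\<beta>. ord b = s ^ \<beta>" using zb pos[OF bH] s s_def prime_power_of_unique_prime[of "ord b" s] by metis
  then obtain \<beta> where \<beta>: "ord b = s ^ \<beta>" by blast
  have \<alpha>0: "\<alpha> > 0" and \<beta>0: "\<beta> > 0" using a1 \<alpha> \<beta> by (auto intro: gr0I)
  have s1: "s > 1" using s prime_gt_1_nat by blast
  have \<alpha>\<beta>: "\<beta> \<le> \<alpha>" using le \<alpha> \<beta> s1 by simp
  define l where "l = s ^ (\<beta> - 1)"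
  have pz: "powers (a [^] (s ^ (\<alpha> - 1))) = powers z" "powers (b [^] l) = powers z"
    using prime_ord_in_powers(1)[OF c(1) \<alpha> s z(1) s_def[symmetric] \<alpha>0]
      prime_ord_in_powers(1)[OF c(2) \<beta> s z(2) s_def[symmetric] \<beta>0]
    by (simp_all only: l_def)
  have "b [^] l \<in> powers (b [^] l)" using c by simp
  then have "b [^] l \<in> powers z" using pz(2) by simp
  then have "inv (b [^] l) \<in> powers (a [^] (s ^ (\<alpha> - 1)))" using pz(1) sg_inv[OF powers_sg[OF zc]] by simp
  then obtain w where w: "inv (b [^] l) = (a [^] (s ^ (\<alpha> - 1))) [^] (w::nat)" by (auto elim: powersE)
  \<comment> \<open>Chosen so that the \<open>l\<close>-th power of \<open>a [^] t\<close> is the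
    inverse of \<open>b [^] l\<close>; both generate subgroups of the group of order
    \<open>s\<close> that contains \<open>z\<close>.\<close>
  define t where "t = s ^ (\<alpha> - \<beta>) * w"
  have tl: "t * l = s ^ (\<alpha> - 1) * w"
  proof -
    have "s ^ (\<alpha> - \<beta>) * s ^ (\<beta> - 1) = s ^ (\<alpha> - 1)" using \<alpha>\<beta> \<beta>0 by (simp flip: power_add)
    then show ?thesis by (simp add: t_def l_def mult.assoc mult.left_commute)
  qed
  define d where "d = a [^] t"
  have dc: "d \<in> carrier G" using c by (simp add: d_def)
  have dl: "d [^] l = inv (b [^] l)" using w tl c by (simp add: d_def nat_pow_pow)
  have zt: "z [^] t \<in> carrier G" using zc by simp
  have ztb: "z [^] t \<otimes> b = b \<otimes> z [^] t" by (rule group_commutes_pow[OF z(5) zc c(2)])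
  have zta: "z [^] t \<otimes> a = a \<otimes> z [^] t" by (rule group_commutes_pow[OF z(4) zc c(1)])
  have ztd: "z [^] t \<otimes> d = d \<otimes> z [^] t"
    unfolding d_def by (rule group_commutes_pow[OF zta[symmetric] c(1) zt, symmetric])
  have "d \<otimes> b = z [^] t \<otimes> (b \<otimes> d)" using z1[of t] by (simp add: d_def)
  also have "\<dots> = (z [^] t \<otimes> b) \<otimes> d" using zt c dc by (simp add: m_assoc)
  also have "\<dots> = b \<otimes> (z [^] t \<otimes> d)" using zt c dc ztb by (simp add: m_assoc)
  also have "\<dots> = b \<otimes> d \<otimes> z [^] t" using zt c dc ztd by (simp add: m_assoc)
  finally have db: "d \<otimes> b = b \<otimes> d \<otimes> z [^] t" .
  \<comment> \<open>By the choice of \<open>t\<close> the first two factors cancel and only a power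
    of \<open>z\<close> survives. Since \<open>b \<otimes> d\<close> does not commute with
    \<open>a\<close>, minimality forbids that power to be trivial.\<close>
  have "(b \<otimes> d) [^] l = b [^] l \<otimes> d [^] l \<otimes> (z [^] t) [^] (l * (l - 1) div 2)"
    by (rule pow_mult_class2[OF c(2) dc zt db ztb ztd])
  then have bdl: "(b \<otimes> d) [^] l = z [^] (t * (l * (l - 1) div 2))"
    using dl c zc by (simp add: nat_pow_pow)
  have bdH: "b \<otimes> d \<in> H" using bH aH H by (simp add: d_def sg_mult sg_pow)
  have "a \<otimes> (b \<otimes> d) \<noteq> (b \<otimes> d) \<otimes> a"
  proof
    assume "a \<otimes> (b \<otimes> d) = (b \<otimes> d) \<otimes> a"
    moreover have "d \<otimes> a = a \<otimes> d" using c unfolding d_def by (simp add: group_commutes_pow)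
    ultimately have "(a \<otimes> b) \<otimes> d = (b \<otimes> a) \<otimes> d" using c dc by (simp add: m_assoc)
    then show False using n c dc by simp
  qed
  then have "\<not> ord (b \<otimes> d) < ord b" using mn[OF aH bdH] by auto
  moreover have "l < ord b" using \<beta> \<beta>0 s1 by (simp add: l_def)
  moreover have "l > 0" using s1 by (simp add: l_def)
  ultimately have "(b \<otimes> d) [^] l \<noteq> \<one>"
    using pow_eq_id[of "b \<otimes> d" l] c dc by (metis dvd_imp_le le_less_trans m_closed)
  then have nd: "\<not> s dvd t * (l * (l - 1) div 2)" using bdl pow_eq_id[OF zc] s_def by metis
  then have nd1: "\<not> s dvd t" and nd2: "\<not> s dvd l * (l - 1) div 2" by (auto simp: dvd_mult dvd_mult2)
  have "\<alpha> - \<beta> = 0" using nd1 by (rule_tac ccontr) (auto simp: t_def dvd_mult2)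
  then have eq: "\<alpha> = \<beta>" using \<alpha>\<beta> by simp
  have "\<beta> \<noteq> 1" using nd2 by (auto simp: l_def)
  then have \<beta>2: "\<beta> \<ge> 2" using \<beta>0 by simp
  have sl: "s dvd l" using \<beta>2 by (simp add: l_def)
  \<comment> \<open>For odd \<open>s\<close> the divisor \<open>s\<close> of \<open>l\<close>
    survives the division of \<open>l * (l - 1)\<close> by 2. For \<open>s = 2\<close> the same
    number is even as soon as 4 divides \<open>l\<close>, which excludes \<open>\<beta> > 2\<close>
    below.\<close>
  have s2: "s = 2"
  proof (rule ccontr)
    assume "s \<noteq> 2"
    then have "odd s" using s prime_odd_nat s1 by (metis le_neq_implies_less less_2_cases_iff not_less prime_ge_2_nat)
    then have cp: "coprime s 2" by simp
    have "even (l * (l - 1))" by auto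
    then have "2 * (l * (l - 1) div 2) = l * (l - 1)" by (rule dvd_mult_div_cancel)
    then have "s dvd 2 * (l * (l - 1) div 2)" using sl by simp
    then show False using nd2 cp by (simp add: coprime_dvd_mult_right_iff)
  qed
  have "\<beta> = 2"
  proof (rule ccontr)
    assume "\<beta> \<noteq> 2"
    then have "2 \<le> \<beta> - 1" using \<beta>2 by simp
    then have "2 ^ 2 dvd l" unfolding l_def s2 by (rule le_imp_power_dvd)
    then obtain q where "l = 4 * q" by (auto simp: dvd_def)
    then have "l * (l - 1) div 2 = 2 * (q * (l - 1))" by simp
    then show False using nd2 s2 by simp
  qed
  then have o4: "ord a = 4" "ord b = 4" using \<alpha> \<beta> eq s2 by simp_all
  \<comment> \<open>The square of a generator is the only involution in a cyclic group of order
    4.\<close>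
  have sq: "z = x \<otimes> x" if x: "x \<in> carrier G" "ord x = 4" "z \<in> powers x" for x
  proof -
    obtain i where i: "z = x [^] (i::nat)" using x by (auto elim: powersE)
    have "z [^] (2::nat) = \<one>" using pow_ord_eq_1[OF zc] s2 s_def by simp
    then have "x [^] (i * 2) = \<one>" using i x by (simp add: nat_pow_pow)
    then have "4 dvd i * 2" using x pow_eq_id by metis
    then obtain j where j: "i = 2 * j" by (auto simp: dvd_def)
    have "odd j"
    proof
      assume "even j"
      then have "4 dvd i" using j by (auto simp: dvd_def)
      then have "z = \<one>" using i x pow_eq_id by metis
      then show False using zn by simp
    qed
    then obtain q where "j = 2 * q + 1" by (auto elim: oddE)
    then have iq: "i = 4 * q + 2" using j by simp
    have "z = (x [^] (4::nat)) [^] q \<otimes> x [^] (2::nat)" using i iq x by (simp add: nat_pow_pow nat_pow_mult)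
    also have "x [^] (4::nat) = \<one>" using pow_ord_eq_1[OF x(1)] x(2) by simp
    finally show ?thesis using x by (simp add: numeral_2_eq_2)
  qed
  have zaa: "z = a \<otimes> a" and zbb: "z = b \<otimes> b" using sq c o4 z by auto
  have "z [^] (2::nat) = \<one>" using pow_ord_eq_1[OF zc] s2 s_def by simp
  then have "z \<otimes> z = \<one>" using zc by (simp add: numeral_2_eq_2)
  then show ?thesis using that[OF aH bH] zaa zbb zn z(3) by metis
qed

text \<open>The square \<open>z\<close> plays the role of the sign, and \<open>w\<close> sends the
  units 1, i, j, k to \<open>\<one>\<close>, \<open>a\<close>, \<open>b\<close>,
  \<open>a \<otimes> b\<close>. The relations reproduce the table \<open>q8_umul\<close>.\<close>

lemma Q8_subgroup:
  assumes c: "a \<in> carrier G" "b \<in> carrier G" and bb: "b \<otimes> b = a \<otimes> a" and z1: "a \<otimes> a \<noteq> \<one>"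
    and zz: "(a \<otimes> a) \<otimes> (a \<otimes> a) = \<one>" and ab: "a \<otimes> b = (a \<otimes> a) \<otimes> (b \<otimes> a)"
  defines "Q \<equiv> {s \<otimes> w | s w. s \<in> {\<one>, a \<otimes> a} \<and> w \<in> {\<one>, a, b, a \<otimes> b}}"
  shows "subgroup Q G" "G\<lparr>carrier := Q\<rparr> \<cong> Q8"
proof -
  define z where "z = a \<otimes> a"
  define w where "w u = (if u = 0 then \<one> else if u = 1 then a else if u = 2 then b else a \<otimes> b)" for u :: nat
  define f where "f x = (if fst x then z else \<one>) \<otimes> w (snd x)" for x :: "bool \<times> nat"
  let ?U = "{0, 1, 2, 3::nat}"
  have zc: "z \<in> carrier G" and wc: "w u \<in> carrier G" for u using c by (auto simp: z_def w_def)
  have aa: "a \<otimes> a = z" "b \<otimes> b = z" "z \<otimes> z = \<one>" using bb zz by (auto simp: z_def)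
  have za: "a \<otimes> z = z \<otimes> a" using c by (simp add: z_def m_assoc)
  have zb: "b \<otimes> z = z \<otimes> b" using c bb by (metis z_def m_assoc)
  have ab': "a \<otimes> b = z \<otimes> (b \<otimes> a)" using ab by (simp add: z_def)
  then have ba: "b \<otimes> a = z \<otimes> (a \<otimes> b)" using c zc aa(3) by (simp flip: m_assoc)
  have l: "x \<otimes> (y \<otimes> t) = (x \<otimes> y) \<otimes> t" if "x \<in> carrier G" "y \<in> carrier G" "t \<in> carrier G" for x y t
    using that by (simp add: m_assoc)
  have az: "a \<otimes> (z \<otimes> t) = z \<otimes> (a \<otimes> t)" "b \<otimes> (z \<otimes> t) = z \<otimes> (b \<otimes> t)" "z \<otimes> (z \<otimes> t) = t"
    if "t \<in> carrier G" for t
    using that c zc l[of a z t] l[of b z t] l[of z z t] za zb aa(3) by (simp_all add: m_assoc)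
  have p13: "a \<otimes> (a \<otimes> b) = z \<otimes> b" using l[of a a b] c aa(1) by simp
  have p23: "b \<otimes> (a \<otimes> b) = a"
  proof -
    have "b \<otimes> (a \<otimes> b) = z \<otimes> (a \<otimes> (b \<otimes> b))" using l[of b a b] c zc ba by (simp add: m_assoc)
    then show ?thesis using aa(2) za az(3)[of a] c by simp
  qed
  have p31: "a \<otimes> b \<otimes> a = b"
  proof -
    have "a \<otimes> b \<otimes> a = a \<otimes> (z \<otimes> (a \<otimes> b))" using c ba by (simp add: m_assoc)
    also have "\<dots> = z \<otimes> (a \<otimes> (a \<otimes> b))" using az(1)[of "a \<otimes> b"] c by simp
    finally show ?thesis using p13 az(3)[of b] c by simp
  qed
  have p32: "a \<otimes> b \<otimes> b = z \<otimes> a" using c aa(2) za by (simp add: m_assoc)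
  have p33: "a \<otimes> b \<otimes> (a \<otimes> b) = z"
  proof -
    have "a \<otimes> b \<otimes> (a \<otimes> b) = (a \<otimes> b \<otimes> a) \<otimes> b" using c by (simp add: m_assoc)
    then show ?thesis using p31 aa(2) by simp
  qed
  have wm: "w u \<otimes> w v = f (q8_umul u v)" if "u \<in> ?U" "v \<in> ?U" for u v
    using that c zc aa ba p13 p23 p31 p32 p33
    by (elim insertE emptyE) (simp_all add: w_def f_def q8_umul_def)
  have zw: "w u \<otimes> z = z \<otimes> w u" for u using c zc za zb az by (simp add: w_def m_assoc)
  have umul: "snd (q8_umul u v) \<in> ?U" if "u \<in> ?U" "v \<in> ?U" for u v
    using that by (auto simp: q8_umul_def)
  have fm: "f (q8_mult x y) = f x \<otimes> f y" if "snd x \<in> ?U" "snd y \<in> ?U" for x y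
  proof -
    define e where "e t = (if t then z else \<one>)" for t :: bool
    have ec: "e t \<in> carrier G" for t using zc by (simp add: e_def)
    have em: "e t \<otimes> e t' = e (t \<noteq> t')" for t t' using zc aa by (auto simp: e_def)
    have ew: "w u \<otimes> e t = e t \<otimes> w u" for u t using zw wc by (auto simp: e_def)
    define r where "r = q8_umul (snd x) (snd y)"
    have "f x \<otimes> f y = e (fst x) \<otimes> (w (snd x) \<otimes> e (fst y)) \<otimes> w (snd y)"
      using ec wc by (simp add: f_def e_def[symmetric] m_assoc)
    also have "\<dots> = (e (fst x) \<otimes> e (fst y)) \<otimes> (w (snd x) \<otimes> w (snd y))"
      using ec wc ew by (simp add: m_assoc)
    also have "w (snd x) \<otimes> w (snd y) = e (fst r) \<otimes> w (snd r)"
      using wm that by (simp add: f_def e_def r_def)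
    also have "(e (fst x) \<otimes> e (fst y)) \<otimes> (e (fst r) \<otimes> w (snd r)) = (e (fst x) \<otimes> e (fst y) \<otimes> e (fst r)) \<otimes> w (snd r)"
      using ec wc by (simp add: m_assoc)
    also have "\<dots> = e ((fst x \<noteq> fst y) \<noteq> fst r) \<otimes> w (snd r)" using em by simp
    finally show ?thesis by (simp add: f_def q8_mult_def r_def e_def Let_def)
  qed
  have Qf: "Q = f ` carrier Q8"
  proof
    show "Q \<subseteq> f ` carrier Q8"
    proof
      fix y assume "y \<in> Q"
      then obtain s v where sv: "y = s \<otimes> v" "s \<in> {\<one>, z}" "v \<in> {\<one>, a, b, a \<otimes> b}"
        by (auto simp: Q_def z_def)
      have "\<exists>u\<in>?U. v = w u" using sv(3) by (auto simp: w_def)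
      then obtain u where u: "v = w u" "u \<in> ?U" by blast
      have "y = f (s = z, u)" using sv u z1 by (auto simp: f_def z_def)
      then show "y \<in> f ` carrier Q8" using u by (auto simp: Q8_def)
    qed
    show "f ` carrier Q8 \<subseteq> Q"
    proof (rule image_subsetI)
      fix x
      have "(if fst x then z else \<one>) \<in> {\<one>, a \<otimes> a}" "w (snd x) \<in> {\<one>, a, b, a \<otimes> b}"
        by (simp_all add: z_def w_def)
      then show "f x \<in> Q" unfolding Q_def f_def by blast
    qed
  qed
  have fc: "f x \<in> carrier G" for x using zc wc by (simp add: f_def)
  have clos: "q8_mult x y \<in> carrier Q8" if "x \<in> carrier Q8" "y \<in> carrier Q8" for x y
  proof -
    have "snd (q8_mult x y) \<in> ?U"
      unfolding q8_mult_def Let_def snd_conv using that by (intro umul) (simp_all add: Q8_def mem_Times_iff)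
    then show ?thesis by (simp add: Q8_def mem_Times_iff)
  qed
  show sg: "subgroup Q G"
  proof (rule finite_subgroupI)
    show "Q \<subseteq> carrier G" using Qf fc by auto
    have "f (False, 0) = \<one>" by (simp add: f_def w_def)
    moreover have "(False, 0) \<in> carrier Q8" by (simp add: Q8_def)
    ultimately show "\<one> \<in> Q" unfolding Qf by (metis imageI)
    fix x y assume "x \<in> Q" "y \<in> Q"
    then obtain p q where pq: "p \<in> carrier Q8" "q \<in> carrier Q8" "x = f p" "y = f q" by (auto simp: Qf)
    then have "snd p \<in> ?U" "snd q \<in> ?U" by (simp_all add: Q8_def mem_Times_iff)
    then have "x \<otimes> y = f (q8_mult p q)" using fm pq by simp
    then show "x \<otimes> y \<in> Q" using clos[OF pq(1,2)] unfolding Qf by blast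
  qed
  have nab: "a \<otimes> b \<noteq> b \<otimes> a" using ab' z1 c zc by (simp add: z_def)
  \<comment> \<open>Which of \<open>a\<close> and \<open>b\<close> commute with an element
    determines its unit; the sign is then read off from \<open>z \<noteq> \<one>\<close>. This gives
    injectivity without comparing elements one by one.\<close>
  have comm_a: "w u \<otimes> a = a \<otimes> w u \<longleftrightarrow> u \<in> {0, 1}" if "u \<in> ?U" for u
  proof -
    have "a \<otimes> b \<otimes> a \<noteq> a \<otimes> (a \<otimes> b)" using c nab by (simp add: m_assoc)
    then show ?thesis using that c nab by (auto simp: w_def)
  qed
  have comm_b: "w u \<otimes> b = b \<otimes> w u \<longleftrightarrow> u \<in> {0, 2}" if "u \<in> ?U" for u
  proof -
    have "a \<otimes> b \<otimes> b \<noteq> b \<otimes> (a \<otimes> b)" using c nab by (simp add: m_assoc[symmetric])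
    then show ?thesis using that c nab by (auto simp: w_def)
  qed
  have inj: "inj_on f (carrier Q8)"
  proof (rule inj_onI)
    fix x y assume x: "x \<in> carrier Q8" and y: "y \<in> carrier Q8" and e: "f x = f y"
    have U: "snd x \<in> ?U" "snd y \<in> ?U" using x y by (auto simp: Q8_def)
    have fa: "f x \<otimes> a = a \<otimes> f x \<longleftrightarrow> snd x \<in> {0, 1}" if "snd x \<in> ?U" for x
    proof (cases "fst x")
      case True
      then have "f x \<otimes> a = a \<otimes> f x \<longleftrightarrow> z \<otimes> (w (snd x) \<otimes> a) = z \<otimes> (a \<otimes> w (snd x))"
        using c zc wc az by (simp add: f_def m_assoc)
      then show ?thesis using comm_a[OF that] c zc wc by simp
    qed (use comm_a[OF that] wc in \<open>simp add: f_def\<close>)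
    have fb: "f x \<otimes> b = b \<otimes> f x \<longleftrightarrow> snd x \<in> {0, 2}" if "snd x \<in> ?U" for x
    proof (cases "fst x")
      case True
      then have "f x \<otimes> b = b \<otimes> f x \<longleftrightarrow> z \<otimes> (w (snd x) \<otimes> b) = z \<otimes> (b \<otimes> w (snd x))"
        using c zc wc az by (simp add: f_def m_assoc)
      then show ?thesis using comm_b[OF that] c zc wc by simp
    qed (use comm_b[OF that] wc in \<open>simp add: f_def\<close>)
    have "snd x \<in> {0, 1} \<longleftrightarrow> snd y \<in> {0, 1}" "snd x \<in> {0, 2} \<longleftrightarrow> snd y \<in> {0, 2}"
      by (simp_all only: fa[OF U(1), symmetric] fa[OF U(2), symmetric] fb[OF U(1), symmetric] fb[OF U(2), symmetric] e)
    then have s: "snd x = snd y" using U by (elim insertE emptyE) simp_all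
    have "fst x = fst y"
      using e s wc[of "snd y"] zc z1 by (auto simp: f_def z_def split: if_splits)
    then show "x = y" using s by (simp add: prod_eq_iff)
  qed
  define g where "g = inv_into (carrier Q8) f"
  have gf: "g (f x) = x" if "x \<in> carrier Q8" for x using inj that by (simp add: g_def)
  have "g \<in> iso (G\<lparr>carrier := Q\<rparr>) Q8"
  proof (rule isoI)
    show "g \<in> hom (G\<lparr>carrier := Q\<rparr>) Q8"
    proof (rule homI)
      show "g x \<in> carrier Q8" if "x \<in> carrier (G\<lparr>carrier := Q\<rparr>)" for x
        using that gf by (auto simp: Qf)
      show "g (x \<otimes>\<^bsub>G\<lparr>carrier := Q\<rparr>\<^esub> y) = g x \<otimes>\<^bsub>Q8\<^esub> g y"
        if "x \<in> carrier (G\<lparr>carrier := Q\<rparr>)" "y \<in> carrier (G\<lparr>carrier := Q\<rparr>)" for x y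
      proof -
        obtain p q where pq: "p \<in> carrier Q8" "q \<in> carrier Q8" "x = f p" "y = f q"
          using \<open>x \<in> carrier (G\<lparr>carrier := Q\<rparr>)\<close> \<open>y \<in> carrier (G\<lparr>carrier := Q\<rparr>)\<close> by (auto simp: Qf)
        then have "snd p \<in> ?U" "snd q \<in> ?U" by (simp_all add: Q8_def mem_Times_iff)
        then have "x \<otimes> y = f (q8_mult p q)" using fm pq by simp
        then show ?thesis using pq gf clos by (simp add: Q8_def)
      qed
    qed
    have "bij_betw g (f ` carrier Q8) (carrier Q8)"
      unfolding g_def using inj by (simp add: bij_betw_inv_into inj_on_imp_bij_betw)
    then show "bij_betw g (carrier (G\<lparr>carrier := Q\<rparr>)) (carrier Q8)" by (simp add: Qf)
  qed
  then show "G\<lparr>carrier := Q\<rparr> \<cong> Q8" by (rule is_isoI)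
qed

end

context fin_group
begin

lemma int_pow_mem_powers: "a \<in> carrier G \<Longrightarrow> a [^] (n::int) \<in> powers a"
  by (cases n rule: int_cases2) (simp_all add: int_pow_int int_pow_neg_int powers_sg sg_inv)

lemma cyclic_group_powers:
  assumes "a \<in> carrier G"
  shows "cyclic_group (G\<lparr>carrier := powers a\<rparr>)"
proof -
  have sg: "subgroup (powers a) G" using assms by (rule powers_sg)
  interpret P: group "G\<lparr>carrier := powers a\<rparr>" using sg by (rule subgroup_imp_group)
  have "\<exists>x\<in>carrier (G\<lparr>carrier := powers a\<rparr>).
      carrier (G\<lparr>carrier := powers a\<rparr>) = range (\<lambda>n::int. x [^]\<^bsub>G\<lparr>carrier := powers a\<rparr>\<^esub> n)"
  proof (rule bexI[of _ a])
    have e: "a [^]\<^bsub>G\<lparr>carrier := powers a\<rparr>\<^esub> n = a [^] n" for n :: int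
      using int_pow_consistent[OF sg] assms by simp
    have "a [^] n \<in> powers a" for n :: int using int_pow_mem_powers[OF assms] .
    moreover have "y \<in> range (\<lambda>n::int. a [^] n)" if "y \<in> powers a" for y
      using that by (auto elim!: powersE simp flip: int_pow_int)
    ultimately show "carrier (G\<lparr>carrier := powers a\<rparr>) = range (\<lambda>n::int. a [^]\<^bsub>G\<lparr>carrier := powers a\<rparr>\<^esub> n)"
      by (auto simp: e)
  qed (use assms in simp)
  then show ?thesis by (simp add: P.cyclic_group)
qed

text \<open>The abelian case is \<open>abelian_fpf_cyclic\<close>. Otherwise \<open>H\<close> has a
  unique involution \<open>z\<close> and contains a quaternion group \<open>Q\<close>. Every element
  of \<open>H\<close> acts on \<open>Q\<close> by signs, that is, like an element of
  \<open>Q\<close>, so \<open>H\<close> is the product of \<open>Q\<close> and its centralizer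
  \<open>C\<close>; and \<open>C\<close> is cyclic of order twice an odd number.\<close>

lemma dedekind_fpf:
  assumes H: "subgroup H G" and ded: "\<And>g h. g \<in> H \<Longrightarrow> h \<in> H \<Longrightarrow> cj g h \<in> powers h"
    and W: "subgroup W G" "W \<noteq> {\<one>}" and W_ab: "\<And>m n. m \<in> W \<Longrightarrow> n \<in> W \<Longrightarrow> m \<otimes> n = n \<otimes> m"
    and HW: "\<And>a n. a \<in> H \<Longrightarrow> n \<in> W \<Longrightarrow> cj a n \<in> W"
    and fpf: "\<And>a n. a \<in> H \<Longrightarrow> n \<in> W \<Longrightarrow> n \<noteq> \<one> \<Longrightarrow> cj a n = n \<Longrightarrow> a = \<one>"
  shows "cyclic_group (G\<lparr>carrier := H\<rparr>) \<or> Q8_times_odd_cyclic G H"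
proof (cases "nonabelian G H")
  case False
  obtain a where "a \<in> H" "H = powers a"
    by (rule abelian_fpf_cyclic[OF H abelianD[OF False] W W_ab HW fpf])
  then show ?thesis using cyclic_group_powers[OF sgD[OF H]] by auto
next
  case True
  have Hc: "h \<in> carrier G" if "h \<in> H" for h using that H by auto
  have Wc: "h \<in> carrier G" if "h \<in> W" for h using that W by auto
  obtain n where n: "n \<in> W" "n \<noteq> \<one>" using W sg_one by blast
  \<comment> \<open>\<open>n \<otimes> cj t n\<close> is fixed by the involution \<open>t\<close>,
    hence trivial. So the product of two involutions fixes \<open>n\<close>, which is why there is
    only one involution.\<close>
  have invo: "cj t n = inv n" if t: "t \<in> H" "t \<otimes> t = \<one>" "t \<noteq> \<one>" for t
  proof -
    have c: "t \<in> carrier G" "n \<in> carrier G" using t n Hc Wc by auto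
    have tn: "cj t n \<in> W" using HW t n by blast
    have "cj t (n \<otimes> cj t n) = cj t n \<otimes> n" using c t by (simp add: cj_mult cj_cj)
    also have "\<dots> = n \<otimes> cj t n" using W_ab[OF tn n(1)] .
    finally have "n \<otimes> cj t n = \<one>" using fpf[OF t(1) sg_mult[OF W(1) n(1) tn]] t by blast
    then show ?thesis using c by (metis cj_closed inv_equality inv_inv inv_closed)
  qed
  have uniq: "t = t'" if t: "t \<in> H" "t \<otimes> t = \<one>" "t \<noteq> \<one>" "t' \<in> H" "t' \<otimes> t' = \<one>" "t' \<noteq> \<one>" for t t'
  proof -
    have c: "t \<in> carrier G" "n \<in> carrier G" "t' \<in> carrier G" using t n Hc Wc by auto
    have "cj (t \<otimes> t') n = n" using invo[OF t(1-3)] invo[OF t(4-6)] c by (simp add: cj_cj[symmetric] cj_inv)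
    then have "t \<otimes> t' = \<one>" using fpf[OF sg_mult[OF H t(1,4)] n] by simp
    then show ?thesis using c t by (metis inv_equality)
  qed
  obtain a b where ab: "a \<in> H" "b \<in> H" "a \<otimes> a = b \<otimes> b" "a \<otimes> a \<noteq> \<one>" "(a \<otimes> a) \<otimes> (a \<otimes> a) = \<one>"
    "a \<otimes> b = (a \<otimes> a) \<otimes> (b \<otimes> a)"
    using dedekind_Q8[OF H ded True] by metis
  have c: "a \<in> carrier G" "b \<in> carrier G" using ab Hc by auto
  define z where "z = a \<otimes> a"
  have zH: "z \<in> H" and zc: "z \<in> carrier G" using ab H c by (auto simp: z_def sg_mult)
  have z: "z \<otimes> z = \<one>" "z \<noteq> \<one>" "a \<otimes> a = z" "b \<otimes> b = z" "a \<otimes> b = z \<otimes> (b \<otimes> a)" using ab by (auto simp: z_def)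
  have za: "a \<otimes> z = z \<otimes> a" using c by (simp add: z_def m_assoc)
  have zb: "b \<otimes> z = z \<otimes> b" using c ab(3) by (metis z_def m_assoc)
  have zz: "z \<otimes> (z \<otimes> x) = x" if "x \<in> carrier G" for x using that zc z(1) by (metis m_assoc l_one)
  have ba: "b \<otimes> a = z \<otimes> (a \<otimes> b)" using z(5) zz[of "b \<otimes> a"] c by simp
  have nab: "a \<otimes> b \<noteq> b \<otimes> a" using z c zc by simp
  have cba: "cj b a = z \<otimes> a" using ba c zc by (simp add: cj_def m_assoc)
  have cab: "cj a b = z \<otimes> b" using z(5) c zc by (simp add: cj_def m_assoc)
  have cself: "cj x x = x" if "x \<in> carrier G" for x using that by (simp add: cj_def m_assoc)
  define Q where "Q = {s \<otimes> w | s w. s \<in> {\<one>, a \<otimes> a} \<and> w \<in> {\<one>, a, b, a \<otimes> b}}"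
  have Q: "subgroup Q G" "G\<lparr>carrier := Q\<rparr> \<cong> Q8"
    using Q8_subgroup[OF c ab(3)[symmetric] ab(4-6)] by (simp_all only: Q_def)
  have QH: "Q \<subseteq> H" using ab H by (auto simp: Q_def sg_mult sg_one)
  have Qm: "z \<in> Q" "a \<in> Q" "b \<in> Q"
  proof -
    have "z = z \<otimes> \<one>" "a = \<one> \<otimes> a" "b = \<one> \<otimes> b" using zc c by auto
    then show "z \<in> Q" "a \<in> Q" "b \<in> Q" unfolding Q_def z_def by blast+
  qed
  define C where "C = {h \<in> H. cj h a = a} \<inter> {h \<in> H. cj h b = b}"
  have C: "subgroup C G" unfolding C_def using subgroup_centralizer[OF H] c by (intro sg_Int) auto
  have CH: "C \<subseteq> H" by (auto simp: C_def)
  have Cab: "x \<otimes> a = a \<otimes> x" "x \<otimes> b = b \<otimes> x" if "x \<in> C" for x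
    using that c Hc by (auto simp: C_def cj_fix_iff)
  have zC: "z \<in> C" using zH za zb c zc by (simp add: C_def cj_fix_iff)
  \<comment> \<open>The conjugate is a power of \<open>x\<close> with square \<open>z\<close>. An
    even power of \<open>x\<close> is a power of \<open>z\<close> and has trivial square, so the
    exponent is odd.\<close>
  have sign: "cj h x = x \<or> cj h x = z \<otimes> x" if h: "h \<in> H" and x: "x \<in> H" "x \<otimes> x = z" for h x
  proof -
    have xc: "x \<in> carrier G" and hc: "h \<in> carrier G" using x h Hc by auto
    obtain i :: nat where i: "cj h x = x [^] i" using ded[OF h x(1)] by (auto elim: powersE)
    have "cj h z = z"
    proof -
      have zh: "cj h z \<in> H" using cj_mem[OF H h zH] .
      have "cj h z \<otimes> cj h z = \<one>" using hc zc z by (simp flip: cj_mult)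
      then show ?thesis using uniq[OF zh _ _ zH z(1,2)] z(2) hc zc by simp
    qed
    then have sq: "cj h x \<otimes> cj h x = z" using x hc xc by (simp flip: cj_mult)
    have p2: "x [^] (2 * k) = z [^] k" for k :: nat
      using x xc by (simp flip: nat_pow_pow) (simp add: numeral_2_eq_2)
    have zk: "z [^] k = \<one> \<or> z [^] k = z" for k :: nat
      by (induction k) (use z zc in auto)
    show ?thesis
    proof (cases "even i")
      case True
      then obtain k where "i = 2 * k" by auto
      then have "cj h x = z [^] k" using i p2 by simp
      then have "cj h x \<otimes> cj h x = \<one>" using zk[of k] z(1) by auto
      then show ?thesis using sq z(2) by simp
    next
      case False
      then obtain k where "i = 2 * k + 1" by (auto elim: oddE)
      then have "cj h x = z [^] k \<otimes> x" using i p2 xc by (simp flip: nat_pow_mult)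
      then show ?thesis using zk[of k] xc by auto
    qed
  qed
  \<comment> \<open>The four sign patterns on \<open>a\<close> and \<open>b\<close> are realized by
    conjugation with \<open>\<one>\<close>, \<open>b\<close>, \<open>a\<close> and
    \<open>a \<otimes> b\<close>; the matching element undoes the action of
    \<open>h\<close>.\<close>
  have inC: "\<exists>q\<in>Q. h \<otimes> q \<in> C" if h: "h \<in> H" for h
  proof -
    have hc: "h \<in> carrier G" using h Hc by auto
    have hz: "cj h z = z"
    proof -
      have zh: "cj h z \<in> H" using cj_mem[OF H h zH] .
      have "cj h z \<otimes> cj h z = \<one>" using hc zc z by (simp flip: cj_mult)
      then show ?thesis using uniq[OF zh _ _ zH z(1,2)] z(2) hc zc by simp
    qed
    have mem: "h \<otimes> q \<in> C" if "q \<in> Q" "cj h (cj q a) = a" "cj h (cj q b) = b" for q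
    proof -
      have "q \<in> H" using that QH by auto
      then show ?thesis using that h H hc Hc c by (simp add: C_def sg_mult flip: cj_cj)
    qed
    have c1: "cj (a \<otimes> b) a = z \<otimes> a" "cj (a \<otimes> b) b = z \<otimes> b"
    proof -
      have "cj a z = z" using za c zc by (simp add: cj_fix_iff)
      then show "cj (a \<otimes> b) a = z \<otimes> a" using c zc by (simp add: cba cj_mult cself flip: cj_cj)
      show "cj (a \<otimes> b) b = z \<otimes> b" using c zc by (simp add: cself cab flip: cj_cj)
    qed
    have sa: "cj h a = a \<or> cj h a = z \<otimes> a" and sb: "cj h b = b \<or> cj h b = z \<otimes> b"
      using sign[OF h ab(1)] sign[OF h ab(2)] z by auto
    have hza: "cj h (z \<otimes> a) = z \<otimes> cj h a" "cj h (z \<otimes> b) = z \<otimes> cj h b"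
      using hc zc c hz by (simp_all add: cj_mult)
    consider "cj h a = a" "cj h b = b" | "cj h a = z \<otimes> a" "cj h b = b"
      | "cj h a = a" "cj h b = z \<otimes> b" | "cj h a = z \<otimes> a" "cj h b = z \<otimes> b"
      using sa sb by blast
    then show ?thesis
    proof cases
      case 1
      then show ?thesis using mem[OF sg_one[OF Q(1)]] c sg_one[OF Q(1)] by auto
    next
      case 2
      then show ?thesis using mem[OF Qm(3)] hza zz c Qm cba cself by auto
    next
      case 3
      then show ?thesis using mem[OF Qm(2)] hza zz c Qm cab cself by auto
    next
      case 4
      then show ?thesis using mem[OF sg_mult[OF Q(1) Qm(2,3)]] hza zz c Q(1) Qm c1 sg_mult by auto
    qed
  qed
  \<comment> \<open>If \<open>d \<in> C\<close> had square \<open>z\<close>, then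
    \<open>a \<otimes> d\<close> would have trivial square, so it would be \<open>\<one>\<close> or
    \<open>z\<close>; either puts \<open>a\<close> into \<open>C\<close>, although \<open>a\<close>
    does not commute with \<open>b\<close>.\<close>
  have nosq: False if d: "d \<in> C" "d \<otimes> d = z" for d
  proof -
    have dc: "d \<in> carrier G" and dH: "d \<in> H" using d CH Hc by auto
    have da: "d \<otimes> a = a \<otimes> d" and db: "d \<otimes> b = b \<otimes> d" using Cab d by auto
    have "(a \<otimes> d) \<otimes> (a \<otimes> d) = (a \<otimes> a) \<otimes> (d \<otimes> d)"
      using da c dc by (metis m_assoc m_closed)
    then have sq: "(a \<otimes> d) \<otimes> (a \<otimes> d) = \<one>" using z d by simp
    have "a \<otimes> d = \<one> \<or> a \<otimes> d = z"
      using uniq[OF sg_mult[OF H ab(1) dH] sq _ zH z(1,2)] by blast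
    then have "a \<otimes> d \<in> C" using zC C sg_one by metis
    then have "a \<in> C" using sg_mult_iff2[OF C d(1) c(1)] by simp
    then show False using Cab(2)[of a] nab by simp
  qed
  have Cded: "cj g h \<in> powers h" if "g \<in> C" "h \<in> C" for g h using that ded CH by blast
  have "\<not> nonabelian G C"
  proof
    assume "nonabelian G C"
    then obtain d e where de: "d \<in> C" "d \<otimes> d \<noteq> \<one>" "(d \<otimes> d) \<otimes> (d \<otimes> d) = \<one>"
      using dedekind_Q8[OF C Cded] by metis
    then have "d \<otimes> d = z" using uniq[of "d \<otimes> d" z] zH z CH H by (auto simp: sg_mult)
    then show False using nosq de by blast
  qed
  then obtain x where x: "x \<in> C" "C = powers x"
  proof -
    assume C_ab: "\<not> nonabelian G C" and th: "\<And>x. x \<in> C \<Longrightarrow> C = powers x \<Longrightarrow> thesis"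
    show thesis
    proof (rule abelian_fpf_cyclic[OF C _ W W_ab])
      show "u \<otimes> v = v \<otimes> u" if "u \<in> C" "v \<in> C" for u v using abelianD[OF C_ab that] .
      show "cj u m \<in> W" if "u \<in> C" "m \<in> W" for u m using that CH HW by blast
      show "u = \<one>" if "u \<in> C" "m \<in> W" "m \<noteq> \<one>" "cj u m = m" for u m using that CH fpf by blast
    qed (use th in auto)
  qed
  have xc: "x \<in> carrier G" using x C by auto
  have ox: "ord x = card C" using x card_powers[OF xc] by simp
  have "2 dvd ord x"
  proof -
    have "ord z = 2"
    proof -
      have "z [^] (2::nat) = \<one>" using z zc by (simp add: numeral_2_eq_2)
      then have "ord z dvd 2" using pow_eq_id zc by blast
      moreover have "ord z \<noteq> 1" using z zc ord_eq_1 by blast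
      ultimately show ?thesis by (metis prime_nat_iff two_is_prime_nat)
    qed
    then show ?thesis using ord_dvd_card[OF C zC] ox by simp
  qed
  then obtain k where k: "ord x = 2 * k" by (auto simp: dvd_def)
  have k0: "k > 0" using k ord_ge_1[OF finite_carrier xc] by simp
  have xk: "x [^] k = z"
  proof -
    have "x [^] k \<otimes> x [^] k = x [^] ord x" using xc k by (simp add: nat_pow_mult mult_2)
    then have "x [^] k \<otimes> x [^] k = \<one>" using xc by simp
    moreover have "x [^] k \<noteq> \<one>" using pow_eq_id[OF xc, of k] k k0 by (auto dest: dvd_imp_le)
    moreover have "x [^] k \<in> H" using x CH C sg_pow by blast
    ultimately show ?thesis using uniq[of "x [^] k" z] zH z by simp
  qed
  have "odd k"
  proof
    assume "even k"
    then obtain j where "k = 2 * j" by auto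
    then have "x [^] j \<otimes> x [^] j = z" using xk xc by (simp add: nat_pow_mult mult_2)
    then show False using nosq[of "x [^] j"] x C sg_pow by blast
  qed
  \<comment> \<open>\<open>x\<close> has order \<open>2 * k\<close> with \<open>k\<close> odd, so
    its square generates the odd part of \<open>C\<close>, and \<open>z\<close> supplies the
    rest.\<close>
  define y where "y = x [^] (2::nat)"
  have yc: "y \<in> carrier G" and yC: "y \<in> C" using xc x C sg_pow by (auto simp: y_def)
  have oy: "ord y = k" using ord_pow[of x 2] xc k by (simp add: y_def)
  define P where "P = powers y"
  have P: "subgroup P G" "P \<subseteq> C" "card P = k" using powers_sg[OF yc] powers_subset[OF C yC] card_powers[OF yc] oy
    by (auto simp: P_def)
  have CP: "u \<in> P \<or> z \<otimes> u \<in> P" if u: "u \<in> C" for u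
  proof -
    obtain i :: nat where i: "u = x [^] i" using u x by (auto elim: powersE)
    show ?thesis
    proof (cases "even i")
      case True
      then obtain j where "i = 2 * j" by auto
      then have "u = y [^] j" using i xc by (simp add: y_def nat_pow_pow)
      then show ?thesis by (simp add: P_def)
    next
      case False
      then obtain j where "k + i = 2 * j" using \<open>odd k\<close> by (metis even_add dvdE)
      then have "z \<otimes> u = x [^] (2 * j)" using i xk nat_pow_mult[OF xc, of k i] by simp
      then have "z \<otimes> u = y [^] j" using xc by (simp add: y_def nat_pow_pow)
      then show ?thesis by (simp add: P_def)
    qed
  qed
  have comm: "q \<otimes> u = u \<otimes> q" if q: "q \<in> Q" and u: "u \<in> P" for q u
  proof -
    have uC: "u \<in> C" using u P by auto
    have uc: "u \<in> carrier G" using u P by auto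
    have ca: "cj u a = a" "cj u b = b" using uC by (auto simp: C_def)
    have cz: "cj u z = z" using ca(1) c uc by (simp add: z_def cj_mult)
    obtain s w where sw: "q = s \<otimes> w" "s \<in> {\<one>, z}" "w \<in> {\<one>, a, b, a \<otimes> b}" using q by (auto simp: Q_def z_def)
    have "cj u w = w" using sw(3) ca c uc by (auto simp: cj_mult)
    moreover have "cj u s = s" using sw(2) cz uc by auto
    moreover have "s \<in> carrier G" "w \<in> carrier G" using sw c zc by auto
    ultimately have "cj u q = q" using sw uc by (simp add: cj_mult)
    then show ?thesis using cj_fix_iff[of u q] uc q Q(1) by auto
  qed
  have Q4: "q [^] (4::nat) = \<one>" if "q \<in> Q" for q
  proof -
    have "card Q = 8"
      using iso_same_card[OF Q(2)] by (simp add: Q8_def card_cartesian_product)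
    then have "ord q dvd 8" using ord_dvd_card[OF Q(1) that] by simp
    moreover have "q \<in> carrier G" using that Q by auto
    moreover have "ord q \<noteq> 8"
    proof
      assume "ord q = 8"
      then have "card (powers q) = card Q" using card_powers \<open>card Q = 8\<close> \<open>q \<in> carrier G\<close> by simp
      then have "powers q = Q" using sg_card_eq[OF Q(1) powers_subset[OF Q(1) that]] by simp
      then obtain i j :: nat where "a = q [^] i" "b = q [^] j" using Qm by (metis powersE)
      then have "a \<otimes> b = b \<otimes> a" using \<open>q \<in> carrier G\<close> nat_pow_comm by simp
      then show False using nab by simp
    qed
    ultimately have "ord q dvd 4"
    proof -
      assume d: "ord q dvd 8" "ord q \<noteq> 8"
      have "ord q dvd 2 ^ 3" using d by simp
      then obtain i where i: "i \<le> 3" "ord q = 2 ^ i" using divides_primepow_nat[OF two_is_prime_nat] by blast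
      have "i \<noteq> 3" using d i by auto
      then have "i \<le> 2" using i by simp
      then have "2 ^ i dvd (2::nat) ^ 2" by (rule le_imp_power_dvd)
      then show ?thesis using i by simp
    qed
    then show ?thesis using pow_eq_id \<open>q \<in> carrier G\<close> by blast
  qed
  have QP: "Q \<inter> P = {\<one>}"
  proof -
    have "u = \<one>" if "u \<in> Q" "u \<in> P" for u
    proof -
      have uc: "u \<in> carrier G" using that Q by auto
      have "ord u dvd 4" using Q4[OF that(1)] pow_eq_id[OF uc] by blast
      moreover have "ord u dvd k" using ord_dvd_card[OF P(1) that(2)] P by simp
      moreover have "coprime 4 k" using \<open>odd k\<close> coprime_power_left_iff[of 2 2 k] by simp
      ultimately have "ord u = 1" by (metis coprime_common_divisor_nat dvd_1_iff_1)
      then show ?thesis using ord_eq_1[OF uc] by simp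
    qed
    then show ?thesis using Q(1) P(1) sg_one by blast
  qed
  have "Q <#> P = H"
  proof
    show "Q <#> P \<subseteq> H" using set_mult_subset[OF H QH] P CH by auto
    show "H \<subseteq> Q <#> P"
    proof
      fix h assume h: "h \<in> H"
      have hi: "inv h \<in> H" using h H sg_inv by blast
      obtain q where q: "q \<in> Q" "inv h \<otimes> q \<in> C" using inC[OF hi] by blast
      have cc: "h \<in> carrier G" "q \<in> carrier G" using h q Hc QH by auto
      have "inv (inv h \<otimes> q) \<in> C" using C q sg_inv by blast
      then have qC: "inv q \<otimes> h \<in> C" using cc by (simp add: inv_mult_group)
      have e: "h = q \<otimes> (inv q \<otimes> h)" using cc by simp
      from CP[OF qC] show "h \<in> Q <#> P"
      proof
        assume "inv q \<otimes> h \<in> P"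
        then show ?thesis using q e mem_set_mult by metis
      next
        assume m: "z \<otimes> (inv q \<otimes> h) \<in> P"
        have "h = (q \<otimes> z) \<otimes> (z \<otimes> (inv q \<otimes> h))" using cc zc zz by (simp add: m_assoc)
        moreover have "q \<otimes> z \<in> Q" using q Qm Q(1) sg_mult by blast
        ultimately show ?thesis using m mem_set_mult by metis
      qed
    qed
  qed
  then have "int_direct G Q P H"
    unfolding int_direct_def using Q(1) P(1) comm QP by blast
  moreover have "cyclic_group (G\<lparr>carrier := P\<rparr>)" unfolding P_def by (rule cyclic_group_powers[OF yc])
  ultimately have "Q8_times_odd_cyclic G H"
    unfolding Q8_times_odd_cyclic_def using Q(2) P(3) \<open>odd k\<close> by blast
  then show ?thesis by simp
qed

end

section \<open>The Frobenius complement\<close>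

context fin_group
begin

lemma pow_coprime_mem:
  assumes C: "subgroup C G" and k: "k \<in> carrier G" and ij: "coprime i (j::nat)" "i \<noteq> 0"
    and m: "k [^] i \<in> C" "k [^] j \<in> C"
  shows "k \<in> C"
proof -
  obtain d x y where d: "d dvd i" "d dvd j" "i * x = j * y + d" using bezout_add_strong_nat[OF ij(2)] by blast
  then have "d = 1" using ij(1) by (metis coprime_common_divisor_nat dvd_1_iff_1 One_nat_def)
  then have e: "i * x = j * y + 1" using d by simp
  have "k [^] (i * x) = k [^] (j * y) \<otimes> k" using e k by simp
  moreover have "k [^] (i * x) \<in> C" "k [^] (j * y) \<in> C"
    using m C k by (simp_all add: sg_pow flip: nat_pow_pow)
  ultimately show ?thesis using sg_mult_iff1[OF C, of "k [^] (j * y)" k] k by simp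
qed

lemma cyclic_prime_ord_unique:
  assumes c: "c \<in> carrier G" and p: "prime p" and x: "x \<in> powers c" "ord x = p" and y: "y \<in> powers c" "ord y = p"
  shows "y \<in> powers x"
proof -
  have pc: "subgroup (powers c) G" using powers_sg c by blast
  have p0: "p > 0" using p prime_gt_0_nat by blast
  have "p dvd ord c" using ord_dvd_card[OF pc x(1)] x card_powers[OF c] by simp
  then obtain m where m: "ord c = p * m" by (auto simp: dvd_def)
  have m0: "m > 0" using m ord_ge_1[OF finite_carrier c] by (auto intro: gr0I)
  have mem: "u \<in> powers (c [^] m)" if u: "u \<in> powers c" "ord u = p" for u
  proof -
    have uc: "u \<in> carrier G" using u pc by auto
    obtain i :: nat where i: "u = c [^] i" using u by (auto elim: powersE)
    have "u [^] p = \<one>" using pow_ord_eq_1[OF uc] u by simp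
    then have "c [^] (i * p) = \<one>" using i c by (simp add: nat_pow_pow)
    then have "p * m dvd i * p" using pow_eq_id[OF c] m by simp
    then have "m dvd i" using p0 by (simp add: mult.commute[of i])
    then obtain j where "i = m * j" by (auto simp: dvd_def)
    then have "u = (c [^] m) [^] j" using i c by (simp add: nat_pow_pow)
    then show ?thesis by simp
  qed
  have om: "ord (c [^] m) = p" using ord_pow[of c m] c m m0 by simp
  have "x \<noteq> \<one>" using x p by auto
  then have "powers x = powers (c [^] m)" using prime_ord_powers_eq(1)[of "c [^] m" x] mem[OF x] om p c by simp
  then show ?thesis using mem[OF y] by simp
qed

text \<open>The \<open>p\<close>-group \<open>R\<close> permutes the \<open>p - 1\<close>
  non-trivial elements of \<open>powers x\<close>. As \<open>p\<close> does not divide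
  \<open>p - 1\<close>, one of them is fixed, and it generates \<open>powers x\<close>.\<close>

lemma p_group_centralizes:
  assumes p: "prime p" and x: "x \<in> carrier G" "ord x = p" and R: "subgroup R G" "card R = p ^ j"
    and nrm: "normalizes R (powers x)" and y: "y \<in> R"
  shows "cj y x = x"
proof -
  have px: "subgroup (powers x) G" using powers_sg x by blast
  have pc: "u \<in> carrier G" if "u \<in> powers x" for u using that px by auto
  have Rc: "u \<in> carrier G" if "u \<in> R" for u using that R by auto
  let ?S = "powers x - {\<one>}"
  have "p dvd card ?S \<longleftrightarrow> p dvd card {s \<in> ?S. \<forall>g\<in>R. cj g s = s}"
  proof (rule card_fixed_points_mod[OF R p])
    show "finite ?S" using px sg_finite by blast
    show "cj g s \<in> ?S" if "g \<in> R" "s \<in> ?S" for g s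
      using that nrm normalizesD Rc pc by auto
    show "cj (g \<otimes> h) s = cj g (cj h s)" if "g \<in> R" "h \<in> R" "s \<in> ?S" for g h s
      using that Rc pc by (simp add: cj_cj)
  qed (use pc in auto)
  moreover have "card ?S = p - 1" using card_powers x px sg_finite by simp
  moreover have "\<not> p dvd p - 1" using p prime_gt_1_nat[of p] by (auto dest: dvd_imp_le)
  ultimately have "{s \<in> ?S. \<forall>g\<in>R. cj g s = s} \<noteq> {}" by (metis card.empty dvd_0_right)
  then obtain u where u: "u \<in> powers x" "u \<noteq> \<one>" "\<forall>g\<in>R. cj g u = u" by blast
  have "x \<in> powers u" using prime_ord_powers_eq(1)[OF x(1) _ u(1,2)] x p by simp
  then obtain i :: nat where "x = u [^] i" by (auto elim: powersE)
  moreover have "cj y (u [^] i) = u [^] i" using cj_pow[of y u i] u y Rc pc by simp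
  ultimately show ?thesis by simp
qed

text \<open>Automorphisms of a cyclic group are power maps, so they commute.\<close>

lemma powers_comm_action:
  assumes x: "x \<in> carrier G" and a: "a \<in> carrier G" "cj a x \<in> powers x" and b: "b \<in> carrier G" "cj b x \<in> powers x"
    and n: "n \<in> powers x"
  shows "cj a (cj b n) = cj b (cj a n)"
proof -
  obtain i j k :: nat where ijk: "cj a x = x [^] i" "cj b x = x [^] j" "n = x [^] k"
    using a b n by (metis powersE)
  show ?thesis using x a b by (simp add: ijk cj_pow nat_pow_pow mult.commute mult.left_commute)
qed

end

section \<open>Structure of a non-abelian complement\<close>

locale frob_TI_nonab = frob_TI +
  assumes K_nonab: "nonabelian G K" and p_dvd_K: "p dvd card K"
begin

lemma ex_x: obtains x where "x \<in> K" "ord x = p"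
  using cauchy[OF K_sg prime_p p_dvd_K] by metis

lemma N_comm: "m \<in> N \<Longrightarrow> n \<in> N \<Longrightarrow> m \<otimes> n = n \<otimes> m"
  using ex_x kernel_abelian by metis

lemma ex_n: obtains n where "n \<in> N" "n \<noteq> \<one>"
  using N_nontrivial sg_one[OF ker_sg] by blast

lemma KN: "k \<in> K \<Longrightarrow> n \<in> N \<Longrightarrow> cj k n \<in> N"
  using Y_normalizes_N K_sub normalizesD by blast

lemma fixed_point_free': "k \<in> K \<Longrightarrow> n \<in> N \<Longrightarrow> n \<noteq> \<one> \<Longrightarrow> cj k n = n \<Longrightarrow> k = \<one>"
  using fixed_point_free by blast

text \<open>The element \<open>inv (h \<otimes> g) \<otimes> (g \<otimes> h)\<close> of
  \<open>K\<close> fixes the non-trivial \<open>n\<close>, hence is trivial.\<close>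

lemma commute_if_actions_commute:
  assumes "g \<in> K" "h \<in> K" "n \<in> N" "n \<noteq> \<one>" "cj g (cj h n) = cj h (cj g n)"
  shows "g \<otimes> h = h \<otimes> g"
proof -
  have c: "g \<in> carrier G" "h \<in> carrier G" "n \<in> carrier G" using assms Kc Nc by auto
  have "cj (inv (h \<otimes> g) \<otimes> (g \<otimes> h)) n = cj (inv (h \<otimes> g)) (cj (g \<otimes> h) n)"
    using c cj_cj[of "inv (h \<otimes> g)" "g \<otimes> h" n] by simp
  also have "cj (g \<otimes> h) n = cj (h \<otimes> g) n" using assms(5) c by (simp add: cj_cj)
  also have "cj (inv (h \<otimes> g)) (cj (h \<otimes> g) n) = n" using c by simp
  finally have "inv (h \<otimes> g) \<otimes> (g \<otimes> h) = \<one>"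
    using fixed_point_free'[OF _ assms(3,4)] assms(1,2) K_sg by (simp add: sg_mult sg_inv)
  then show ?thesis using c by (metis inv_equality inv_inv inv_closed m_closed)
qed

text \<open>The product \<open>T\<close> of \<open>N\<close> and \<open>U\<close> is non-abelian. If
  it is TI, then it is normal, because all of \<open>Y\<close> normalizes the part \<open>N\<close>;
  so it is subnormal in either case, and intersecting the chain with \<open>K\<close> gives
  \<open>U\<close>.\<close>

lemma complement_subnormal:
  assumes U: "subgroup U G" "U \<subseteq> K" "p dvd card U"
  shows "snrm K U"
proof -
  define T where "T = N <#> U"
  have nU: "normalizes U N" using normalizes_mono[OF Y_normalizes_N] U K_sub by blast
  have T: "subgroup T G" unfolding T_def using subgroup_set_mult[OF ker_sg U(1) nU] .
  have NT: "N \<subseteq> T" and UT: "U \<subseteq> T" unfolding T_def using subset_set_mult1[OF ker_sg U(1)] subset_set_mult2[OF ker_sg U(1)] .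
  have TY: "T \<subseteq> Y" unfolding T_def using set_mult_subset[OF Y_sg N_sub] U K_sub by blast
  obtain u where u: "u \<in> U" "ord u = p" using cauchy[OF U(1) prime_p U(3)] by metis
  obtain n where n: "n \<in> N" "n \<noteq> \<one>" using ex_n by metis
  have "u \<noteq> \<one>" using u prime_p by auto
  then have "cj u n \<noteq> n" using fixed_point_free[of u n] u U n by blast
  then have "u \<otimes> n \<noteq> n \<otimes> u" using cj_fix_iff[of u n] u U Kc Nc n by auto
  then have "nonabelian G T" using nonabelianI[of u T n] u n NT UT by blast
  moreover have "p dvd card T" using U(3) sg_card_dvd[OF U(1) T UT] by (rule dvd_trans)
  ultimately have "ti Y T \<or> snrm Y T" using hypD[OF hypY T TY] by blast
  moreover have "snrm Y T" if t: "ti Y T"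
  proof -
    have "normalizes Y T"
      unfolding normalizes_def
    proof (intro ballI)
      fix g v assume "g \<in> Y" "v \<in> T"
      then show "cj g v \<in> T" using tiD[OF t, of g n v] n NT normalizesD[OF Y_normalizes_N, of g n] by blast
    qed
    then show ?thesis using snrm_step[OF snrm_top T TY] by blast
  qed
  ultimately have "snrm Y T" by blast
  then have "snrm (Y \<inter> K) (T \<inter> K)" using snrm_Int[OF _ K_sg] by blast
  moreover have "Y \<inter> K = K" using K_sub by blast
  moreover have "T \<inter> K = U"
  proof -
    have "v \<in> U" if v: "v \<in> T" "v \<in> K" for v
    proof -
      obtain n' u' where nu: "n' \<in> N" "u' \<in> U" "v = n' \<otimes> u'" using v by (auto simp: T_def mem_set_mult)
      have "n' \<in> K" using sg_mult_iff2[OF K_sg, of u' n'] nu v U Nc by auto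
      then have "n' = \<one>" using nu N_Int_K by blast
      then show ?thesis using nu U by auto
    qed
    then show ?thesis using UT U by blast
  qed
  ultimately show ?thesis by simp
qed

text \<open>A subnormal subgroup of \<open>Y\<close> meeting \<open>K\<close> non-trivially contains
  \<open>N\<close>, which a subgroup of \<open>K\<close> cannot.\<close>

lemma complement_TI:
  assumes U: "subgroup U G" "U \<subseteq> K" "p dvd card U" "nonabelian G U"
  shows "ti Y U"
proof -
  have "\<not> snrm Y U"
  proof
    assume s: "snrm Y U"
    obtain u where u: "u \<in> U" "ord u = p" using cauchy[OF U(1) prime_p U(3)] by metis
    have "u \<noteq> \<one>" using u prime_p by auto
    then have "N \<subseteq> U" using subnormal_contains_N[OF s, of u] u U by blast
    then show False using U(2) N_Int_K N_nontrivial by blast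
  qed
  then show ?thesis using hypD[OF hypY U(1) _ U(4,3)] U(2) K_sub by blast
qed

context
  fixes x assumes x: "x \<in> K" "ord x = p"
begin

lemma xc: "x \<in> carrier G"
  using x Kc by blast

lemma x_ne: "x \<noteq> \<one>"
  using x prime_p by auto

lemma P_sg: "subgroup (powers x) G" and P_sub: "powers x \<subseteq> K" and x_P: "x \<in> powers x" and P_card: "card (powers x) = p"
  using powers_sg[OF xc] powers_subset[OF K_sg x(1)] xc card_powers[OF xc] x by auto

lemma P_irr_action: "irr_action G (powers x) N"
proof (rule irr_action.intro[OF fin_group_axioms], rule irr_action_axioms.intro)
  show "cj a n \<in> N" if "a \<in> powers x" "n \<in> N" for a n using that P_sub KN by blast
  show "cj a (cj b n) = cj b (cj a n)" if "a \<in> powers x" "b \<in> powers x" "n \<in> N" for a b n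
  proof -
    obtain i j :: nat where "a = x [^] i" "b = x [^] j"
      using \<open>a \<in> powers x\<close> \<open>b \<in> powers x\<close> by (auto elim!: powersE)
    then show ?thesis using xc Nc[OF that(3)] by (simp add: cj_cj nat_pow_mult add.commute)
  qed
  show "D = {\<one>} \<or> D = N"
    if "subgroup D G" "D \<subseteq> N" "\<And>a d. a \<in> powers x \<Longrightarrow> d \<in> D \<Longrightarrow> cj a d \<in> D" for D
    using kernel_irreducible[OF x that(1,2)] that(3)[OF x_P] by blast
  show "m \<otimes> n = n \<otimes> m" if "m \<in> N" "n \<in> N" for m n using that by (rule N_comm)
qed (rule P_sg ker_sg N_nontrivial)+

definition C where "C = {k \<in> K. cj k x = x}"

lemma C_sg: "subgroup C G"
  unfolding C_def by (rule subgroup_centralizer[OF K_sg xc])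

lemma C_sub: "C \<subseteq> K"
  by (auto simp: C_def)

text \<open>Elements centralizing \<open>x\<close> act on \<open>N\<close> in the commutant of the
  irreducible action of \<open>powers x\<close>, where they commute by
  \<open>commutant_commutative\<close>; the absence of fixed points lifts this to
  \<open>K\<close>.\<close>

lemma C_comm:
  assumes "g \<in> C" "h \<in> C"
  shows "g \<otimes> h = h \<otimes> g"
proof -
  interpret I: irr_action G "powers x" N by (rule P_irr_action)
  obtain n where n: "n \<in> N" "n \<noteq> \<one>" using ex_n by metis
  have gK: "k \<in> K" "k \<in> carrier G" if "k \<in> C" for k using that C_sub Kc by auto
  have cA: "cj k (cj a m) = cj a (cj k m)" if k: "k \<in> C" and a: "a \<in> powers x" and m: "m \<in> N" for k a m
  proof -
    obtain i :: nat where i: "a = x [^] i" using a by (auto elim: powersE)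
    have "k \<otimes> x = x \<otimes> k" using k gK[OF k] xc by (simp add: C_def cj_fix_iff)
    then have "x [^] i \<otimes> k = k \<otimes> x [^] i" using group_commutes_pow[of x k i] gK[OF k] xc by simp
    then show ?thesis using gK[OF k] xc Nc[OF m] by (simp add: cj_cj i)
  qed
  have "cj g (cj h n) = cj h (cj g n)"
    using I.commutant_commutative[of g h n] gK assms KN cA n by blast
  then show ?thesis using commute_if_actions_commute[OF _ _ n] gK assms by blast
qed

lemma C_cyclic: obtains c where "c \<in> C" "C = powers c"
  by (rule abelian_fpf_cyclic[OF C_sg C_comm ker_sg N_nontrivial N_comm]) (use C_sub KN fixed_point_free' in blast)+

lemma x_C: "x \<in> C"
  using x xc by (simp add: C_def cj_fix_iff)

lemma C_ord_p: "y \<in> C \<Longrightarrow> ord y = p \<Longrightarrow> y \<in> powers x"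
  using C_cyclic cyclic_prime_ord_unique[OF _ prime_p] x_C x(2) C_sg by (metis sgD)

text \<open>An element of order \<open>p\<close> normalizing \<open>powers x\<close> centralizes
  \<open>x\<close>, so it lies in the cyclic group \<open>C\<close>, which has only one subgroup of
  order \<open>p\<close>.\<close>

lemma normalizer_ord_p:
  assumes y: "y \<in> K" "ord y = p" and n: "\<And>u. u \<in> powers x \<Longrightarrow> cj y u \<in> powers x"
  shows "y \<in> powers x"
proof -
  have yc: "y \<in> carrier G" using y Kc by blast
  have "cj y x = x"
    using p_group_centralizes[OF prime_p xc x(2) powers_sg[OF yc], of 1 y] card_powers[OF yc] y
      normalizes_powers[OF yc P_sg n] yc by simp
  then show ?thesis using C_ord_p y by (simp add: C_def)
qed

lemma K_normalizes_P: "normalizes K (powers x)"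
proof -
  \<comment> \<open>The induction starts at the top of the chain, so the claim is an implication
    that climbs. If \<open>H\<close> normalizes \<open>powers x\<close> and
    \<open>g \<in> L\<close>, then \<open>cj g x\<close> is an element of order \<open>p\<close> in
    \<open>H\<close>, and \<open>normalizer_ord_p\<close> puts it into
    \<open>powers x\<close>.\<close>
  have "normalizes L (powers x) \<longrightarrow> powers x \<subseteq> L \<longrightarrow> normalizes K (powers x)" if "snrm K L" for L
    using that
  proof (induction rule: snrm.induct)
    case (snrm_step L H)
    have LK: "subgroup L G" "L \<subseteq> K"
    proof -
      show "subgroup L G" using snrm_sg[OF snrm_step.hyps(1) K_sg] .
      show "L \<subseteq> K" using snrm_step.hyps(1) by (induction rule: snrm.induct) auto
    qed
    show ?case
    proof (intro impI)
      assume a: "normalizes H (powers x)" "powers x \<subseteq> H"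
      have Lx: "cj g x \<in> powers x" if g: "g \<in> L" for g
      proof -
        have gc: "g \<in> carrier G" using g LK by auto
        have H: "cj g x \<in> H" using snrm_step.hyps(4) g a x_P normalizesD by blast
        have "ord (cj g x) = ord x"
        proof -
          have "cj g x [^] n = \<one> \<longleftrightarrow> x [^] n = \<one>" for n :: nat using gc xc by (simp flip: cj_pow)
          then show ?thesis using ord_unique[of "cj g x" "ord x"] gc xc pow_eq_id[OF xc] by simp
        qed
        then show ?thesis
          using normalizer_ord_p[of "cj g x"] H snrm_step.hyps(3) LK a(1) x normalizesD by blast
      qed
      have "cj g u \<in> powers x" if "g \<in> L" "u \<in> powers x" for g u
      proof -
        obtain i :: nat where "u = x [^] i" using \<open>u \<in> powers x\<close> by (auto elim: powersE)
        then have "cj g u = cj g x [^] i" using cj_pow[OF sgD[OF LK(1) that(1)] xc] by simp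
        then show ?thesis using sg_pow[OF P_sg Lx[OF that(1)]] by simp
      qed
      then have "normalizes L (powers x)" by (simp add: normalizes_def)
      then show "normalizes K (powers x)" using snrm_step.IH a(2) snrm_step.hyps(3) by blast
    qed
  qed simp
  then show ?thesis
    using complement_subnormal[OF P_sg P_sub] P_card normalizes_self[OF P_sg] by simp
qed

lemma ord_p_in_P: "y \<in> K \<Longrightarrow> ord y = p \<Longrightarrow> y \<in> powers x"
  using normalizer_ord_p normalizesD[OF K_normalizes_P] by blast

lemma pow_p_in_P: "y \<in> K \<Longrightarrow> y [^] p = \<one> \<Longrightarrow> y \<in> powers x"
proof -
  assume y: "y \<in> K" "y [^] p = \<one>"
  then have yc: "y \<in> carrier G" using Kc by blast
  have "ord y dvd p" using y pow_eq_id[OF yc] by blast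
  then have "ord y = 1 \<or> ord y = p" using prime_p by (metis prime_nat_iff)
  then show ?thesis using ord_p_in_P y ord_eq_1[OF yc] by auto
qed

lemma p_group_in_C: "subgroup R G \<Longrightarrow> R \<subseteq> K \<Longrightarrow> card R = p ^ j \<Longrightarrow> R \<subseteq> C"
  using p_group_centralizes[OF prime_p xc x(2)] normalizes_mono[OF K_normalizes_P] by (auto simp: C_def)

lemma C_normal: "g \<in> K \<Longrightarrow> h \<in> C \<Longrightarrow> cj g h \<in> C"
proof -
  assume g: "g \<in> K" and h: "h \<in> C"
  have c: "g \<in> carrier G" "h \<in> carrier G" "h \<in> K" using g h C_sub Kc by auto
  have gi: "inv g \<in> K" using g K_sg sg_inv by blast
  have "cj (inv g) x \<in> powers x" using K_normalizes_P gi x_P normalizesD by blast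
  then obtain i :: nat where i: "cj (inv g) x = x [^] i" by (metis powersE)
  have "cj (cj g h) x = cj g (cj h (cj (inv g) x))" using c xc by (simp add: cj_cj) (simp add: cj_def m_assoc)
  also have "cj h (cj (inv g) x) = cj (inv g) x" using i h c xc cj_pow[of h x i] by (simp add: C_def)
  finally have "cj (cj g h) x = x" using c xc by simp
  then show ?thesis using cj_mem[OF K_sg g c(3)] by (simp add: C_def)
qed

lemma C_proper: obtains k where "k \<in> K" "k \<notin> C"
proof -
  have "K \<noteq> C"
  proof
    assume "K = C"
    then have "\<not> nonabelian G K" using C_comm by (auto simp: nonabelian_def)
    then show False using K_nonab by simp
  qed
  then show ?thesis using that C_sub by blast
qed

text \<open>A normal subgroup of order 2 is central, so \<open>p = 2\<close> would give
  \<open>K = C\<close>, which is abelian.\<close>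

lemma p_gt_2: "p > 2"
proof -
  have "p \<noteq> 2"
  proof
    assume p2: "p = 2"
    have "k \<in> C" if k: "k \<in> K" for k
    proof -
      have "cj k x \<in> powers x" using K_normalizes_P k x_P normalizesD by blast
      then obtain i :: nat where i: "cj k x = x [^] i" by (metis powersE)
      have x2: "x [^] (2::nat) = \<one>" using pow_ord_eq_1[OF xc] x p2 by simp
      have "odd i"
      proof
        assume "even i"
        then obtain j where "i = 2 * j" by auto
        then have "x [^] i = \<one>" using x2 xc by (simp flip: nat_pow_pow)
        then show False using i k x_ne xc Kc by simp
      qed
      then obtain j where "i = 2 * j + 1" by (auto elim: oddE)
      then have "x [^] i = (x [^] (2::nat)) [^] j \<otimes> x" using xc by (simp add: nat_pow_pow)
      then show ?thesis using i k x2 xc by (simp add: C_def)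
    qed
    then show False using C_proper by metis
  qed
  then show ?thesis using prime_p prime_ge_2_nat by (metis le_neq_implies_less)
qed

text \<open>The product of \<open>powers x\<close> and \<open>powers k\<close> is non-abelian, hence
  TI. Every \<open>g \<in> K\<close> keeps \<open>x\<close> inside it and therefore normalizes
  it.\<close>

lemma noncentral_normal:
  assumes k: "k \<in> K" "k \<notin> C" and g: "g \<in> K" and u: "u \<in> powers x <#> powers k"
  shows "cj g u \<in> powers x <#> powers k"
proof -
  have kc: "k \<in> carrier G" using k Kc by blast
  define U where "U = powers x <#> powers k"
  have pk: "subgroup (powers k) G" "powers k \<subseteq> K" using powers_sg[OF kc] powers_subset[OF K_sg k(1)] by auto
  have U: "subgroup U G" unfolding U_def
    using subgroup_set_mult[OF P_sg pk(1) normalizes_mono[OF K_normalizes_P pk(2)]] .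
  have UK: "U \<subseteq> K" unfolding U_def using set_mult_subset[OF K_sg P_sub pk(2)] .
  have m: "powers x \<subseteq> U" "powers k \<subseteq> U" unfolding U_def
    using subset_set_mult1[OF P_sg pk(1)] subset_set_mult2[OF P_sg pk(1)] .
  have "cj k x \<noteq> x" using k by (simp add: C_def)
  then have "k \<otimes> x \<noteq> x \<otimes> k" using kc xc by (simp add: cj_fix_iff)
  then have "nonabelian G U" using nonabelianI[of k U x] m x_P self_mem_powers[OF kc] by blast
  moreover have "p dvd card U" using sg_card_dvd[OF P_sg U m(1)] P_card by simp
  ultimately have "ti Y U" using complement_TI[OF U UK] by blast
  moreover have "cj g x \<in> U" using K_normalizes_P g x_P normalizesD m(1) by blast
  ultimately show ?thesis using tiD[of Y U g x u] g K_sub m(1) x_P x_ne u unfolding U_def by blast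
qed

text \<open>If \<open>p\<^sup>2\<close> divided \<open>|K|\<close>, a \<open>p'\<close>-element \<open>k\<close> outside \<open>C\<close> would act on a cyclic group of order
  \<open>p\<^sup>2\<close> trivially modulo its subgroup of order \<open>p\<close>, hence trivially on that subgroup.\<close>

lemma p_square: "\<not> p ^ 2 dvd card K"
proof
  assume p2: "p ^ 2 dvd card K"
  define e where "e = multiplicity p (card K)"
  have cK: "card K \<noteq> 0" using sg_card_pos[OF K_sg] by simp
  have pu: "\<not> is_unit p" using prime_p not_prime_unit by blast
  have e2: "e \<ge> 2" using p2 cK pu unfolding e_def by (simp add: power_dvd_iff_le_multiplicity)
  obtain m where m: "card K = p ^ e * m" "\<not> p dvd m"
    using multiplicity_decompose'[of "card K" p] cK pu unfolding e_def by metis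
  obtain R where R: "subgroup R G" "R \<subseteq> K" "card R = p ^ e" using sylow_exists[OF K_sg prime_p] e_def by metis
  have RC: "R \<subseteq> C" using p_group_in_C[OF R] .
  obtain c where c: "c \<in> C" "C = powers c" using C_cyclic by metis
  have cc: "c \<in> carrier G" using c C_sg by auto
  have "p ^ e dvd ord c" using sg_card_dvd[OF R(1) C_sg RC] R(3) c card_powers[OF cc] by simp
  then have "p ^ 2 dvd ord c" using e2 by (meson dvd_trans le_imp_power_dvd)
  then obtain t where t: "ord c = p ^ 2 * t" by (auto simp: dvd_def)
  have t0: "t > 0" using t ord_ge_1[OF finite_carrier cc] by (auto intro: gr0I)
  define y where "y = c [^] t"
  have yC: "y \<in> C" unfolding y_def using c C_sg sg_pow by blast
  have yK: "y \<in> K" and yc: "y \<in> carrier G" using yC C_sub Kc by auto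
  have oy: "ord y = p ^ 2" using ord_pow[of c t] cc t t0 by (simp add: y_def)
  obtain k0 where k0: "k0 \<in> K" "k0 \<notin> C" using C_proper by metis
  have k0c: "k0 \<in> carrier G" using k0 Kc by blast
  \<comment> \<open>The \<open>p'\<close>-part of \<open>k0\<close>. The \<open>p\<close>-part
    \<open>k0 [^] m\<close> generates a \<open>p\<close>-group and so lies in \<open>C\<close>; if
    \<open>k\<close> did as well, so would \<open>k0\<close>.\<close>
  define k where "k = k0 [^] (p ^ e)"
  have kK: "k \<in> K" and kc: "k \<in> carrier G" using k0 K_sg sg_pow Kc by (auto simp: k_def)
  have km: "k [^] m = \<one>" using sg_pow_card[OF K_sg k0(1)] m k0c by (simp add: k_def nat_pow_pow)
  have "k0 [^] m \<in> C"
  proof -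
    have "(k0 [^] m) [^] (p ^ e) = \<one>" using sg_pow_card[OF K_sg k0(1)] m k0c by (simp add: nat_pow_pow mult.commute)
    then have "ord (k0 [^] m) dvd p ^ e" using pow_eq_id k0c by blast
    then obtain j where "ord (k0 [^] m) = p ^ j" using divides_primepow_nat[OF prime_p] by blast
    then have "powers (k0 [^] m) \<subseteq> C"
      using p_group_in_C[of "powers (k0 [^] m)" j] powers_sg card_powers powers_subset[OF K_sg] k0 k0c K_sg sg_pow by simp
    then show ?thesis using k0c by auto
  qed
  moreover have "coprime (p ^ e) m" using m(2) prime_p by (simp add: prime_imp_coprime)
  moreover have "p ^ e \<noteq> 0" using prime_p by auto
  ultimately have kC: "k \<notin> C" using pow_coprime_mem[OF C_sg k0c] k0(2) unfolding k_def by blast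
  define v where "v = cj y k \<otimes> inv k"
  define U where "U = powers x <#> powers k"
  have pk: "subgroup (powers k) G" "powers k \<subseteq> K" using powers_sg[OF kc] powers_subset[OF K_sg kK] by auto
  have U: "subgroup U G" unfolding U_def
    using subgroup_set_mult[OF P_sg pk(1) normalizes_mono[OF K_normalizes_P pk(2)]] .
  have kU: "k \<in> U" unfolding U_def using subset_set_mult2[OF P_sg pk(1)] kc by auto
  have "cj y k \<in> U" using noncentral_normal[OF kK kC yK] kU unfolding U_def by blast
  then have vU: "v \<in> U" unfolding v_def using U kU by (simp add: sg_mult sg_inv)
  have ve: "v = y \<otimes> cj k (inv y)" using yc kc by (simp add: v_def cj_def m_assoc)
  have kyC: "cj k (inv y) \<in> C" using C_normal[OF kK sg_inv[OF C_sg yC]] .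
  have vC: "v \<in> C" using ve C_sg yC kyC sg_mult by simp
  have vc: "v \<in> carrier G" using vC C_sg by auto
  have "v [^] (p ^ 2) = y [^] (p ^ 2) \<otimes> cj k (inv y) [^] (p ^ 2)"
    using ve pow_mult_distrib[OF C_comm[OF yC kyC]] yc kc by simp
  also have "\<dots> = \<one>"
    using pow_ord_eq_1[OF yc] oy yc kc by (simp add: nat_pow_inv flip: cj_pow)
  finally have ov: "ord v dvd p ^ 2" using pow_eq_id[OF vc] by blast
  \<comment> \<open>The order of \<open>U\<close> divides \<open>p * ord k\<close>, hence
    \<open>p * m\<close>. As the order of \<open>v\<close> also divides \<open>p ^ 2\<close> while
    \<open>p\<close> does not divide \<open>m\<close>, it divides \<open>p\<close>.\<close>
  have "card U * card (powers x \<inter> powers k) = p * ord k"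
    using card_set_mult_Int[OF P_sg pk(1)] P_card card_powers[OF kc] by (simp add: U_def)
  then have "ord v dvd p * ord k" using ord_dvd_card[OF U vU] by (metis dvd_mult2)
  then have "ord v dvd p * m" using km pow_eq_id[OF kc] by (meson dvd_trans mult_dvd_mono dvd_refl)
  moreover obtain j where j: "ord v = p ^ j" using ov divides_primepow_nat[OF prime_p] by blast
  ultimately have vp: "v [^] p = \<one>"
  proof -
    assume d: "ord v dvd p * m"
    have "j \<le> 1"
    proof (rule ccontr)
      assume "\<not> j \<le> 1"
      then have "p ^ 2 dvd ord v" using j by (simp add: le_imp_power_dvd)
      then have "p * p dvd p * m" using d by (metis dvd_trans power2_eq_square)
      then show False using m(2) prime_p by auto
    qed
    then have "ord v dvd p" using j by (cases j) auto
    then show ?thesis using pow_eq_id[OF vc] by blast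
  qed
  \<comment> \<open>So \<open>k\<close> changes \<open>y\<close> by an element of order dividing
    \<open>p\<close>, and \<open>k\<close> fixes \<open>y [^] p\<close>, a generator of
    \<open>powers x\<close>.\<close>
  have "cj k y = inv (cj k (inv y))" using kc yc by (simp add: cj_inv)
  also have "cj k (inv y) = inv y \<otimes> v" using ve yc kc by simp
  also have "inv (inv y \<otimes> v) = inv v \<otimes> y" using yc vc by (simp add: inv_mult_group)
  finally have "cj k (y [^] p) = (inv v \<otimes> y) [^] p" using kc yc by (simp add: cj_pow)
  also have "\<dots> = inv v [^] p \<otimes> y [^] p"
    using pow_mult_distrib[OF C_comm[OF sg_inv[OF C_sg vC] yC]] yc vc by simp
  also have "\<dots> = y [^] p" using vp vc yc by (simp add: nat_pow_inv)
  finally have fx: "cj k (y [^] p) = y [^] p" .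
  have oyp: "ord (y [^] p) = p"
    using ord_pow[of y p] yc oy prime_p prime_gt_0_nat[OF prime_p] by (simp add: power2_eq_square)
  then have yP: "y [^] p \<in> powers x" using ord_p_in_P sg_pow[OF K_sg yK] by blast
  have "y [^] p \<noteq> \<one>" using oyp prime_p by auto
  then have "x \<in> powers (y [^] p)" using prime_ord_powers_eq(1)[OF xc _ yP] x prime_p x_P by simp
  then obtain i :: nat where "x = (y [^] p) [^] i" by (metis powersE)
  then have "cj k x = x" using fx cj_pow[of k "y [^] p" i] kc yc by simp
  then show False using kC kK by (simp add: C_def)
qed

text \<open>\<open>H\<close> is generated by the \<open>p'\<close>-part \<open>D\<close> of the
  cyclic group \<open>C\<close> and a \<open>p'\<close>-element \<open>k\<close> inducing the same
  automorphisms of \<open>powers x\<close> as all of \<open>K\<close>. Any \<open>b \<in> K\<close>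
  agrees with a power of \<open>k\<close> up to an element of \<open>C\<close>, which is the product
  of \<open>powers x\<close> and \<open>D\<close>.\<close>

lemma complement_structure:
  obtains H where "subgroup H G" "H \<subseteq> K" "powers x \<inter> H = {\<one>}" "powers x <#> H = K"
    "\<exists>h\<in>H. x \<otimes> h \<noteq> h \<otimes> x" "\<And>g h. g \<in> H \<Longrightarrow> h \<in> H \<Longrightarrow> cj g h \<in> powers h"
proof -
  obtain m where m: "card K = p * m" using p_dvd_K by (auto simp: dvd_def)
  have pm: "\<not> p dvd m" using p_square m by (auto simp: power2_eq_square dvd_def)
  have p0: "p \<noteq> 0" using prime_p by auto
  interpret I: irr_action G K "powers x"
  proof (rule irr_action.intro[OF fin_group_axioms], rule irr_action_axioms.intro)
    show "m \<otimes> n = n \<otimes> m" if "m \<in> powers x" "n \<in> powers x" for m n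
    proof -
      obtain i j :: nat where "m = x [^] i" "n = x [^] j"
        using \<open>m \<in> powers x\<close> \<open>n \<in> powers x\<close> by (auto elim!: powersE)
      then show ?thesis using xc by (simp add: nat_pow_mult add.commute)
    qed
    show "powers x \<noteq> {\<one>}" using x_P x_ne by blast
    show "cj a n \<in> powers x" if "a \<in> K" "n \<in> powers x" for a n using that K_normalizes_P normalizesD by blast
    show "cj a (cj b n) = cj b (cj a n)" if "a \<in> K" "b \<in> K" "n \<in> powers x" for a b n
      using powers_comm_action[OF xc] that Kc K_normalizes_P normalizesD x_P by blast
    show "D = {\<one>} \<or> D = powers x" if D: "subgroup D G" "D \<subseteq> powers x" for D
    proof (cases "x \<in> D")
      case True
      then show ?thesis using powers_subset[OF D(1)] D(2) by blast
    next
      case False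
      then show ?thesis using prime_card_trivial_Int[OF xc _ D(1)] x prime_p D(2) by (simp add: Int_absorb1)
    qed
  qed (rule K_sg P_sg)+
  obtain k0 where k0: "k0 \<in> K" "\<And>b. b \<in> K \<Longrightarrow> \<exists>i::nat. \<forall>n\<in>powers x. cj b n = cj (k0 [^] i) n"
    using I.action_cyclic by metis
  have k0c: "k0 \<in> carrier G" using k0 Kc by blast
  obtain d r s where d: "d dvd p" "d dvd m" "p * r = m * s + d" using bezout_add_strong_nat[OF p0] by blast
  have "d = 1" using d pm prime_p by (metis prime_nat_iff)
  then have rs: "p * r = m * s + 1" using d by simp
  \<comment> \<open>By the Bezout relation \<open>rs\<close>, powers of \<open>k\<close> and of
    \<open>k0\<close> differ only by powers of \<open>k0 [^] m\<close>, which lies in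
    \<open>powers x\<close> and acts trivially there. So \<open>k\<close> induces the same
    automorphisms and has order dividing \<open>m\<close>.\<close>
  define k where "k = k0 [^] p"
  have kK: "k \<in> K" and kc: "k \<in> carrier G" using k0 K_sg sg_pow Kc by (auto simp: k_def)
  have Km: "y [^] (p * m) = \<one>" if "y \<in> K" for y using sg_pow_card[OF K_sg that] m by simp
  have km: "k [^] m = \<one>" using Km[OF k0(1)] k0c by (simp add: k_def nat_pow_pow)
  have mP: "y [^] m \<in> powers x" if "y \<in> K" for y
    using pow_p_in_P[OF sg_pow[OF K_sg that, of m]] Km[OF that] Kc[OF that] by (simp add: nat_pow_pow mult.commute)
  have P_C: "powers x \<subseteq> C" using powers_subset[OF C_sg x_C] .
  have kact: "\<exists>j::nat. cj b x = cj (k [^] j) x" if b: "b \<in> K" for b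
  proof -
    obtain i :: nat where i: "cj b x = cj (k0 [^] i) x" using k0(2)[OF b] x_P by blast
    have "k [^] (r * i) = k0 [^] (p * r * i)" using k0c by (simp add: k_def nat_pow_pow mult.assoc)
    also have "p * r * i = i + m * (s * i)" using rs by (simp add: algebra_simps)
    finally have "k [^] (r * i) = k0 [^] i \<otimes> (k0 [^] m) [^] (s * i)" using k0c by (simp add: nat_pow_mult nat_pow_pow)
    moreover have "cj ((k0 [^] m) [^] (s * i)) x = x"
    proof -
      have "(k0 [^] m) [^] (s * i) \<in> C" using mP[OF k0(1)] P_C C_sg sg_pow by blast
      then show ?thesis by (simp add: C_def)
    qed
    ultimately have "cj (k [^] (r * i)) x = cj (k0 [^] i) x" using k0c xc by (simp flip: cj_cj)
    then show ?thesis using i by metis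
  qed
  define D where "D = {c \<in> C. c [^] m = \<one>}"
  have Cc: "c \<in> carrier G" if "c \<in> C" for c using that C_sg by auto
  have D: "subgroup D G"
  proof (rule finite_subgroupI)
    show "u \<otimes> v \<in> D" if "u \<in> D" "v \<in> D" for u v
      using that C_sg Cc pow_mult_distrib[OF C_comm[of u v]] by (auto simp: D_def sg_mult)
  qed (use Cc C_sg in \<open>auto simp: D_def sg_one\<close>)
  have DK: "D \<subseteq> K" using C_sub by (auto simp: D_def)
  have Dn: "cj g u \<in> D" if "g \<in> K" "u \<in> D" for g u
    using that C_normal Cc Kc by (auto simp: D_def simp flip: cj_pow)
  define H where "H = D <#> powers k"
  have pk: "subgroup (powers k) G" "powers k \<subseteq> K" using powers_sg[OF kc] powers_subset[OF K_sg kK] by auto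
  have H: "subgroup H G" unfolding H_def
    using subgroup_set_mult[OF D pk(1)] Dn pk(2) by (auto simp: normalizes_def)
  have HK: "H \<subseteq> K" unfolding H_def using set_mult_subset[OF K_sg DK pk(2)] .
  have DH: "D \<subseteq> H" and kH: "k \<in> H" unfolding H_def
    using subset_set_mult1[OF D pk(1)] subset_set_mult2[OF D pk(1)] kc by auto
  have pH: "\<not> p dvd card H"
  proof
    assume "p dvd card H"
    moreover have "card H * card (D \<inter> powers k) = card D * ord k"
      using card_set_mult_Int[OF D pk(1)] card_powers[OF kc] by (simp add: H_def)
    ultimately have "p dvd card D * ord k" by (metis dvd_mult2)
    then have "p dvd card D \<or> p dvd ord k" using prime_p by (simp add: prime_dvd_mult_iff)
    then show False
    proof
      assume "p dvd card D"
      then obtain u where u: "u \<in> D" "ord u = p" using cauchy[OF D prime_p] by metis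
      then have "p dvd m" using pow_eq_id[of u m] Cc by (auto simp: D_def)
      then show False using pm by simp
    next
      assume "p dvd ord k"
      then show False using km pow_eq_id[OF kc] pm dvd_trans by blast
    qed
  qed
  have xH: "x \<notin> H" using ord_dvd_card[OF H, of x] x pH by auto
  have PH: "powers x \<inter> H = {\<one>}" using prime_card_trivial_Int[OF xc _ H xH] x prime_p by simp
  have PHK: "powers x <#> H = K"
  proof
    show "powers x <#> H \<subseteq> K" using set_mult_subset[OF K_sg P_sub HK] .
    show "K \<subseteq> powers x <#> H"
    proof
      fix b assume b: "b \<in> K"
      have bc: "b \<in> carrier G" using b Kc by blast
      obtain j :: nat where j: "cj b x = cj (k [^] j) x" using kact[OF b] by blast
      define c where "c = inv (k [^] j) \<otimes> b"
      have "cj c x = x" using j bc kc xc by (simp add: c_def flip: cj_cj)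
      moreover have "c \<in> K" using b kK K_sg by (simp add: c_def sg_mult sg_inv sg_pow)
      ultimately have cC: "c \<in> C" by (simp add: C_def)
      have cc: "c \<in> carrier G" using Cc cC by blast
      \<comment> \<open>The relation \<open>p * r = m * s + 1\<close> splits \<open>c\<close> into
        its \<open>p'\<close>-part \<open>v\<close> and its \<open>p\<close>-part
        \<open>w\<close>.\<close>
      define v where "v = c [^] (p * r)"
      define w where "w = inv (c [^] (m * s))"
      have vw: "c = w \<otimes> v"
      proof -
        have "v = c [^] (m * s) \<otimes> c" using rs cc by (simp add: v_def)
        then show ?thesis using cc by (simp add: w_def)
      qed
      have vD: "v \<in> D"
      proof -
        have "v [^] m = (c [^] (p * m)) [^] r" using cc by (simp add: v_def nat_pow_pow ac_simps)
        then show ?thesis using Km[of c] cC C_sub C_sg sg_pow by (auto simp: D_def v_def)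
      qed
      have wP: "w \<in> powers x"
      proof -
        have "c [^] (m * s) = (c [^] m) [^] s" using cc by (simp add: nat_pow_pow)
        then show ?thesis using mP[of c] cC C_sub P_sg sg_pow sg_inv unfolding w_def by (metis subsetD)
      qed
      have bkc: "b = k [^] j \<otimes> c" using bc kc by (simp add: c_def)
      have wc: "w \<in> carrier G" "v \<in> carrier G" using cc by (auto simp: w_def v_def)
      have "b = cj (k [^] j) w \<otimes> (k [^] j \<otimes> v)" using bkc vw wc kc by (simp add: cj_def m_assoc)
      moreover have "cj (k [^] j) w \<in> powers x" using K_normalizes_P wP kK K_sg sg_pow normalizesD by blast
      moreover have "k [^] j \<otimes> v \<in> H" using kH vD DH H by (auto simp: sg_mult sg_pow)
      ultimately show "b \<in> powers x <#> H" by (metis mem_set_mult)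
    qed
  qed
  have kC: "k \<notin> C"
  proof
    assume kC: "k \<in> C"
    obtain b where b: "b \<in> K" "b \<notin> C" using C_proper by metis
    obtain j :: nat where j: "cj b x = cj (k [^] j) x" using kact[OF b(1)] by blast
    have "k [^] j \<in> C" using kC C_sg sg_pow by blast
    then have "cj b x = x" using j by (simp add: C_def)
    then show False using b by (simp add: C_def)
  qed
  then have "cj k x \<noteq> x" using kK by (simp add: C_def)
  then have nc: "x \<otimes> k \<noteq> k \<otimes> x" using cj_fix_iff[OF kc xc] by auto
  \<comment> \<open>Inside the cyclic normal subgroup \<open>C\<close>, conjugation by
    \<open>g\<close> is a power map. For \<open>h \<notin> C\<close>,
    \<open>noncentral_normal\<close> writes the conjugate as \<open>u \<otimes> v\<close> with
    \<open>u \<in> powers x\<close> and \<open>v \<in> powers h\<close>; then \<open>u\<close> lies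
    in \<open>H\<close> and is trivial.\<close>
  have ded: "cj g h \<in> powers h" if g: "g \<in> H" and h: "h \<in> H" for g h
  proof (cases "h \<in> C")
    case True
    obtain c where c: "c \<in> C" "C = powers c" using C_cyclic by metis
    have cc: "c \<in> carrier G" using c Cc by blast
    have gK: "g \<in> K" and gc: "g \<in> carrier G" using g HK Kc by auto
    obtain i :: nat where i: "h = c [^] i" using True c by (metis powersE)
    obtain j :: nat where j: "cj g c = c [^] j" using C_normal[OF gK c(1)] c by (metis powersE)
    have "cj g h = h [^] j" using i j gc cc by (simp add: cj_pow nat_pow_pow mult.commute)
    then show ?thesis by simp
  next
    case False
    have hK: "h \<in> K" and gK: "g \<in> K" and hc: "h \<in> carrier G" using g h HK Kc by auto
    have ph: "powers h \<subseteq> H" "h \<in> powers h" using powers_subset[OF H h] hc by auto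
    have "h \<in> powers x <#> powers h" using subset_set_mult2[OF P_sg powers_sg[OF hc]] ph by blast
    then have "cj g h \<in> powers x <#> powers h" using noncentral_normal[OF hK False gK] by blast
    then obtain u v where uv: "u \<in> powers x" "v \<in> powers h" "cj g h = u \<otimes> v" by (auto simp: mem_set_mult)
    have "u \<otimes> v \<in> H" using uv cj_mem[OF H g h] by simp
    then have "u \<in> H" using sg_mult_iff2[OF H, of v u] uv ph P_sg by auto
    then have "u = \<one>" using uv PH by blast
    then show ?thesis using uv powers_sg[OF hc] by auto
  qed
  show ?thesis using that[OF H HK PH PHK _ ded] nc kH by blast
qed

text \<open>For \<open>r = 1\<close> the kernel is cyclic, its automorphisms commute, and the
  faithful action would make \<open>K\<close> abelian.\<close>

lemma kernel_rank:
  assumes q: "prime q" "card N = q ^ r"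
  shows "r > 1"
proof (rule ccontr)
  assume "\<not> r > 1"
  then have "r = 0 \<or> r = 1" by auto
  moreover have "r \<noteq> 0"
  proof
    assume "r = 0"
    then have "card N = 1" using q by simp
    then show False using N_nontrivial sg_one[OF ker_sg] by (metis card_1_singletonE singletonD)
  qed
  ultimately have cN: "card N = q" using q by simp
  obtain n where n: "n \<in> N" "n \<noteq> \<one>" using ex_n by metis
  have nc: "n \<in> carrier G" using n Nc by blast
  have "ord n dvd q" using ord_dvd_card[OF ker_sg n(1)] cN by simp
  moreover have "ord n \<noteq> 1" using n ord_eq_1[OF nc] by simp
  ultimately have "ord n = q" using q by (metis prime_nat_iff)
  then have Np: "powers n = N"
    using sg_card_eq[OF ker_sg powers_subset[OF ker_sg n(1)]] card_powers[OF nc] cN by simp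
  have "g \<otimes> h = h \<otimes> g" if g: "g \<in> K" and h: "h \<in> K" for g h
  proof -
    have "cj g (cj h n) = cj h (cj g n)"
      using powers_comm_action[OF nc, of g h n] g h Kc KN n Np by auto
    then show ?thesis using commute_if_actions_commute[OF g h n] by blast
  qed
  then show False using K_nonab by (auto simp: nonabelian_def)
qed

end

end

section \<open>The converse\<close>

text \<open>In the second claim the triple product is the inverse of \<open>x\<close>: conjugation
  in the quaternion group fixes or inverts each element. Both claims are checked on the
  table.\<close>

lemma q8_facts:
  assumes "x \<in> carrier Q8" "y \<in> carrier Q8"
  shows "q8_mult (q8_mult (q8_mult x x) x) x = (False, 0)"
    and "q8_mult y x = q8_mult x y \<or> q8_mult y x = q8_mult (q8_mult (q8_mult x x) x) y"
proof -
  obtain s u t v where e: "x = (s, u)" "y = (t, v)" by (cases x, cases y) auto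
  have uv: "u \<in> {0, 1, 2, 3}" "v \<in> {0, 1, 2, 3}" using assms e by (auto simp: Q8_def)
  show "q8_mult (q8_mult (q8_mult x x) x) x = (False, 0)"
    using uv(1) unfolding e by (elim insertE emptyE; cases s) (simp_all add: q8_mult_def q8_umul_def Let_def)
  show "q8_mult y x = q8_mult x y \<or> q8_mult y x = q8_mult (q8_mult (q8_mult x x) x) y"
    using uv unfolding e
    by (elim insertE emptyE; cases s; cases t) (simp_all add: q8_mult_def q8_umul_def Let_def)
qed

context fin_group
begin

lemma Q8_conj:
  assumes Q: "subgroup Q G" and iso: "G\<lparr>carrier := Q\<rparr> \<cong> Q8" and vw: "v \<in> Q" "w \<in> Q"
  shows "v [^] (4::nat) = \<one>" "cj w v = v \<or> cj w v = v [^] (3::nat)"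
proof -
  obtain f where f: "f \<in> iso (G\<lparr>carrier := Q\<rparr>) Q8" using iso by (auto simp: is_iso_def)
  have fh: "f (a \<otimes> b) = q8_mult (f a) (f b)" if "a \<in> Q" "b \<in> Q" for a b
    using f that by (auto simp: iso_def hom_def Q8_def)
  have fc: "f a \<in> carrier Q8" if "a \<in> Q" for a using f that by (auto simp: iso_def hom_def)
  have inj: "a = b" if "a \<in> Q" "b \<in> Q" "f a = f b" for a b
    using f that by (auto simp: iso_def bij_betw_def inj_on_def)
  have c: "v \<in> carrier G" "w \<in> carrier G" using vw Q by auto
  have m: "v \<otimes> v \<in> Q" "v \<otimes> v \<otimes> v \<in> Q" "v \<otimes> v \<otimes> v \<otimes> v \<in> Q" "w \<otimes> v \<in> Q" "v \<otimes> w \<in> Q" "v \<otimes> v \<otimes> v \<otimes> w \<in> Q"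
    using vw Q by (simp_all add: sg_mult)
  define e where "e = v \<otimes> v \<otimes> v \<otimes> v"
  have eQ: "e \<in> Q" using m e_def by simp
  have fe: "f e = (False, 0)" unfolding e_def using q8_facts(1)[OF fc fc] vw m by (simp add: fh)
  have "f (e \<otimes> e) = f e" using fh[OF eQ eQ] fe by (simp add: q8_mult_def q8_umul_def Let_def)
  then have "e \<otimes> e = e" using inj[OF sg_mult[OF Q eQ eQ] eQ] by simp
  then have "e = \<one>" using eQ Q by (metis l_cancel_one sgD)
  then show "v [^] (4::nat) = \<one>" using c by (simp add: e_def numeral_eq_Suc)
  have "f (w \<otimes> v) = f (v \<otimes> w) \<or> f (w \<otimes> v) = f (v \<otimes> v \<otimes> v \<otimes> w)"
    using q8_facts(2)[OF fc[OF vw(1)] fc[OF vw(2)]] vw m by (simp add: fh)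
  then have "w \<otimes> v = v \<otimes> w \<or> w \<otimes> v = v \<otimes> v \<otimes> v \<otimes> w" using inj m by blast
  moreover have "v \<otimes> v \<otimes> v = v [^] (3::nat)" using c by (simp add: numeral_eq_Suc)
  ultimately have "w \<otimes> v = v \<otimes> w \<or> w \<otimes> v = v [^] (3::nat) \<otimes> w" by simp
  then show "cj w v = v \<or> cj w v = v [^] (3::nat)"
    using c by (auto simp: cj_def inv_solve_right')
qed

text \<open>The exponent \<open>1 + 2 * n\<close> is congruent to 3 modulo 4, since \<open>n\<close>
  is odd, and to 1 modulo \<open>n\<close>.\<close>

lemma cube_in_powers:
  assumes c: "v \<in> carrier G" "b \<in> carrier G" and comm: "v \<otimes> b = b \<otimes> v"
    and v: "v [^] (4::nat) = \<one>" and b: "b [^] n = \<one>" "odd (n::nat)"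
  shows "v [^] (3::nat) \<otimes> b \<in> powers (v \<otimes> b)"
proof -
  obtain j where j: "n = 2 * j + 1" using b(2) by (auto elim: oddE)
  have "1 + 2 * n = 4 * j + 3" using j by simp
  then have "v [^] (1 + 2 * n) = (v [^] (4::nat)) [^] j \<otimes> v [^] (3::nat)"
    using c by (simp only: nat_pow_pow nat_pow_mult)
  then have v3: "v [^] (1 + 2 * n) = v [^] (3::nat)" using v c by simp
  have "b [^] (1 + 2 * n) = b [^] (1::nat) \<otimes> (b [^] n) [^] (2::nat)"
    using c by (simp only: nat_pow_pow nat_pow_mult mult.commute)
  then have b1: "b [^] (1 + 2 * n) = b" using b c by simp
  have "(v \<otimes> b) [^] (1 + 2 * n) = v [^] (3::nat) \<otimes> b"
    using pow_mult_distrib[OF comm c, of "1 + 2 * n"] v3 b1 by simp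
  then show ?thesis by (metis pow_mem_powers)
qed

lemma cyclic_groupD:
  assumes P: "subgroup P G" and cyc: "cyclic_group (G\<lparr>carrier := P\<rparr>)"
  obtains c where "c \<in> P" "P = powers c"
proof -
  interpret P: group "G\<lparr>carrier := P\<rparr>" using P by (rule subgroup_imp_group)
  obtain c where c: "c \<in> P" "P = range (\<lambda>n::int. c [^]\<^bsub>G\<lparr>carrier := P\<rparr>\<^esub> n)"
    using cyc by (auto simp: P.cyclic_group)
  have cc: "c \<in> carrier G" using c P by auto
  have "c [^] n \<in> powers c" for n :: int using int_pow_mem_powers[OF cc] .
  moreover have "c [^]\<^bsub>G\<lparr>carrier := P\<rparr>\<^esub> n = c [^] n" for n :: int
    using int_pow_consistent[OF P c(1)] by simp
  ultimately have "P \<subseteq> powers c" using c(2) by auto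
  then show ?thesis using that[OF c(1)] powers_subset[OF P c(1)] by blast
qed

lemma powers_comm: "x \<in> carrier G \<Longrightarrow> a \<in> powers x \<Longrightarrow> b \<in> powers x \<Longrightarrow> a \<otimes> b = b \<otimes> a"
  by (auto elim!: powersE simp: nat_pow_mult add.commute)

text \<open>The factor \<open>b\<close> of odd order lets one statement serve both alternatives:
  \<open>b\<close> runs through the cyclic Sylow subgroup when the complement is a direct product,
  and is \<open>\<one>\<close> in the other case. It is absorbed, with the odd cyclic part of
  \<open>h\<close>, into the odd-order factor of \<open>cube_in_powers\<close>.\<close>

lemma Q8_times_odd_cyclic_dedekind:
  assumes H: "Q8_times_odd_cyclic G H" and B: "b \<in> carrier G" "b [^] n = \<one>" "odd (n::nat)"
    and comm: "\<And>h. h \<in> H \<Longrightarrow> b \<otimes> h = h \<otimes> b" and gh: "g \<in> H" "h \<in> H"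
  shows "cj g h \<otimes> b \<in> powers (h \<otimes> b)"
proof -
  obtain Q C where QC: "int_direct G Q C H" "G\<lparr>carrier := Q\<rparr> \<cong> Q8" "cyclic_group (G\<lparr>carrier := C\<rparr>)" "odd (card C)"
    using H by (auto simp: Q8_times_odd_cyclic_def)
  have Q: "subgroup Q G" and C: "subgroup C G" and cm: "\<And>a b. a \<in> Q \<Longrightarrow> b \<in> C \<Longrightarrow> a \<otimes> b = b \<otimes> a"
    and e: "Q <#> C = H" using QC(1) by (auto simp: int_direct_def)
  obtain c0 where c0: "c0 \<in> C" "C = powers c0" using cyclic_groupD[OF C QC(3)] by metis
  obtain w d where wd: "w \<in> Q" "d \<in> C" "g = w \<otimes> d" using gh e by (auto simp: mem_set_mult)
  obtain v c where vc: "v \<in> Q" "c \<in> C" "h = v \<otimes> c" using gh e by (auto simp: mem_set_mult)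
  have cc: "w \<in> carrier G" "d \<in> carrier G" "v \<in> carrier G" "c \<in> carrier G" "c0 \<in> carrier G"
    using wd vc Q C c0 by auto
  have vH: "v \<in> H" and cH: "c \<in> H" using subset_set_mult1[OF Q C] subset_set_mult2[OF Q C] vc e by auto
  have "cj d v = v" using cm vc wd cc by (simp add: cj_fix_iff)
  moreover have "cj d c = c" using powers_comm[OF cc(5)] c0(2) vc wd cc by (simp add: cj_fix_iff)
  moreover have "cj w c = c" using cm vc wd cc by (simp add: cj_fix_iff)
  ultimately have gh': "cj g h = cj w v \<otimes> c" using wd vc cc by (simp add: cj_mult flip: cj_cj)
  have bc: "c \<otimes> b \<in> carrier G" using cc B by simp
  have "(c \<otimes> b) [^] (card C * n) = c [^] (card C * n) \<otimes> b [^] (card C * n)"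
    using pow_mult_distrib[of c b] comm[OF cH] cc B by simp
  also have "\<dots> = (c [^] card C) [^] n \<otimes> (b [^] n) [^] card C"
    unfolding nat_pow_pow[OF cc(4)] nat_pow_pow[OF B(1)] by (simp add: mult.commute)
  also have "\<dots> = \<one>" using sg_pow_card[OF C vc(2)] B by simp
  finally have o: "(c \<otimes> b) [^] (card C * n) = \<one>" .
  have vcb: "v \<otimes> (c \<otimes> b) = (c \<otimes> b) \<otimes> v"
    using cm[OF vc(1,2)] comm[OF vH] cc B by (metis m_assoc)
  have "v [^] (3::nat) \<otimes> (c \<otimes> b) \<in> powers (v \<otimes> (c \<otimes> b))"
    using cube_in_powers[OF cc(3) bc vcb Q8_conj(1)[OF Q QC(2) vc(1,1)] o] QC(4) B(3) by simp
  moreover have "v \<otimes> (c \<otimes> b) \<in> powers (v \<otimes> (c \<otimes> b))" using cc bc by simp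
  ultimately have "cj w v \<otimes> (c \<otimes> b) \<in> powers (v \<otimes> (c \<otimes> b))" using Q8_conj(2)[OF Q QC(2) vc(1) wd(1)] by auto
  then show ?thesis using gh' vc cc B by (simp add: m_assoc)
qed

lemma frobenius_frob_compl:
  assumes "frobenius G N K"
  shows "frob_compl (carrier G) K"
  unfolding frob_compl_def
proof (intro conjI ballI impI)
  show K: "subgroup K G" using assms by (simp add: frobenius_def)
  then show "K \<subseteq> carrier G" by (rule sg_carrier)
  fix g h assume g: "g \<in> carrier G" and h: "h \<in> K" "h \<noteq> \<one> \<and> cj g h \<in> K"
  show "g \<in> K"
  proof (rule ccontr)
    assume "g \<notin> K"
    then have "inv g \<in> carrier G - K" using g K by (simp add: sg_inv_iff)
    then have "K \<inter> conj_set G K (inv g) = {\<one>}" using assms by (auto simp: frobenius_def)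
    moreover have "cj g h \<in> conj_set G K (inv g)" using h g by (auto simp: conj_set_def cj_def)
    ultimately have "cj g h = \<one>" using h by blast
    then show False using h g K by auto
  qed
qed (rule subgroup_self)

text \<open>The common core of both alternatives. After conjugation \<open>x \<in> L\<close>, and by
  irreducibility \<open>L \<inter> N\<close> is \<open>N\<close> or trivial. If
  \<open>N \<subseteq> L\<close>, then \<open>L\<close> is generated by \<open>N\<close> and
  \<open>L \<inter> K\<close>, which is normal in \<open>K\<close> by \<open>over\<close>, so
  \<open>L\<close> is normal. Otherwise \<open>L\<close> lies in \<open>K\<close> and is normal
  there, and the Frobenius property of \<open>K\<close> gives TI.\<close>

lemma frobenius_TI:
  assumes fr: "frobenius G N K" and sd: "int_semidirect G N K (carrier G)" and ea: "elem_abelian G N q r"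
    and p: "prime p" "prime q" "q \<noteq> p" and x: "x \<in> K" "ord x = p"
    and Px: "\<And>g. g \<in> K \<Longrightarrow> cj g x \<in> powers x"
    and uniq: "\<And>y. y \<in> K \<Longrightarrow> ord y = p \<Longrightarrow> y \<in> powers x"
    and irr: "irreducible_on G (powers x) N"
    and over: "\<And>U. subgroup U G \<Longrightarrow> powers x \<subseteq> U \<Longrightarrow> U \<subseteq> K \<Longrightarrow> normalizes K U"
    and L: "subgroup L G" "p dvd card L"
  shows "ti (carrier G) L"
proof -
  note fc = frobenius_frob_compl[OF fr]
  note K = frob_complD(2)[OF fc] and fK = frob_complD(4)[OF fc]
  have Kc: "k \<in> carrier G" if "k \<in> K" for k using that K by auto
  have xc: "x \<in> carrier G" using x Kc by blast
  have x1: "x \<noteq> \<one>" using x p by auto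
  have N: "subgroup N G" and Nn: "normalizes (carrier G) N" and NK: "N <#> K = carrier G"
    using sd normal_relative_iff[OF subgroup_self] by (auto simp: int_semidirect_def)
  have Nc: "k \<in> carrier G" if "k \<in> N" for k using that N by auto
  have px: "subgroup (powers x) G" "powers x \<subseteq> K" "x \<in> powers x"
    using powers_sg[OF xc] powers_subset[OF K x(1)] xc by auto
  have main: "ti (carrier G) L" if L: "subgroup L G" "x \<in> L" for L
  proof -
    have PL: "powers x \<subseteq> L" using powers_subset[OF L] .
    have LN: "subgroup (L \<inter> N) G" using L N sg_Int by blast
    have Lc: "l \<in> carrier G" if "l \<in> L" for l using that L by auto
    have "\<forall>a\<in>powers x. \<forall>y\<in>L \<inter> N. a \<otimes> y \<otimes> inv a \<in> L \<inter> N"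
      using PL cj_mem[OF L(1)] normalizesD[OF Nn] px sgD[OF px(1)] unfolding cj_def[symmetric] by blast
    then have "L \<inter> N = {\<one>} \<or> L \<inter> N = N" using irr LN unfolding irreducible_on_def by blast
    then show ?thesis
    proof
      assume LN: "L \<inter> N = N"
      then have NL: "N \<subseteq> L" by blast
      have nK: "normalizes K (L \<inter> K)" using over[of "L \<inter> K"] L K PL px sg_Int by blast
      have "cj g l \<in> L" if g: "g \<in> carrier G" and l: "l \<in> L" for g l
      proof -
        obtain n k where nk: "n \<in> N" "k \<in> K" "g = n \<otimes> k" using g NK by (metis mem_set_mult)
        obtain n' u where nu: "n' \<in> N" "u \<in> K" "l = n' \<otimes> u" using Lc[OF l] NK by (metis mem_set_mult)
        have c: "n \<in> carrier G" "k \<in> carrier G" "n' \<in> carrier G" "u \<in> carrier G" using nk nu Kc Nc by auto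
        have "u \<in> L" using sg_mult_iff1[OF L(1), of n' u] nu l NL c by auto
        then have "cj k u \<in> L" using nK nk nu normalizesD by blast
        moreover have "cj k n' \<in> L" using Nn c nu NL normalizesD by blast
        ultimately have "cj k l \<in> L" using nu c L by (simp add: cj_mult sg_mult)
        then have "cj n (cj k l) \<in> L" using cj_mem[OF L(1)] nk NL by blast
        then show ?thesis using nk c Lc[OF l] by (simp add: cj_cj)
      qed
      then show ?thesis by (auto simp: ti_def)
    next
      assume LN: "L \<inter> N = {\<one>}"
      \<comment> \<open>Write \<open>l = n \<otimes> k\<close>. The \<open>N\<close>-part of
        \<open>cj l x\<close> lies in \<open>L \<inter> N\<close> and is trivial, so
        \<open>cj l x\<close> stays in \<open>K\<close>, which forces
        \<open>l \<in> K\<close>.\<close>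
      have LK: "l \<in> K" if l: "l \<in> L" for l
      proof -
        obtain n k where nk: "n \<in> N" "k \<in> K" "l = n \<otimes> k" using Lc[OF l] NK by (metis mem_set_mult)
        define w where "w = cj k x"
        have wP: "w \<in> powers x" using Px nk by (simp add: w_def)
        have c: "n \<in> carrier G" "k \<in> carrier G" "w \<in> carrier G" using nk Kc Nc wP px by auto
        have e: "cj l x = (n \<otimes> cj w (inv n)) \<otimes> w" using nk c xc by (simp add: w_def flip: cj_cj) (simp add: cj_def m_assoc)
        have "cj l x \<in> L" using cj_mem[OF L(1) l L(2)] .
        then have "n \<otimes> cj w (inv n) \<in> L"
          using e sg_mult_iff2[OF L(1), of w "n \<otimes> cj w (inv n)"] wP PL c by auto
        moreover have "n \<otimes> cj w (inv n) \<in> N" using N nk c Nn by (simp add: normalizesD sg_mult sg_inv)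
        ultimately have "n \<otimes> cj w (inv n) = \<one>" using LN by blast
        then have "cj l x \<in> K" using e c wP px by auto
        then show ?thesis using fK[OF Lc[OF l] x(1) x1] by blast
      qed
      then have nL: "normalizes K L" using over[OF L(1) PL] by blast
      have "cj g v \<in> L" if "g \<in> carrier G" "u \<in> L" "u \<noteq> \<one>" "cj g u \<in> L" "v \<in> L" for g u v
        using fK[of g u] that LK nL normalizesD by blast
      then show ?thesis by (auto simp: ti_def)
    qed
  qed
  obtain y where y: "y \<in> L" "ord y = p" using cauchy[OF L(1) p(1) L(2)] by metis
  have yc: "y \<in> carrier G" using y L by auto
  \<comment> \<open>\<open>N\<close> has exponent \<open>q \<noteq> p\<close>. An element outside
    the kernel has a conjugate in \<open>K\<close>; for \<open>y\<close> that conjugate generates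
    \<open>powers x\<close>, so the corresponding conjugate of \<open>L\<close> contains
    \<open>x\<close>.\<close>
  have "y \<notin> N"
  proof
    assume "y \<in> N"
    then have "y [^] q = \<one>" using ea by (auto simp: elem_abelian_def)
    then have "p dvd q" using pow_eq_id[OF yc] y by simp
    then show False using p primes_dvd_imp_eq by blast
  qed
  moreover have "N = (carrier G - (\<Union>g \<in> carrier G. conj_set G K g)) \<union> {\<one>}" using fr by (simp add: frobenius_def)
  ultimately obtain g where g: "g \<in> carrier G" "y \<in> conj_set G K g" using yc by blast
  then obtain k where k: "k \<in> K" "y = inv g \<otimes> k \<otimes> g" by (auto simp: conj_set_def)
  have kc: "k \<in> carrier G" using k Kc by blast
  have yk: "y = cj (inv g) k" using k g kc by (simp add: cj_def)
  then have ky: "cj g y = k" using g kc by simp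
  have ok: "ord k = p"
  proof -
    have "k [^] n = \<one> \<longleftrightarrow> y [^] n = \<one>" for n :: nat using g kc yk by (simp flip: cj_pow)
    then show ?thesis using ord_unique[OF kc] pow_eq_id[OF yc] y by simp
  qed
  have "k \<noteq> \<one>" using ok p by auto
  then have "powers k = powers x" using prime_ord_powers_eq(1)[OF xc _ uniq[OF k(1) ok]] x p by simp
  then have xk: "x \<in> powers k" using px by simp
  define L' where "L' = cj g ` L"
  have Lc: "l \<in> carrier G" if "l \<in> L" for l using that L by auto
  have L': "subgroup L' G"
  proof (rule finite_subgroupI)
    show "L' \<subseteq> carrier G" using Lc g by (auto simp: L'_def)
    show "\<one> \<in> L'" unfolding L'_def using sg_one[OF L(1)] g by (intro image_eqI[of _ _ \<one>]) auto
    fix a b assume "a \<in> L'" "b \<in> L'"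
    then obtain u v where uv: "u \<in> L" "v \<in> L" "a = cj g u" "b = cj g v" by (auto simp: L'_def)
    then have "a \<otimes> b = cj g (u \<otimes> v)" using Lc g by (simp add: cj_mult)
    then show "a \<otimes> b \<in> L'" unfolding L'_def using uv sg_mult[OF L(1)] by blast
  qed
  have "k \<in> L'" using ky y by (auto simp: L'_def)
  then have "x \<in> L'" using powers_subset[OF L'] xk by blast
  then have t: "ti (carrier G) L'" using main L' by blast
  have "cj h v \<in> L" if h: "h \<in> carrier G" and u: "u \<in> L" "u \<noteq> \<one>" "cj h u \<in> L" and v: "v \<in> L" for h u v
  proof -
    have cc: "cj (cj g h) (cj g w) = cj g (cj h w)" if "w \<in> L" for w
      using that h g Lc by (simp add: cj_cj) (simp add: cj_def m_assoc)
    have "cj g u \<in> L'" "cj g u \<noteq> \<one>" "cj (cj g h) (cj g u) \<in> L'" "cj g v \<in> L'"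
      using u v g Lc cc by (auto simp: L'_def)
    then have "cj (cj g h) (cj g v) \<in> L'" using tiD[OF t, of "cj g h" "cj g u" "cj g v"] g h by simp
    then have "cj g (cj h v) \<in> L'" using cc v by simp
    then obtain l where "l \<in> L" "cj g (cj h v) = cj g l" by (auto simp: L'_def)
    then show ?thesis using g h v Lc by simp
  qed
  then show ?thesis by (auto simp: ti_def)
qed

text \<open>All subgroups of the complement are normal in it: \<open>conjK\<close> combines the
  cyclic factor, of odd order because \<open>p > 2\<close>, with the Dedekind group
  \<open>H\<close>. The elements of order \<open>p\<close> lie in \<open>P\<close>, since
  \<open>p\<close> does not divide the order of \<open>H\<close>.\<close>

lemma case2_TI:
  assumes p: "prime p" "p > 2" "p dvd order G" and q: "prime q" "q \<noteq> p" and ea: "elem_abelian G N q r"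
    and sd: "int_semidirect G N K (carrier G)" and fr: "frobenius G N K" and dir: "int_direct G P H K"
    and syl: "sylow_subgroup G p P" and cyc: "cyclic_group (G\<lparr>carrier := P\<rparr>)" and H8: "Q8_times_odd_cyclic G H"
    and irr: "\<And>Z. subgroup Z G \<Longrightarrow> Z \<subseteq> P \<Longrightarrow> Z \<noteq> {\<one>} \<Longrightarrow> irreducible_on G Z N"
    and L: "subgroup L G" "p dvd card L"
  shows "ti (carrier G) L"
proof -
  have K: "subgroup K G" using fr by (simp add: frobenius_def)
  have P: "subgroup P G" and H: "subgroup H G" and cm: "\<And>a b. a \<in> P \<Longrightarrow> b \<in> H \<Longrightarrow> a \<otimes> b = b \<otimes> a"
    and PH: "P \<inter> H = {\<one>}" "P <#> H = K" using dir by (auto simp: int_direct_def)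
  have o0: "order G \<noteq> 0" using finite_carrier carrier_not_empty by (simp add: order_def)
  define e where "e = multiplicity p (order G)"
  have pu: "\<not> is_unit p" using p not_prime_unit by blast
  have e0: "e > 0" using p o0 by (simp add: e_def prime_multiplicity_gt_zero_iff)
  have cP: "card P = p ^ e" using syl by (simp add: sylow_subgroup_def e_def)
  have pP: "p dvd card P" using cP e0 by simp
  have cK: "card K = card P * card H" using card_set_mult[OF P H PH(1)] PH(2) by simp
  have pH: "\<not> p dvd card H"
  proof
    assume "p dvd card H"
    then have "p ^ e * p dvd card K" using cK cP by (simp add: mult_dvd_mono)
    then have "p ^ Suc e dvd order G"
      using sg_card_dvd[OF K subgroup_self sg_carrier[OF K]] by (metis dvd_trans order_def power_Suc2)
    then show False using o0 pu unfolding e_def by (metis not_less_eq_eq order_refl power_dvd_iff_le_multiplicity)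
  qed
  obtain c where c: "c \<in> P" "P = powers c" using cyclic_groupD[OF P cyc] by metis
  have cc: "c \<in> carrier G" using c P by auto
  obtain x where x: "x \<in> P" "ord x = p" using cauchy[OF P p(1) pP] by metis
  have PK: "P \<subseteq> K" and HK: "H \<subseteq> K" using subset_set_mult1[OF P H] subset_set_mult2[OF P H] PH by auto
  have Pc: "a \<in> carrier G" if "a \<in> P" for a using that P by auto
  have Hc: "a \<in> carrier G" if "a \<in> H" for a using that H by auto
  have Pcomm: "a \<otimes> b = b \<otimes> a" if "a \<in> P" "b \<in> P" for a b using powers_comm[OF cc] that c by simp
  have conjK: "cj g u \<in> powers u" if g: "g \<in> K" and u: "u \<in> K" for g u
  proof -
    obtain a h where ah: "a \<in> P" "h \<in> H" "g = a \<otimes> h" using g PH by (metis mem_set_mult)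
    obtain b k where bk: "b \<in> P" "k \<in> H" "u = b \<otimes> k" using u PH by (metis mem_set_mult)
    have c4: "a \<in> carrier G" "h \<in> carrier G" "b \<in> carrier G" "k \<in> carrier G" using ah bk Pc Hc by auto
    have hk: "cj h k \<in> H" using cj_mem[OF H ah(2) bk(2)] .
    have "cj h b = b" "cj a b = b" "cj a (cj h k) = cj h k"
      using cm[OF bk(1) ah(2)] Pcomm[OF ah(1) bk(1)] cm[OF ah(1) hk] c4 by (simp_all add: cj_fix_iff)
    then have "cj g u = b \<otimes> cj h k" using ah bk c4 by (simp add: cj_mult flip: cj_cj)
    also have "\<dots> = cj h k \<otimes> b" using cm[OF bk(1) hk] .
    finally have e: "cj g u = cj h k \<otimes> b" .
    have "cj h k \<otimes> b \<in> powers (k \<otimes> b)"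
    proof (rule Q8_times_odd_cyclic_dedekind[OF H8 c4(3) _ _ _ ah(2) bk(2)])
      show "b [^] card P = \<one>" using sg_pow_card[OF P bk(1)] .
      show "odd (card P)" using cP p prime_odd_nat[OF p(1)] by simp
      show "b \<otimes> h = h \<otimes> b" if "h \<in> H" for h using cm[OF bk(1) that] .
    qed
    moreover have "k \<otimes> b = u" using bk(3) cm[OF bk(1,2)] by simp
    ultimately show ?thesis using e by simp
  qed
  show ?thesis
  proof (rule frobenius_TI[OF fr sd ea p(1) q _ x(2) _ _ _ _ L])
    show "x \<in> K" using x PK by auto
    show "cj g x \<in> powers x" if "g \<in> K" for g using conjK[OF that] x PK by auto
    show "irreducible_on G (powers x) N"
    proof (rule irr)
      show "subgroup (powers x) G" "powers x \<subseteq> P" using powers_sg[OF Pc[OF x(1)]] powers_subset[OF P x(1)] .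
      have "x \<noteq> \<one>" using x p by auto
      then show "powers x \<noteq> {\<one>}" using self_mem_powers[OF Pc[OF x(1)]] by auto
    qed
    show "normalizes K U" if U: "subgroup U G" "U \<subseteq> K" for U
      using conjK U powers_subset[OF U(1)] unfolding normalizes_def by blast
    show "y \<in> powers x" if y: "y \<in> K" "ord y = p" for y
    proof -
      obtain b k where bk: "b \<in> P" "k \<in> H" "y = b \<otimes> k" using y PH by (metis mem_set_mult)
      have c2: "b \<in> carrier G" "k \<in> carrier G" "y \<in> carrier G" using bk Pc Hc by auto
      have "b [^] p \<otimes> k [^] p = \<one>" using pow_mult_distrib[OF cm[OF bk(1,2)] c2(1,2), of p] bk(3) pow_ord_eq_1[OF c2(3)] y by simp
      then have "\<one> \<otimes> \<one> = b [^] p \<otimes> k [^] p" by simp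
      then have "k [^] p = \<one>"
        using mult_eq_mult_imp(2)[OF P H PH(1) sg_one[OF P] _ sg_one[OF H]] bk P H sg_pow by metis
      then have "ord k dvd p" using pow_eq_id[OF c2(2)] by blast
      moreover have "ord k \<noteq> p" using ord_dvd_card[OF H bk(2)] pH by auto
      ultimately have "k = \<one>" using ord_eq_1[OF c2(2)] p by (metis prime_nat_iff)
      then have "y \<in> P" using bk c2 by simp
      then show ?thesis using cyclic_prime_ord_unique[OF cc p(1)] x y c by simp
    qed
  qed
qed

text \<open>Subgroups of the complement that contain \<open>P\<close> are normal, since
  \<open>H\<close> is Dedekind and \<open>P\<close> is normal. A second subgroup of order
  \<open>p\<close> would give a subgroup of order \<open>p * p\<close>, against the Sylow
  condition.\<close>

lemma case3_TI:
  assumes p: "prime p" and q: "prime q" "q \<noteq> p" and ea: "elem_abelian G N q r"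
    and sd: "int_semidirect G N K (carrier G)" and fr: "frobenius G N K" and sdP: "int_semidirect G P H K"
    and syl: "sylow_subgroup G p P" "card P = p"
    and HH: "cyclic_group (G\<lparr>carrier := H\<rparr>) \<or> Q8_times_odd_cyclic G H"
    and irr: "irreducible_on G P N"
    and L: "subgroup L G" "p dvd card L"
  shows "ti (carrier G) L"
proof -
  have K: "subgroup K G" using fr by (simp add: frobenius_def)
  have P: "subgroup P G" and H: "subgroup H G" and Pn: "normalizes K P"
    and PH: "P \<inter> H = {\<one>}" "P <#> H = K"
    using sdP normal_relative_iff[OF K] by (auto simp: int_semidirect_def)
  have o0: "order G \<noteq> 0" using finite_carrier carrier_not_empty by (simp add: order_def)
  have pu: "\<not> is_unit p" using p not_prime_unit by blast
  have m1: "multiplicity p (order G) = 1"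
    using syl p prime_gt_1_nat[of p] power_inject_exp[of p "multiplicity p (order G)" 1] by (simp add: sylow_subgroup_def)
  have cK: "card K = p * card H" using card_set_mult[OF P H PH(1)] PH(2) syl by simp
  have pp: "\<not> p ^ 2 dvd card K"
  proof
    assume "p ^ 2 dvd card K"
    then have "p ^ 2 dvd order G"
      using sg_card_dvd[OF K subgroup_self sg_carrier[OF K]] by (metis dvd_trans order_def)
    then have "2 \<le> multiplicity p (order G)" using o0 pu by (simp add: power_dvd_iff_le_multiplicity)
    then show False using m1 by simp
  qed
  have "p dvd card P" using syl by simp
  then obtain x where x: "x \<in> P" "ord x = p" using cauchy[OF P p] by metis
  have xc: "x \<in> carrier G" using x P by auto
  have Px: "P = powers x"
    using sg_card_eq[OF P powers_subset[OF P x(1)]] card_powers[OF xc] x syl by simp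
  have PK: "P \<subseteq> K" and HK: "H \<subseteq> K" using subset_set_mult1[OF P H] subset_set_mult2[OF P H] PH by auto
  have Kc: "a \<in> carrier G" if "a \<in> K" for a using that K by auto
  have conjH: "cj g h \<in> powers h" if gh: "g \<in> H" "h \<in> H" for g h
    using HH
  proof
    assume "cyclic_group (G\<lparr>carrier := H\<rparr>)"
    then obtain c where c: "c \<in> H" "H = powers c" using cyclic_groupD[OF H] by metis
    then have "g \<otimes> h = h \<otimes> g" using powers_comm[of c g h] gh H by auto
    then have "cj g h = h" using cj_fix_iff[OF sgD[OF H gh(1)] sgD[OF H gh(2)]] by simp
    then show ?thesis using gh H by auto
  next
    assume "Q8_times_odd_cyclic G H"
    moreover have "\<one> \<otimes> h = h \<otimes> \<one>" if "h \<in> H" for h using that H by auto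
    ultimately have "cj g h \<otimes> \<one> \<in> powers (h \<otimes> \<one>)"
      using Q8_times_odd_cyclic_dedekind[of H \<one> 1 g h] gh by simp
    moreover have "g \<in> carrier G" "h \<in> carrier G" using gh H by auto
    ultimately show ?thesis by simp
  qed
  show ?thesis
  proof (rule frobenius_TI[OF fr sd ea p q _ x(2) _ _ _ _ L])
    show "x \<in> K" using x PK by auto
    show "cj g x \<in> powers x" if "g \<in> K" for g using Pn that x normalizesD unfolding Px by blast
    show "irreducible_on G (powers x) N" using irr Px by simp
    show "y \<in> powers x" if y: "y \<in> K" "ord y = p" for y
    proof (rule ccontr)
      assume n: "y \<notin> powers x"
      have yc: "y \<in> carrier G" using y Kc by blast
      have py: "subgroup (powers y) G" "powers y \<subseteq> K" using powers_sg[OF yc] powers_subset[OF K y(1)] .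
      have "powers y \<inter> P = {\<one>}" using prime_card_trivial_Int[OF yc _ P] y p n Px by simp
      then have "card (P <#> powers y) = p * p"
        using card_set_mult[OF P py(1)] card_powers[OF yc] y syl by (simp add: Int_commute)
      moreover have "subgroup (P <#> powers y) G"
        using subgroup_set_mult[OF P py(1) normalizes_mono[OF Pn py(2)]] .
      moreover have "P <#> powers y \<subseteq> K" using set_mult_subset[OF K PK py(2)] .
      ultimately have "p * p dvd card K" using sg_card_dvd[OF _ K] by metis
      then show False using pp by (simp add: power2_eq_square)
    qed
    show "normalizes K U" if U: "subgroup U G" "powers x \<subseteq> U" "U \<subseteq> K" for U
      unfolding normalizes_def
    proof (intro ballI)
      fix g u assume g: "g \<in> K" and u: "u \<in> U"
      obtain a h where ah: "a \<in> P" "h \<in> H" "g = a \<otimes> h" using g PH by (metis mem_set_mult)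
      obtain b k where bk: "b \<in> P" "k \<in> H" "u = b \<otimes> k" using u U PH by (metis mem_set_mult subsetD)
      have PU: "P \<subseteq> U" using U Px by simp
      have c4: "a \<in> carrier G" "h \<in> carrier G" "b \<in> carrier G" "k \<in> carrier G"
        using ah bk PK HK Kc by auto
      have kU: "k \<in> U" using sg_mult_iff1[OF U(1), of b k] bk u PU c4 by auto
      have "cj h k \<in> U" using conjH[OF ah(2) bk(2)] powers_subset[OF U(1) kU] by blast
      moreover have "cj h b \<in> U" using Pn ah bk HK PU normalizesD by blast
      ultimately have "cj h u \<in> U" using bk c4 U(1) by (simp add: cj_mult sg_mult)
      then have "cj a (cj h u) \<in> U" using cj_mem[OF U(1)] ah PU by blast
      then show "cj g u \<in> U" using ah c4 bk by (simp add: cj_cj)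
    qed
  qed
qed

section \<open>The forward implication, assembled from the structure of kernel and
  complement\<close>

lemma TI_or_subnormal_structure:
  assumes p: "prime p" and hyp: "hyp p (carrier G)"
    and bad: "subgroup U G" "nonabelian G U" "p dvd card U" "\<not> subnormal G U"
  shows "p > 2 \<and> (\<exists>N K P H q r. prime q \<and> q \<noteq> p \<and> r > 1 \<and> elem_abelian G N q r \<and>
            int_semidirect G N K (carrier G) \<and> frobenius G N K \<and>
            int_semidirect G P H K \<and> sylow_subgroup G p P \<and> card P = p \<and>
            (cyclic_group (G\<lparr>carrier := H\<rparr>) \<or> Q8_times_odd_cyclic G H) \<and>
            (\<exists>x \<in> P. \<exists>h \<in> H. x \<otimes> h \<noteq> h \<otimes> x) \<and> irreducible_on G P N)"
proof -
  have "\<not> snrm (carrier G) U" using bad snrm_carrier_iff by simp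
  then obtain K where K: "frob_compl (carrier G) K" "max_subgroup (carrier G) K" "nonabelian G K" "p dvd card K"
    using nonsubnormal_frobenius[OF subgroup_self hyp bad(1) sg_carrier[OF bad(1)] bad(2,3)] by metis
  then have Ks: "subgroup K G" "K \<subset> carrier G" by (auto simp: max_subgroup_def)
  have sK: "solv K" using hyp_imp_solv[OF p Ks(1) hyp_mono[OF hyp Ks(1)] K(4)] Ks(2) by blast
  note ker = frobenius_kernel[OF K(1) sK]
  interpret F: frob_TI_nonab G "carrier G" K p
    using K hyp p Ks ker
    by (simp add: frob_TI_nonab_def frob_TI_nonab_axioms_def frob_TI_def frob_TI_axioms_def fin_group_axioms psubset_eq)
  obtain x where x: "x \<in> K" "ord x = p" using F.ex_x by metis
  obtain q r where q: "prime q" "q \<noteq> p" "card F.N = q ^ r" using F.kernel_prime_power[OF x] by metis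
  obtain H where H: "subgroup H G" "H \<subseteq> K" "powers x \<inter> H = {\<one>}" "powers x <#> H = K"
    "\<exists>h\<in>H. x \<otimes> h \<noteq> h \<otimes> x" "\<And>g h. g \<in> H \<Longrightarrow> h \<in> H \<Longrightarrow> cj g h \<in> powers h"
    using F.complement_structure[OF x] by metis
  have "elem_abelian G F.N q r"
    using F.ker_sg F.N_comm F.kernel_exponent[OF x q(1,3)] q(3) unfolding elem_abelian_def by blast
  moreover have "int_semidirect G F.N K (carrier G)"
    using normal_relative_iff[OF subgroup_self] F.ker_sg F.N_sub F.Y_normalizes_N F.K_sg F.N_Int_K F.N_mult_K subgroup_self
    unfolding int_semidirect_def by blast
  moreover have "frobenius G F.N K"
  proof -
    have cs: "conj_set G K g = cj (inv g) ` K" if "g \<in> carrier G" for g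
      using that by (simp add: conj_set_def cj_def)
    have "K \<inter> conj_set G K g = {\<one>}" if g: "g \<in> carrier G - K" for g
    proof -
      have k1: "k = \<one>" if "k \<in> K" "cj (inv g) k \<in> K" for k
      proof (rule ccontr)
        assume "k \<noteq> \<one>"
        then have "inv g \<in> K" using frob_complD(4)[OF K(1), of "inv g" k] that g by auto
        then show False using g Ks(1) by (simp add: sg_inv_iff)
      qed
      have w1: "w = \<one>" if w: "w \<in> K" "w \<in> conj_set G K g" for w
      proof -
        obtain k where k: "k \<in> K" "w = cj (inv g) k" using w(2) cs g by auto
        then have "k = \<one>" using k1 w(1) by simp
        then show ?thesis using k(2) g by simp
      qed
      have "cj (inv g) \<one> \<in> conj_set G K g" using cs g sg_one[OF Ks(1)] by blast
      then have "\<one> \<in> conj_set G K g" using g by simp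
      then show ?thesis using w1 sg_one[OF Ks(1)] by blast
    qed
    moreover have "F.N = (carrier G - (\<Union>g \<in> carrier G. conj_set G K g)) \<union> {\<one>}"
    proof -
      have e: "y \<in> conj_set G K g \<longleftrightarrow> cj g y \<in> K" if "y \<in> carrier G" "g \<in> carrier G" for y g
      proof
        assume "y \<in> conj_set G K g"
        then obtain k where "k \<in> K" "y = cj (inv g) k" using cs \<open>g \<in> carrier G\<close> by auto
        then show "cj g y \<in> K" using that F.Kc by simp
      next
        assume "cj g y \<in> K"
        moreover have "y = cj (inv g) (cj g y)" using that by simp
        ultimately show "y \<in> conj_set G K g" using cs that by blast
      qed
      have "y \<in> F.N \<longleftrightarrow> y \<in> (carrier G - (\<Union>g \<in> carrier G. conj_set G K g)) \<union> {\<one>}" for y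
      proof (cases "y \<in> carrier G \<and> y \<noteq> \<one>")
        case True
        then have "y \<in> F.N \<longleftrightarrow> (\<forall>g\<in>carrier G. cj g y \<notin> K)" by (auto simp: frob_ker_def)
        then show ?thesis using True e by blast
      next
        case False
        then show ?thesis using F.Nc sg_one[OF F.ker_sg] by blast
      qed
      then show ?thesis by blast
    qed
    moreover have "K \<noteq> {\<one>}" using K(3) by (auto simp: nonabelian_def)
    ultimately show ?thesis using Ks unfolding frobenius_def by blast
  qed
  moreover have "int_semidirect G (powers x) H K"
    using normal_relative_iff[OF Ks(1)] F.P_sg[OF x] F.P_sub[OF x] F.K_normalizes_P[OF x] H Ks(1)
    unfolding int_semidirect_def by blast
  moreover have "sylow_subgroup G p (powers x)"
  proof -
    have o: "order G = card F.N * card K" using card_frob_ker[OF K(1)] by (simp add: order_def)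
    have "multiplicity p (order G) = 1"
    proof (rule multiplicity_eqI)
      show "p ^ 1 dvd order G" using o K(4) by simp
      show "\<not> p ^ Suc 1 dvd order G"
      proof
        assume "p ^ Suc 1 dvd order G"
        moreover have "coprime (p ^ Suc 1) (card F.N)"
          using F.p_not_dvd_N[OF x] p prime_imp_coprime by (metis coprime_power_left_iff)
        ultimately have "p ^ 2 dvd card K" using o by (simp add: coprime_dvd_mult_right_iff numeral_2_eq_2)
        then show False using F.p_square[OF x] by simp
      qed
    qed
    then show ?thesis using F.P_sg[OF x] F.P_card[OF x] by (simp add: sylow_subgroup_def)
  qed
  moreover have "cyclic_group (G\<lparr>carrier := H\<rparr>) \<or> Q8_times_odd_cyclic G H"
  proof (rule dedekind_fpf[OF H(1,6) F.ker_sg F.N_nontrivial F.N_comm])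
    show "cj a n \<in> F.N" if "a \<in> H" "n \<in> F.N" for a n using that H(2) F.KN by blast
    show "a = \<one>" if "a \<in> H" "n \<in> F.N" "n \<noteq> \<one>" "cj a n = n" for a n using that H(2) F.fixed_point_free' by blast
  qed
  moreover have "irreducible_on G (powers x) F.N"
    unfolding irreducible_on_def
  proof (intro allI impI, elim conjE)
    fix S assume S: "subgroup S G" "S \<subseteq> F.N" "\<forall>a\<in>powers x. \<forall>y\<in>S. a \<otimes> y \<otimes> inv a \<in> S"
    have "cj x d \<in> S" if "d \<in> S" for d using S(3) that F.x_P[OF x] by (simp add: cj_def)
    then show "S = {\<one>} \<or> S = F.N" using F.kernel_irreducible[OF x S(1,2)] by blast
  qed
  ultimately show ?thesis
    using q F.kernel_rank[OF x q(1,3)] F.p_gt_2[OF x] F.P_card[OF x] H(5) F.x_P[OF x] by blast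
qed

end

theorem theorem1p4:
  fixes G :: "('a, 'b) monoid_scheme" and p :: nat
  assumes "group G" and "finite (carrier G)" and "Factorial_Ring.prime p" and "p dvd order G"
  shows "(\<forall>H. subgroup H G \<and> nonabelian G H \<longrightarrow>
             TI_subgroup G H \<or> subnormal G H \<or> \<not> p dvd card H)
    \<longleftrightarrow>
         (\<forall>H. subgroup H G \<and> nonabelian G H \<and> p dvd card H \<longrightarrow> subnormal G H)
       \<or> (p > 2 \<and> (\<exists>N K P H q r. Factorial_Ring.prime q \<and> q \<noteq> p \<and> r > 1 \<and> elem_abelian G N q r \<and>
            int_semidirect G N K (carrier G) \<and> frobenius G N K \<and>
            int_direct G P H K \<and> sylow_subgroup G p P \<and> cyclic_group (G\<lparr>carrier := P\<rparr>) \<and>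
            Q8_times_odd_cyclic G H \<and>
            (\<forall>Y. subgroup Y G \<and> Y \<subseteq> P \<and> Y \<noteq> {\<one>\<^bsub>G\<^esub>} \<longrightarrow> irreducible_on G Y N)))
       \<or> (p > 2 \<and> (\<exists>N K P H q r. Factorial_Ring.prime q \<and> q \<noteq> p \<and> r > 1 \<and> elem_abelian G N q r \<and>
            int_semidirect G N K (carrier G) \<and> frobenius G N K \<and>
            int_semidirect G P H K \<and> sylow_subgroup G p P \<and> card P = p \<and>
            (cyclic_group (G\<lparr>carrier := H\<rparr>) \<or> Q8_times_odd_cyclic G H) \<and>
            (\<exists>x \<in> P. \<exists>h \<in> H. x \<otimes>\<^bsub>G\<^esub> h \<noteq> h \<otimes>\<^bsub>G\<^esub> x) \<and>
            irreducible_on G P N))"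
    (is "?L \<longleftrightarrow> ?A1 \<or> ?A2 \<or> ?A3")
proof -
  interpret fin_group G using assms by (simp add: fin_group_def fin_group_axioms_def)
  \<comment> \<open>In the second and third alternatives every subgroup of order divisible by
    \<open>p\<close> is TI, abelian or not.\<close>
  have TI_all: ?L if "\<And>U. subgroup U G \<Longrightarrow> p dvd card U \<Longrightarrow> ti (carrier G) U"
    using that TI_subgroup_iff by blast
  show ?thesis
  proof
    assume L: ?L
    have h: "hyp p (carrier G)"
      unfolding hyp_def using L TI_subgroup_iff snrm_carrier_iff by blast
    show "?A1 \<or> ?A2 \<or> ?A3"
    \<comment> \<open>The forward direction always ends in the first or the third
      alternative.\<close>
    proof (rule disjCI)
      assume "\<not> (?A2 \<or> ?A3)"
      then have n3: "\<not> ?A3" by blast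
      show ?A1
      proof (intro allI impI, elim conjE, rule ccontr)
        fix U assume "subgroup U G" "nonabelian G U" "p dvd card U" "\<not> subnormal G U"
        then show False using TI_or_subnormal_structure[OF assms(3) h] n3 by blast
      qed
    qed
  next
    assume "?A1 \<or> ?A2 \<or> ?A3"
    then show ?L
    proof (elim disjE)
      assume ?A1
      then show ?L by blast
    next
      assume a: ?A2
      then obtain N K P H q r where "Factorial_Ring.prime q" "q \<noteq> p" "elem_abelian G N q r"
            "int_semidirect G N K (carrier G)" "frobenius G N K"
            "int_direct G P H K" "sylow_subgroup G p P" "cyclic_group (G\<lparr>carrier := P\<rparr>)"
            "Q8_times_odd_cyclic G H"
            "\<And>Y. subgroup Y G \<Longrightarrow> Y \<subseteq> P \<Longrightarrow> Y \<noteq> {\<one>\<^bsub>G\<^esub>} \<Longrightarrow> irreducible_on G Y N" by blast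
      then show ?L using a assms by (intro TI_all case2_TI) auto
    next
      assume ?A3
      then obtain N K P H q r where "Factorial_Ring.prime q" "q \<noteq> p" "elem_abelian G N q r"
            "int_semidirect G N K (carrier G)" "frobenius G N K"
            "int_semidirect G P H K" "sylow_subgroup G p P" "card P = p"
            "cyclic_group (G\<lparr>carrier := H\<rparr>) \<or> Q8_times_odd_cyclic G H" "irreducible_on G P N" by blast
      then show ?L using assms(3) by (intro TI_all case3_TI)
    qed
  qed
qed

end
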